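(* Let $\Gamma$ be a non-elementary hyperbolic group endowed with a metric $d\in\mathcal{D}(\Gamma)$, and let $\mu_{PS}$ be the associated Patterson-Sullivan measure on $\partial\Gamma$. Define $J\colon\Gamma\to\overline{\Gamma}\times\overline{\Gamma}$ by $J(g)=(g,g^{-1})$. Then there exists a family $\{\mu_R : R\geq 0\}$ of probability measures on $\Gamma$ such that (1) $\lim_{R\to\infty} J_*\mu_R=\mu_{PS}\otimes\mu_{PS}$ in the weak-* topology on $C(\overline{\Gamma}\times\overline{\Gamma})^*$; (2) there exists $h>0$ such that for every $R\ge 0$ the measure $\mu_R$ is supported in the annulus $A_{R,h}$; (3) there exists a constant $C>0$, independent of $R$ and $g$, such that $\mu_R(\{g\})\leq C\,\omega^{-R}$ for all $R\ge 0$ and $g\in\Gamma$.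
   Context: $\Gamma$ is a (finitely generated) hyperbolic group; non-elementary means not virtually cyclic. $\mathcal{D}(\Gamma)$ is the class of all metrics $d$ on $\Gamma$ that are quasi-isometric to a word metric $d_S$ (i.e. $L^{-1}d_S-C\le d\le Ld_S+C$ for some $L\ge1$, $C\ge0$), left-invariant, and hyperbolic, meaning that there is a constant $\delta$ with $(x,y)\ge\min\{(x,z),(z,y)\}-\delta$ for all $x,y,z\in\Gamma$. Here $|g|=d(1,g)$ and $(x,y)=\frac12(|x|+|y|-d(x,y))$ is the Gromov product based at $1$. Annuli: $A_{R,h}=\{g\in\Gamma : |g|\in[R-h,R+h]\}$. $\omega=\lim_{R\to\infty}|\{g\in\Gamma:|g|\le R\}|^{1/R}$. Boundary: $(\Gamma,d)$ is roughly geodesic: there is a constant $K$ depending only on $(\Gamma,d)$ such that any $x,y\in\Gamma$ are joined by a map $\gamma\colon[0,\ell]\to\Gamma$ with $\gamma(0)=x$, $\gamma(\ell)=y$, $|d(\gamma(s),\gamma(t))-|s-t||\le K$. Roughly geodesic rays $[0,\infty)\to\Gamma$ are defined by the same inequality with a fixed constant. $\partial\Gamma$ is the set of roughly geodesic rays modulo the relation of being at bounded distance. The Gromov product extends to $\overline{\Gamma}=\Gamma\cup\partial\Gamma$ by $(\xi,\eta)=\inf\liminf_{t\to\infty}(\gamma_1(t),\gamma_2(t))$, the infimum being over representatives $\gamma_1,\gamma_2$ of $\xi,\eta$ (elements of $\Gamma$ are represented by constant maps). $\overline{\Gamma}$ is topologized as a compactification of the discrete set $\Gamma$, with $x_n\to\xi\in\partial\Gamma$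 iff $(x_n,\xi)\to\infty$. Fix $\epsilon>0$ small enough that there is a visual metric $d_\epsilon$ on $\partial\Gamma$, i.e. a metric with $C^{-1}e^{-\epsilon(\xi,\eta)}\le d_\epsilon(\xi,\eta)\le Ce^{-\epsilon(\xi,\eta)}$ for some $C>0$. $D$ is the Hausdorff dimension of $(\partial\Gamma,d_\epsilon)$, and $\mu_{PS}$ is the $D$-dimensional Hausdorff measure of $(\partial\Gamma,d_\epsilon)$ normalized to be a probability measure. $\mu_{PS}\otimes\mu_{PS}$ is regarded as a measure on $\overline{\Gamma}\times\overline{\Gamma}$ supported on $\partial\Gamma\times\partial\Gamma$. *)

theory Defs
  imports "HOL-Probability.Probability" "HOL-Algebra.Elementary_Groups"
begin

section \<open>Word metrics and hyperbolic groups\<close>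

definition word_length :: "('a, 'b) monoid_scheme \<Rightarrow> 'a set \<Rightarrow> 'a \<Rightarrow> nat" where
  "word_length G S g =
     (LEAST n. \<exists>ws. length ws = n \<and> set ws \<subseteq> S \<union> m_inv G ` S \<and>
        foldr (mult G) ws (one G) = g)"

definition word_metric :: "('a, 'b) monoid_scheme \<Rightarrow> 'a set \<Rightarrow> 'a \<Rightarrow> 'a \<Rightarrow> real" where
  "word_metric G S x y = real (word_length G S (mult G (m_inv G x) y))"

definition finite_generating_set :: "('a, 'b) monoid_scheme \<Rightarrow> 'a set \<Rightarrow> bool" where
  "finite_generating_set G S \<longleftrightarrow> finite S \<and> S \<subseteq> carrier G \<and> generate G S = carrier G"

definition gromov_product ::
  "('a, 'b) monoid_scheme \<Rightarrow> ('a \<Rightarrow> 'a \<Rightarrow> real) \<Rightarrow> 'a \<Rightarrow> 'a \<Rightarrow> real" where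
  "gromov_product G d x y = (d (one G) x + d (one G) y - d x y) / 2"

definition hyperbolic_metric :: "('a, 'b) monoid_scheme \<Rightarrow> ('a \<Rightarrow> 'a \<Rightarrow> real) \<Rightarrow> bool" where
  "hyperbolic_metric G d \<longleftrightarrow>
     (\<exists>\<delta>. \<forall>x\<in>carrier G. \<forall>y\<in>carrier G. \<forall>z\<in>carrier G.
        gromov_product G d x y \<ge> min (gromov_product G d x z) (gromov_product G d z y) - \<delta>)"

definition hyperbolic_group :: "('a, 'b) monoid_scheme \<Rightarrow> bool" where
  "hyperbolic_group G \<longleftrightarrow>
     group G \<and> (\<exists>S. finite_generating_set G S \<and> hyperbolic_metric G (word_metric G S))"

definition virtually_cyclic :: "('a, 'b) monoid_scheme \<Rightarrow> bool" where
  "virtually_cyclic G \<longleftrightarrow>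
     (\<exists>H. subgroup H G \<and> finite (RCOSETS G H) \<and> cyclic_group (G\<lparr>carrier := H\<rparr>))"

definition quasi_isometric_metrics ::
  "'a set \<Rightarrow> ('a \<Rightarrow> 'a \<Rightarrow> real) \<Rightarrow> ('a \<Rightarrow> 'a \<Rightarrow> real) \<Rightarrow> bool" where
  "quasi_isometric_metrics X d d' \<longleftrightarrow>
     (\<exists>L C. L \<ge> 1 \<and> C \<ge> 0 \<and>
        (\<forall>x\<in>X. \<forall>y\<in>X. inverse L * d' x y - C \<le> d x y \<and> d x y \<le> L * d' x y + C))"

text \<open>The class \<open>\<D>(\<Gamma>)\<close>.\<close>

definition group_metrics :: "('a, 'b) monoid_scheme \<Rightarrow> ('a \<Rightarrow> 'a \<Rightarrow> real) set" where
  "group_metrics G =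
     {d. Metric_space (carrier G) d \<and>
         (\<exists>S. finite_generating_set G S \<and>
              quasi_isometric_metrics (carrier G) d (word_metric G S)) \<and>
         (\<forall>g\<in>carrier G. \<forall>x\<in>carrier G. \<forall>y\<in>carrier G. d (mult G g x) (mult G g y) = d x y) \<and>
         hyperbolic_metric G d}"

definition annulus ::
  "('a, 'b) monoid_scheme \<Rightarrow> ('a \<Rightarrow> 'a \<Rightarrow> real) \<Rightarrow> real \<Rightarrow> real \<Rightarrow> 'a set" where
  "annulus G d R h = {g \<in> carrier G. d (one G) g \<in> {R - h..R + h}}"

definition growth_rate :: "('a, 'b) monoid_scheme \<Rightarrow> ('a \<Rightarrow> 'a \<Rightarrow> real) \<Rightarrow> real" where
  "growth_rate G d =
     Lim at_top (\<lambda>R::real. real (card {g \<in> carrier G. d (one G) g \<le> R}) powr (1 / R))"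


section \<open>The Gromov boundary and the compactification\<close>

definition roughly_geodesic_on :: "('a \<Rightarrow> 'a \<Rightarrow> real) \<Rightarrow> real \<Rightarrow> real set \<Rightarrow> (real \<Rightarrow> 'a) \<Rightarrow> bool" where
  "roughly_geodesic_on d K I \<gamma> \<longleftrightarrow> (\<forall>s\<in>I. \<forall>t\<in>I. \<bar>d (\<gamma> s) (\<gamma> t) - \<bar>s - t\<bar>\<bar> \<le> K)"

definition roughly_geodesic_space :: "'a set \<Rightarrow> ('a \<Rightarrow> 'a \<Rightarrow> real) \<Rightarrow> real \<Rightarrow> bool" where
  "roughly_geodesic_space X d K \<longleftrightarrow>
     (\<forall>x\<in>X. \<forall>y\<in>X. \<exists>l\<ge>0. \<exists>\<gamma>\<in>{0..l} \<rightarrow> X.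
        \<gamma> 0 = x \<and> \<gamma> l = y \<and> roughly_geodesic_on d K {0..l} \<gamma>)"

text \<open>The constant \<open>K\<close> fixed for rays is meant to be one for which the space is
  \<open>K\<close>-roughly geodesic; a smaller constant could miss boundary points. Rays are extensional,
  so that they are really maps on \<open>[0, \<infinity>)\<close>.\<close>

definition rough_rays :: "'a set \<Rightarrow> ('a \<Rightarrow> 'a \<Rightarrow> real) \<Rightarrow> real \<Rightarrow> (real \<Rightarrow> 'a) set" where
  "rough_rays X d K = {\<gamma> \<in> {0..} \<rightarrow>\<^sub>E X. roughly_geodesic_on d K {0..} \<gamma>}"

definition ray_equiv ::
  "'a set \<Rightarrow> ('a \<Rightarrow> 'a \<Rightarrow> real) \<Rightarrow> real \<Rightarrow> ((real \<Rightarrow> 'a) \<times> (real \<Rightarrow> 'a)) set" where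
  "ray_equiv X d K =
     {(\<gamma>, \<gamma>'). \<gamma> \<in> rough_rays X d K \<and> \<gamma>' \<in> rough_rays X d K \<and>
               (\<exists>C. \<forall>t\<ge>0. d (\<gamma> t) (\<gamma>' t) \<le> C)}"

definition gromov_boundary ::
  "'a set \<Rightarrow> ('a \<Rightarrow> 'a \<Rightarrow> real) \<Rightarrow> real \<Rightarrow> (real \<Rightarrow> 'a) set set" where
  "gromov_boundary X d K = rough_rays X d K // ray_equiv X d K"

text \<open>A point of the compactification is either \<open>Inl g\<close> for a group element \<open>g\<close>
  or \<open>Inr \<xi>\<close> for a boundary point \<open>\<xi>\<close>.\<close>

type_synonym 'a completion_point = "'a + (real \<Rightarrow> 'a) set"

definition completion :: "'a set \<Rightarrow> ('a \<Rightarrow> 'a \<Rightarrow> real) \<Rightarrow> real \<Rightarrow> 'a completion_point set" where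
  "completion X d K = X <+> gromov_boundary X d K"

fun representatives :: "'a completion_point \<Rightarrow> (real \<Rightarrow> 'a) set" where
  "representatives (Inl g) = {\<lambda>t. g}"
| "representatives (Inr \<xi>) = \<xi>"

definition ext_gromov_product ::
  "('a, 'b) monoid_scheme \<Rightarrow> ('a \<Rightarrow> 'a \<Rightarrow> real) \<Rightarrow>
     'a completion_point \<Rightarrow> 'a completion_point \<Rightarrow> ereal" where
  "ext_gromov_product G d p q =
     (INF \<gamma>\<in>representatives p. INF \<gamma>'\<in>representatives q.
        Liminf at_top (\<lambda>t. ereal (gromov_product G d (\<gamma> t) (\<gamma>' t))))"

text \<open>The open sets are those that are sequentially open for the convergence
  \<open>x\<^sub>n \<longrightarrow> \<xi> \<longleftrightarrow> (x\<^sub>n, \<xi>) \<longrightarrow> \<infinity>\<close> to boundary points; there is no condition at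
  group elements, so these are isolated.\<close>

definition completion_open ::
  "('a, 'b) monoid_scheme \<Rightarrow> ('a \<Rightarrow> 'a \<Rightarrow> real) \<Rightarrow> real \<Rightarrow> 'a completion_point set \<Rightarrow> bool" where
  "completion_open G d K U \<longleftrightarrow>
     U \<subseteq> completion (carrier G) d K \<and>
     (\<forall>\<xi> x. Inr \<xi> \<in> U \<longrightarrow> (\<forall>n. x n \<in> completion (carrier G) d K) \<longrightarrow>
        (\<lambda>n. ext_gromov_product G d (x n) (Inr \<xi>)) \<longlonglongrightarrow> \<infinity> \<longrightarrow>
        (\<forall>\<^sub>F n in sequentially. x n \<in> U))"

definition completion_topology ::
  "('a, 'b) monoid_scheme \<Rightarrow> ('a \<Rightarrow> 'a \<Rightarrow> real) \<Rightarrow> real \<Rightarrow> 'a completion_point topology" where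
  "completion_topology G d K = topology (completion_open G d K)"

lemma istopology_completion_open: "istopology (completion_open G d K)"
  unfolding istopology_def
proof (intro conjI allI impI)
  fix U V
  assume "completion_open G d K U" "completion_open G d K V"
  then show "completion_open G d K (U \<inter> V)"
    unfolding completion_open_def by (auto intro: eventually_conj)
next
  fix \<U>
  assume \<U>: "\<forall>U\<in>\<U>. completion_open G d K U"
  show "completion_open G d K (\<Union>\<U>)"
    unfolding completion_open_def
  proof (intro conjI allI impI)
    show "\<Union>\<U> \<subseteq> completion (carrier G) d K"
      using \<U> unfolding completion_open_def by blast
  next
    fix \<xi> and x :: "nat \<Rightarrow> 'a completion_point"
    assume *: "Inr \<xi> \<in> \<Union>\<U>" "\<forall>n. x n \<in> completion (carrier G) d K"
      "(\<lambda>n. ext_gromov_product G d (x n) (Inr \<xi>)) \<longlonglongrightarrow> \<infinity>"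
    then obtain U where U: "U \<in> \<U>" "Inr \<xi> \<in> U" by blast
    then have "\<forall>\<^sub>F n in sequentially. x n \<in> U"
      using \<U> * unfolding completion_open_def by blast
    then show "\<forall>\<^sub>F n in sequentially. x n \<in> \<Union>\<U>"
      by eventually_elim (use U in blast)
  qed
qed

lemma openin_completion_topology:
  "openin (completion_topology G d K) U \<longleftrightarrow> completion_open G d K U"
  by (simp add: completion_topology_def topology_inverse' istopology_completion_open)

lemma topspace_completion_topology:
  "topspace (completion_topology G d K) = completion (carrier G) d K"
proof -
  have "completion_open G d K (completion (carrier G) d K)"
    unfolding completion_open_def by auto
  then show ?thesis
    unfolding topspace_def openin_completion_topology
    by (auto simp: completion_open_def)
qed

text \<open>For \<open>\<xi> = \<eta>\<close> the product is infinite, and \<open>exp (-\<epsilon> \<infinity>)\<close> is read as \<open>0\<close>.\<close>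

definition exp_neg_mult :: "real \<Rightarrow> ereal \<Rightarrow> real" where
  "exp_neg_mult \<epsilon> p = (if p = \<infinity> then 0 else exp (- \<epsilon> * real_of_ereal p))"

definition visual_metric ::
  "('a, 'b) monoid_scheme \<Rightarrow> ('a \<Rightarrow> 'a \<Rightarrow> real) \<Rightarrow> real \<Rightarrow> real \<Rightarrow>
     ((real \<Rightarrow> 'a) set \<Rightarrow> (real \<Rightarrow> 'a) set \<Rightarrow> real) \<Rightarrow> bool" where
  "visual_metric G d K \<epsilon> \<rho> \<longleftrightarrow>
     Metric_space (gromov_boundary (carrier G) d K) \<rho> \<and>
     (\<exists>C>0. \<forall>\<xi>\<in>gromov_boundary (carrier G) d K. \<forall>\<eta>\<in>gromov_boundary (carrier G) d K.
        inverse C * exp_neg_mult \<epsilon> (ext_gromov_product G d (Inr \<xi>) (Inr \<eta>)) \<le> \<rho> \<xi> \<eta> \<and>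
        \<rho> \<xi> \<eta> \<le> C * exp_neg_mult \<epsilon> (ext_gromov_product G d (Inr \<xi>) (Inr \<eta>)))"


section \<open>Hausdorff measure and dimension\<close>

definition borel_of :: "'a topology \<Rightarrow> 'a measure" where
  "borel_of T = sigma (topspace T) {U. openin T U}"

definition ediam :: "('a \<Rightarrow> 'a \<Rightarrow> real) \<Rightarrow> 'a set \<Rightarrow> ennreal" where
  "ediam \<rho> U = (SUP x\<in>U. SUP y\<in>U. ennreal (\<rho> x y))"

text \<open>\<open>diam(U)\<^sup>s\<close> for \<open>U\<close> of finite diameter, with the conventions that it is \<open>0\<close> for empty \<open>U\<close>
  and \<open>1\<close> for nonempty \<open>U\<close> if \<open>s = 0\<close> (note that \<open>0 powr 0 = 0\<close>).\<close>

definition diam_pow :: "('a \<Rightarrow> 'a \<Rightarrow> real) \<Rightarrow> real \<Rightarrow> 'a set \<Rightarrow> ennreal" where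
  "diam_pow \<rho> s U =
     (if U = {} then 0 else if s = 0 then 1 else ennreal (enn2real (ediam \<rho> U) powr s))"

definition hausdorff_outer ::
  "'a set \<Rightarrow> ('a \<Rightarrow> 'a \<Rightarrow> real) \<Rightarrow> real \<Rightarrow> 'a set \<Rightarrow> ennreal" where
  "hausdorff_outer M \<rho> s E =
     (SUP \<delta>\<in>{0::real<..}.
        INF U\<in>{U :: nat \<Rightarrow> 'a set. (\<forall>i. U i \<subseteq> M \<and> ediam \<rho> (U i) \<le> ennreal \<delta>) \<and> E \<subseteq> (\<Union>i. U i)}.
          \<Sum>i. diam_pow \<rho> s (U i))"

definition hausdorff_measure :: "'a set \<Rightarrow> ('a \<Rightarrow> 'a \<Rightarrow> real) \<Rightarrow> real \<Rightarrow> 'a measure" where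
  "hausdorff_measure M \<rho> s =
     measure_of M (sets (borel_of (Metric_space.mtopology M \<rho>))) (hausdorff_outer M \<rho> s)"

definition hausdorff_dim :: "'a set \<Rightarrow> ('a \<Rightarrow> 'a \<Rightarrow> real) \<Rightarrow> ereal" where
  "hausdorff_dim M \<rho> = Inf (ereal ` {s. 0 \<le> s \<and> hausdorff_outer M \<rho> s M = 0})"

definition normalized_hausdorff_measure :: "'a set \<Rightarrow> ('a \<Rightarrow> 'a \<Rightarrow> real) \<Rightarrow> 'a measure" where
  "normalized_hausdorff_measure M \<rho> =
     (let H = hausdorff_measure M \<rho> (real_of_ereal (hausdorff_dim M \<rho>))
      in scale_measure (1 / emeasure H M) H)"

definition patterson_sullivan ::
  "('a, 'b) monoid_scheme \<Rightarrow> ('a \<Rightarrow> 'a \<Rightarrow> real) \<Rightarrow> real \<Rightarrow>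
     ((real \<Rightarrow> 'a) set \<Rightarrow> (real \<Rightarrow> 'a) set \<Rightarrow> real) \<Rightarrow> (real \<Rightarrow> 'a) set measure" where
  "patterson_sullivan G d K \<rho> = normalized_hausdorff_measure (gromov_boundary (carrier G) d K) \<rho>"


section \<open>Weak-* convergence\<close>

definition weak_star_tendsto ::
  "'x topology \<Rightarrow> ('i \<Rightarrow> 'x measure) \<Rightarrow> 'x measure \<Rightarrow> 'i filter \<Rightarrow> bool" where
  "weak_star_tendsto T \<mu> \<nu> F \<longleftrightarrow>
     (\<forall>f :: 'x \<Rightarrow> real. continuous_map T euclideanreal f \<longrightarrow>
        ((\<lambda>i. \<integral>x. f x \<partial>(\<mu> i)) \<longlongrightarrow> (\<integral>x. f x \<partial>\<nu>)) F)"

definition completion_square ::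
  "('a, 'b) monoid_scheme \<Rightarrow> ('a \<Rightarrow> 'a \<Rightarrow> real) \<Rightarrow> real \<Rightarrow>
     ('a completion_point \<times> 'a completion_point) topology" where
  "completion_square G d K = prod_topology (completion_topology G d K) (completion_topology G d K)"

definition pair_with_inverse ::
  "('a, 'b) monoid_scheme \<Rightarrow> 'a \<Rightarrow> 'a completion_point \<times> 'a completion_point" where
  "pair_with_inverse G g = (Inl g, Inl (m_inv G g))"

definition boundary_product_measure ::
  "('a, 'b) monoid_scheme \<Rightarrow> ('a \<Rightarrow> 'a \<Rightarrow> real) \<Rightarrow> real \<Rightarrow> (real \<Rightarrow> 'a) set measure \<Rightarrow>
     ('a completion_point \<times> 'a completion_point) measure" where
  "boundary_product_measure G d K \<nu> =
     distr (\<nu> \<Otimes>\<^sub>M \<nu>) (borel_of (completion_square G d K)) (map_prod Inr Inr)"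

end

theory Submission
  imports Defs
begin

text \<open>
  The measure \<open>\<mu>\<^sub>R\<close> is the image of \<open>\<mu>\<^sub>P\<^sub>S \<otimes> \<mu>\<^sub>P\<^sub>S\<close> under a map sending \<open>(\<xi>, \<eta>)\<close> to \<open>x a y\<inverse>\<close>, where \<open>x\<close> and \<open>y\<close>
  are points at distance about \<open>R/2\<close> from \<open>1\<close> on rays to \<open>\<xi>\<close> and \<open>\<eta>\<close>, and \<open>a\<close> is an element of bounded length
  such that \<open>\<bar>x a y\<inverse>\<bar>\<close> is about \<open>\<bar>x\<bar> + \<bar>y\<bar>\<close>; such an \<open>a\<close> exists because a group fixing a boundary point is
  virtually cyclic. Then \<open>x a y\<inverse>\<close> is near \<open>\<xi>\<close> and its inverse is near \<open>\<eta>\<close>, so the weak limit follows by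
  dominated convergence. If \<open>g = x a y\<inverse>\<close>, then \<open>\<xi>\<close> lies in the shadow of \<open>g\<close> at depth \<open>R/2\<close> and \<open>\<eta>\<close> in that of
  \<open>g\<inverse>\<close>, and shadows at depth \<open>n\<close> have measure at most \<open>C \<omega>\<^sup>-\<^sup>n\<close>.

  For the last bound, almost additive products make the sizes of annuli supermultiplicative, so
  that an annulus at distance \<open>R\<close> has about \<open>\<omega>\<^sup>R\<close> elements. Covering a shadow by the
  shadows of a distant annulus bounds its Hausdorff measure of dimension \<open>D = ln \<omega> / \<epsilon>\<close> from above, and counting
  the elements of annuli behind the members of a cover shows that the boundary has positive
  \<open>D\<close>-dimensional measure.
\<close>

subsection \<open>Hyperbolic groups\<close>

text \<open>Segments are only rough and distances need not be integers, so no sphere has to contain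
  a point. Every count is therefore made in annuli, and every estimate may lose a bounded amount.
  The obstacle is that the limit defining the growth rate determines ball sizes only up to
  subexponential factors, which a Hausdorff measure in its exact dimension does not tolerate.
  Submultiplicativity of balls gives a lower bound by a constant times
  \<open>\<omega> powr R\<close>, and supermultiplicativity of annuli an upper bound of the same
  form. The upper bound makes the measure of dimension \<open>ln \<omega> / \<epsilon>\<close>
  finite, and both together make it positive. A second obstacle is measurability: a group element
  chosen separately for each boundary point need not depend measurably on it. The choice therefore
  factors through a countable dense subset of the boundary.\<close>

lemma card_le_fibres:
  assumes A: "finite A" and B: "finite B" and f: "f ` A \<subseteq> B"
    and fib: "\<And>a. a \<in> A \<Longrightarrow> card {a' \<in> A. f a' = f a} \<le> M"
  shows "card A \<le> M * card B"
proof -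
  have "A = (\<Union>b\<in>f ` A. {a \<in> A. f a = b})"
    by auto
  then have "card A \<le> (\<Sum>b\<in>f ` A. card {a \<in> A. f a = b})"
    using card_UN_le[of "f ` A" "\<lambda>b. {a \<in> A. f a = b}"] A by simp
  also have "\<dots> \<le> (\<Sum>b\<in>f ` A. M)"
    by (intro sum_mono) (use fib in auto)
  also have "\<dots> \<le> M * card B"
    using card_mono[OF B f] by simp
  finally show ?thesis .
qed

text \<open>A lower bound on a \<open>Liminf\<close> yields eventual lower bounds only for strictly
  smaller numbers. This removes that loss again, so that \<open>E_hyp\<close> costs exactly
  \<open>\<delta>\<close>.\<close>

lemma ereal_le_if_less_le:
  fixes e :: ereal
  assumes "\<And>r'. r' < r \<Longrightarrow> ereal r' \<le> e"
  shows "ereal r \<le> e"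
proof (rule dense_le)
  fix x assume "x < ereal r"
  then show "x \<le> e"
    using assms by (cases x) auto
qed

text \<open>What is kept of the comparison with a word metric is the finiteness of balls;
  \<open>group_metrics_rough_hyperbolic\<close> derives it at the end.\<close>

locale rough_hyperbolic_group = group G + Metric_space "carrier G" d
  for G (structure) and d +
  fixes K \<delta> :: real
  assumes left_inv: "\<lbrakk>g \<in> carrier G; x \<in> carrier G; y \<in> carrier G\<rbrakk> \<Longrightarrow> d (g \<otimes> x) (g \<otimes> y) = d x y"
    and delta_nonneg: "\<delta> \<ge> 0"
    and hyp: "\<lbrakk>x \<in> carrier G; y \<in> carrier G; z \<in> carrier G\<rbrakk> \<Longrightarrow>
      gromov_product G d x y \<ge> min (gromov_product G d x z) (gromov_product G d z y) - \<delta>"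
    and rough_geodesic: "roughly_geodesic_space (carrier G) d K"
    and finite_cball: "finite {g \<in> carrier G. d \<one> g \<le> r}"
begin

abbreviation "X \<equiv> carrier G"
abbreviation "len g \<equiv> d \<one> g"
abbreviation "gp \<equiv> gromov_product G d"
abbreviation "E \<equiv> ext_gromov_product G d"
abbreviation "bdry \<equiv> gromov_boundary X d K"
abbreviation "rays \<equiv> rough_rays X d K"
abbreviation "compl \<equiv> completion X d K"

definition bcard :: "real \<Rightarrow> nat" where "bcard r = card {g \<in> X. len g \<le> r}"

lemma gp2: "2 * gp x y = len x + len y - d x y"
  by (simp add: gromov_product_def)

lemma gp_sym: "gp x y = gp y x"
  by (simp add: gromov_product_def commute)

lemma gp_nonneg: "x \<in> X \<Longrightarrow> y \<in> X \<Longrightarrow> 0 \<le> gp x y"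
  using triangle[of x \<one> y] gp2[of x y] commute[of x \<one>] by simp

lemma gp_le_len: "x \<in> X \<Longrightarrow> y \<in> X \<Longrightarrow> gp x y \<le> len x"
  using triangle[of \<one> x y] gp2[of x y] commute[of y x] by simp

lemma gp_change: "x \<in> X \<Longrightarrow> y \<in> X \<Longrightarrow> z \<in> X \<Longrightarrow> gp x y \<ge> gp x z - d z y"
  using triangle[of \<one> y z] triangle[of x z y] triangle[of \<one> z y] gp2[of x y] gp2[of x z] commute[of y z]
  by simp

lemma dist_eq_gp: "d x y = len x + len y - 2 * gp x y"
  using gp2[of x y] by simp

lemma dist_eq_len: "x \<in> X \<Longrightarrow> y \<in> X \<Longrightarrow> d x y = len (inv x \<otimes> y)"
  using left_inv[of "inv x" x y] by simp

lemma len_inv: "x \<in> X \<Longrightarrow> len (inv x) = len x"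
  using dist_eq_len[of x \<one>] by (simp add: commute)

lemma dist_mult: "x \<in> X \<Longrightarrow> y \<in> X \<Longrightarrow> d x (x \<otimes> y) = len y"
  using left_inv[of x \<one> y] by simp

lemma len_mult: "x \<in> X \<Longrightarrow> y \<in> X \<Longrightarrow> len (x \<otimes> y) \<le> len x + len y"
  using triangle[of \<one> x "x \<otimes> y"] dist_mult by simp

lemma len_diff: "x \<in> X \<Longrightarrow> y \<in> X \<Longrightarrow> \<bar>len x - len y\<bar> \<le> d x y"
  using triangle[of \<one> x y] triangle[of \<one> y x] by (simp add: commute)

lemma gp_left_mult:
  assumes "g \<in> X" "x \<in> X" "y \<in> X"
  shows "gp (g \<otimes> x) (g \<otimes> y) \<ge> gp x y - len g"
proof -
  have "len x \<le> len g + len (g \<otimes> x)" "len y \<le> len g + len (g \<otimes> y)"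
    using len_mult[of "inv g" "g \<otimes> x"] len_mult[of "inv g" "g \<otimes> y"] assms
    by (simp_all add: len_inv m_assoc[symmetric])
  then show ?thesis
    using left_inv[OF assms] gp2[of x y] gp2[of "g \<otimes> x" "g \<otimes> y"] by linarith
qed

lemma K_nonneg: "K \<ge> 0"
proof -
  obtain l \<gamma> where "l \<ge> (0::real)" "roughly_geodesic_on d K {0..l} \<gamma>"
    using rough_geodesic one_closed unfolding roughly_geodesic_space_def by blast
  then have "\<bar>d (\<gamma> 0) (\<gamma> 0) - \<bar>0 - 0\<bar>\<bar> \<le> K"
    unfolding roughly_geodesic_on_def by (metis atLeastAtMost_iff order_refl)
  then show ?thesis
    by (smt (verit) nonneg)
qed

lemma segment:
  assumes "x \<in> X" "y \<in> X"
  obtains l \<gamma> where "l \<ge> 0" "\<gamma> \<in> {0..l} \<rightarrow> X" "\<gamma> 0 = x" "\<gamma> l = y"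
    "\<And>s t. 0 \<le> s \<Longrightarrow> s \<le> l \<Longrightarrow> 0 \<le> t \<Longrightarrow> t \<le> l \<Longrightarrow> \<bar>d (\<gamma> s) (\<gamma> t) - \<bar>s - t\<bar>\<bar> \<le> K"
  using rough_geodesic assms unfolding roughly_geodesic_space_def roughly_geodesic_on_def
  by (metis atLeastAtMost_iff)

text \<open>A substitute for the point at distance \<open>r\<close> on a geodesic from
  \<open>\<one>\<close> to \<open>g\<close>: the bound on the Gromov product says that
  \<open>x\<close> lies close to the way to \<open>g\<close>.\<close>

lemma truncate:
  assumes g: "g \<in> X" and r: "0 \<le> r" "r \<le> len g"
  obtains x where "x \<in> X" "\<bar>len x - r\<bar> \<le> 2 * K" "gp x g \<ge> r - 3 * K"
proof -
  obtain l \<gamma> where \<gamma>: "l \<ge> 0" "\<gamma> \<in> {0..l} \<rightarrow> X" "\<gamma> 0 = \<one>" "\<gamma> l = g"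
    "\<And>s t. 0 \<le> s \<Longrightarrow> s \<le> l \<Longrightarrow> 0 \<le> t \<Longrightarrow> t \<le> l \<Longrightarrow> \<bar>d (\<gamma> s) (\<gamma> t) - \<bar>s - t\<bar>\<bar> \<le> K"
    using segment[OF one_closed g] by metis
  \<comment> \<open>\<open>l\<close> can be smaller than \<open>len g\<close> by up to
    \<open>K\<close>, so time \<open>r\<close> may lie beyond the end of the segment; capping it
    costs at most \<open>K\<close>.\<close>
  define t where "t = min r l"
  have t: "0 \<le> t" "t \<le> l" "t \<le> r"
    using r \<gamma>(1) by (auto simp: t_def)
  have l: "\<bar>len g - l\<bar> \<le> K"
    using \<gamma>(5)[of 0 l] \<gamma>(1,3,4) by simp
  then have "t \<ge> r - K"
    using r K_nonneg by (auto simp: t_def)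
  moreover have "\<bar>len (\<gamma> t) - t\<bar> \<le> K" "\<bar>d (\<gamma> t) g - (l - t)\<bar> \<le> K"
    using \<gamma>(5)[of 0 t] \<gamma>(5)[of t l] \<gamma> t by auto
  ultimately show ?thesis
    using that[of "\<gamma> t"] \<gamma>(2) t l K_nonneg gp2[of "\<gamma> t" g] by (auto simp: Pi_iff)
qed

section \<open>Counting in balls\<close>

lemma card_translated_ball: "x \<in> X \<Longrightarrow> card {y \<in> X. d x y \<le> r} = bcard r"
proof -
  assume x: "x \<in> X"
  have "bij_betw (\<lambda>y. inv x \<otimes> y) {y \<in> X. d x y \<le> r} {g \<in> X. len g \<le> r}"
    by (rule bij_betw_byWitness[where f' = "\<lambda>y. x \<otimes> y"])
       (use x in \<open>auto simp: dist_eq_len[OF x] inv_solve_left' m_assoc[symmetric]\<close>)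
  then show ?thesis
    unfolding bcard_def by (rule bij_betw_same_card)
qed

lemma finite_translated_ball: "x \<in> X \<Longrightarrow> finite {y \<in> X. d x y \<le> r}"
proof -
  assume x: "x \<in> X"
  have "{y \<in> X. d x y \<le> r} \<subseteq> {y \<in> X. len y \<le> r + len x}"
    using triangle[of \<one> x] x by auto (smt (verit) one_closed)
  then show ?thesis
    using finite_cball finite_subset by blast
qed

lemma bcard_mono: "r \<le> s \<Longrightarrow> bcard r \<le> bcard s"
  unfolding bcard_def by (intro card_mono finite_cball) auto

lemma bcard_ge_1: "0 \<le> r \<Longrightarrow> 1 \<le> bcard r"
proof -
  assume "0 \<le> r"
  then have "\<one> \<in> {g \<in> X. len g \<le> r}" by simp
  then show ?thesis
    unfolding bcard_def using card_gt_0_iff finite_cball[of r]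
    by (metis (mono_tags, lifting) One_nat_def Suc_leI empty_iff)
qed

text \<open>A fibre lies in the ball of radius \<open>r\<close> around any of its members, and by
  left invariance all balls of that radius have \<open>bcard r\<close> elements.\<close>

lemma card_le_close_fibres:
  assumes A: "finite A" "A \<subseteq> X" and B: "finite B" "f ` A \<subseteq> B"
    and fib: "\<And>a a'. a \<in> A \<Longrightarrow> a' \<in> A \<Longrightarrow> f a = f a' \<Longrightarrow> d a a' \<le> r"
  shows "card A \<le> bcard r * card B"
proof (rule card_le_fibres[OF A(1) B])
  fix a assume a: "a \<in> A"
  have "card {a' \<in> A. f a' = f a} \<le> card {y \<in> X. d a y \<le> r}"
    by (rule card_mono) (use a A fib finite_translated_ball in auto)
  then show "card {a' \<in> A. f a' = f a} \<le> bcard r"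
    using card_translated_ball a A by auto
qed

subsection \<open>Rough rays and the extended Gromov product\<close>

lemma ray_in: "\<gamma> \<in> rays \<Longrightarrow> 0 \<le> t \<Longrightarrow> \<gamma> t \<in> X"
  by (auto simp: rough_rays_def PiE_iff)

lemma ray_dist: "\<gamma> \<in> rays \<Longrightarrow> 0 \<le> s \<Longrightarrow> 0 \<le> t \<Longrightarrow> \<bar>d (\<gamma> s) (\<gamma> t) - \<bar>s - t\<bar>\<bar> \<le> K"
  by (auto simp: rough_rays_def roughly_geodesic_on_def)

text \<open>Rays may start anywhere, hence the term \<open>len (\<gamma> 0)\<close> here and in the
  next estimates; \<open>bdry_point\<close> gets rid of it.\<close>

lemma ray_len: "\<gamma> \<in> rays \<Longrightarrow> 0 \<le> t \<Longrightarrow> t - K - len (\<gamma> 0) \<le> len (\<gamma> t)"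
  using ray_dist[of \<gamma> 0 t] ray_in[of \<gamma> 0] ray_in[of \<gamma> t] triangle[of "\<gamma> 0" \<one> "\<gamma> t"]
  by (simp add: commute)

lemma ray_gp:
  assumes "\<gamma> \<in> rays" "0 \<le> s" "s \<le> t"
  shows "gp (\<gamma> s) (\<gamma> t) \<ge> s - len (\<gamma> 0) - 2 * K"
  using ray_dist[of \<gamma> s t] ray_len[of \<gamma> s] ray_len[of \<gamma> t] assms K_nonneg
    gp2[of "\<gamma> s" "\<gamma> t"]
  by simp

lemma ray_equiv_iff:
  "(\<gamma>, \<gamma>') \<in> ray_equiv X d K \<longleftrightarrow>
     \<gamma> \<in> rays \<and> \<gamma>' \<in> rays \<and> (\<exists>C. \<forall>t\<ge>0. d (\<gamma> t) (\<gamma>' t) \<le> C)"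
  by (simp add: ray_equiv_def)

lemma bdry_ray: "\<xi> \<in> bdry \<Longrightarrow> \<gamma> \<in> \<xi> \<Longrightarrow> \<gamma> \<in> rays"
  by (auto simp: gromov_boundary_def quotient_def ray_equiv_iff)

lemma bdry_close:
  assumes "\<xi> \<in> bdry" "\<gamma> \<in> \<xi>" "\<gamma>' \<in> \<xi>"
  obtains C where "\<And>t. 0 \<le> t \<Longrightarrow> d (\<gamma> t) (\<gamma>' t) \<le> C"
proof -
  obtain \<beta> where \<beta>: "\<beta> \<in> rays" "\<xi> = ray_equiv X d K `` {\<beta>}"
    using assms by (auto simp: gromov_boundary_def quotient_def)
  then obtain C C' where C: "\<And>t. 0 \<le> t \<Longrightarrow> d (\<beta> t) (\<gamma> t) \<le> C" "\<And>t. 0 \<le> t \<Longrightarrow> d (\<beta> t) (\<gamma>' t) \<le> C'"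
    using assms unfolding \<beta> by (auto simp: ray_equiv_iff)
  have "d (\<gamma> t) (\<gamma>' t) \<le> C + C'" if "0 \<le> t" for t
    using C[OF that] triangle[of "\<gamma> t" "\<beta> t" "\<gamma>' t"] ray_in[OF _ that] assms \<beta>(1) bdry_ray
    by (smt (verit) commute)
  then show ?thesis using that by blast
qed

lemma bdry_nonempty: "\<xi> \<in> bdry \<Longrightarrow> \<exists>\<gamma>. \<gamma> \<in> \<xi>"
proof -
  assume "\<xi> \<in> bdry"
  then obtain \<beta> where \<beta>: "\<beta> \<in> rays" "\<xi> = ray_equiv X d K `` {\<beta>}"
    by (auto simp: gromov_boundary_def quotient_def)
  have "d (\<beta> t) (\<beta> t) \<le> 0" if "t \<ge> 0" for t
    using ray_in[OF \<beta>(1) that] by simp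
  then show ?thesis
    using \<beta> by (auto simp: ray_equiv_iff)
qed

lemma ray_bdry:
  assumes "\<gamma> \<in> rays"
  obtains \<xi> where "\<xi> \<in> bdry" "\<gamma> \<in> \<xi>"
proof -
  have "d (\<gamma> t) (\<gamma> t) \<le> 0" if "t \<ge> 0" for t
    using ray_in[OF assms that] by simp
  then show ?thesis
    using assms that[of "ray_equiv X d K `` {\<gamma>}"]
    by (auto simp: gromov_boundary_def quotient_def ray_equiv_iff)
qed

lemma Inl_in_compl [simp]: "Inl x \<in> compl \<longleftrightarrow> x \<in> X"
  by (auto simp: completion_def)

lemma Inr_in_compl [simp]: "Inr \<xi> \<in> compl \<longleftrightarrow> \<xi> \<in> bdry"
  by (auto simp: completion_def)

lemma rep_in: "p \<in> compl \<Longrightarrow> \<gamma> \<in> representatives p \<Longrightarrow> 0 \<le> t \<Longrightarrow> \<gamma> t \<in> X"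
  by (cases p) (use bdry_ray ray_in in auto)

lemma rep_nonempty: "p \<in> compl \<Longrightarrow> \<exists>\<gamma>. \<gamma> \<in> representatives p"
  by (cases p) (use bdry_nonempty in auto)

lemma E_geI:
  assumes "\<And>\<gamma> \<gamma>'. \<gamma> \<in> representatives p \<Longrightarrow> \<gamma>' \<in> representatives q \<Longrightarrow>
     \<forall>\<^sub>F t in at_top. r \<le> gp (\<gamma> t) (\<gamma>' t)"
  shows "ereal r \<le> E p q"
  unfolding ext_gromov_product_def
  by (intro INF_greatest Liminf_bounded) (use assms in auto)

lemma E_geD:
  assumes "ereal r \<le> E p q" "\<gamma> \<in> representatives p" "\<gamma>' \<in> representatives q" "r' < r"
  shows "\<forall>\<^sub>F t in at_top. r' < gp (\<gamma> t) (\<gamma>' t)"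
proof -
  have "E p q \<le> Liminf at_top (\<lambda>t. ereal (gp (\<gamma> t) (\<gamma>' t)))"
    unfolding ext_gromov_product_def using assms by (meson INF_lower2 order_refl)
  then have "ereal r' < Liminf at_top (\<lambda>t. ereal (gp (\<gamma> t) (\<gamma>' t)))"
    using assms(1,4) by (metis ereal_less_le less_ereal.simps(1) less_le_trans)
  from less_LiminfD[OF this] show ?thesis by simp
qed

lemma E_sym: "E p q = E q p"
  unfolding ext_gromov_product_def
  by (subst INF_commute) (simp add: gp_sym)

lemma E_Inl [simp]: "E (Inl x) (Inl y) = ereal (gp x y)"
  by (simp add: ext_gromov_product_def Liminf_const)

lemma E_nonneg: "p \<in> compl \<Longrightarrow> q \<in> compl \<Longrightarrow> 0 \<le> E p q"
proof -
  assume pq: "p \<in> compl" "q \<in> compl"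
  have "ereal 0 \<le> E p q"
    by (rule E_geI, rule eventually_mono[OF eventually_ge_at_top[of 0]])
       (use pq rep_in gp_nonneg in auto)
  then show ?thesis by (simp add: zero_ereal_def)
qed

text \<open>A lower bound on \<open>E\<close> holds for all representatives, so one representative
  of the middle point \<open>z\<close> can serve on both sides, and the inequality at each time
  \<open>t\<close> passes to the lower limit without further loss. Real lower bounds are used
  because the products may be infinite.\<close>

lemma E_hyp:
  assumes pqr: "p \<in> compl" "q \<in> compl" "z \<in> compl" and "ereal r \<le> E p z" "ereal r \<le> E z q"
  shows "ereal (r - \<delta>) \<le> E p q"
proof (rule ereal_le_if_less_le)
  fix r' assume r': "r' < r - \<delta>"
  obtain \<beta> where \<beta>: "\<beta> \<in> representatives z"
    using rep_nonempty pqr by blast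
  show "ereal r' \<le> E p q"
  proof (rule E_geI)
    fix \<gamma> \<gamma>' assume \<gamma>: "\<gamma> \<in> representatives p" "\<gamma>' \<in> representatives q"
    have r'': "r' + \<delta> < r" using r' by simp
    show "\<forall>\<^sub>F t in at_top. r' \<le> gp (\<gamma> t) (\<gamma>' t)"
      using E_geD[OF assms(4) \<gamma>(1) \<beta> r''] E_geD[OF assms(5) \<beta> \<gamma>(2) r''] eventually_ge_at_top[of 0]
    proof eventually_elim
      case (elim t)
      then show ?case
        using hyp[of "\<gamma> t" "\<gamma>' t" "\<beta> t"] rep_in pqr \<gamma> \<beta> by auto
    qed
  qed
qed

text \<open>Another ray to the same point is reached through \<open>\<gamma> s\<close>, which costs
  \<open>\<delta>\<close> once. The distance \<open>C\<close> between the two rays only delays the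
  time from which the estimate holds, so the bound is the same for all representatives.\<close>

lemma ray_converges:
  assumes "\<xi> \<in> bdry" "\<gamma> \<in> \<xi>" "0 \<le> t"
  shows "ereal (t - len (\<gamma> 0) - 2 * K - \<delta>) \<le> E (Inl (\<gamma> t)) (Inr \<xi>)"
proof (rule E_geI)
  fix \<beta> \<gamma>' assume *: "\<beta> \<in> representatives (Inl (\<gamma> t))" "\<gamma>' \<in> representatives (Inr \<xi>)"
  then have \<beta>: "\<beta> s = \<gamma> t" for s by simp
  have \<gamma>': "\<gamma>' \<in> \<xi>" "\<gamma>' \<in> rays" "\<gamma> \<in> rays" using * assms bdry_ray by auto
  obtain C where C: "\<And>t. 0 \<le> t \<Longrightarrow> d (\<gamma> t) (\<gamma>' t) \<le> C"
    using bdry_close assms \<gamma>' by metis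
  show "\<forall>\<^sub>F s in at_top. t - len (\<gamma> 0) - 2 * K - \<delta> \<le> gp (\<beta> s) (\<gamma>' s)"
    using eventually_ge_at_top[of "t + C"] eventually_ge_at_top[of t]
  proof eventually_elim
    case (elim s)
    then have s: "0 \<le> s" using assms(3) by simp
    have X: "\<gamma> s \<in> X" "\<gamma>' s \<in> X" "\<gamma> t \<in> X" using ray_in \<gamma>' s assms(3) by auto
    have 1: "gp (\<gamma> t) (\<gamma> s) \<ge> t - len (\<gamma> 0) - 2 * K"
      using ray_gp[OF \<gamma>'(3) assms(3), of s] elim by simp
    have "gp (\<gamma> s) (\<gamma>' s) \<ge> gp (\<gamma> s) (\<gamma> s) - C"
      using gp_change[of "\<gamma> s" "\<gamma>' s" "\<gamma> s"] C[OF s] X by simp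
    moreover have "gp (\<gamma> s) (\<gamma> s) \<ge> s - len (\<gamma> 0) - 2 * K"
      using ray_gp[OF \<gamma>'(3) s, of s] by simp
    ultimately show ?case
      using 1 hyp[OF X(3,2,1)] elim by (simp add: \<beta>)
  qed
qed

text \<open>The errors depend on \<open>K\<close> and \<open>\<delta>\<close> alone, not on the ray:
  a far point of some ray to \<open>\<xi>\<close> is joined to \<open>\<one>\<close> and truncated
  there.\<close>

lemma bdry_point:
  assumes \<xi>: "\<xi> \<in> bdry" and r: "0 \<le> r"
  obtains x where "x \<in> X" "\<bar>len x - r\<bar> \<le> 2 * K" "ereal (r - 3 * K - \<delta>) \<le> E (Inl x) (Inr \<xi>)"
proof -
  obtain \<gamma> where \<gamma>: "\<gamma> \<in> \<xi>" using bdry_nonempty \<xi> by blast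
  have ray: "\<gamma> \<in> rays" using bdry_ray \<xi> \<gamma> by simp
  \<comment> \<open>Far enough for \<open>\<gamma> T\<close> to have length at least
    \<open>r\<close> and product at least \<open>r\<close> with \<open>\<xi>\<close>.\<close>
  define T where "T = r + len (\<gamma> 0) + 2 * K + \<delta>"
  have T: "T \<ge> 0" using r K_nonneg delta_nonneg by (simp add: T_def)
  have TX: "\<gamma> T \<in> X" using ray_in[OF ray T] .
  have "r \<le> len (\<gamma> T)" using ray_len[OF ray T] K_nonneg delta_nonneg by (simp add: T_def)
  from truncate[OF TX r this] obtain x where
    x: "x \<in> X" "\<bar>len x - r\<bar> \<le> 2 * K" "gp x (\<gamma> T) \<ge> r - 3 * K" .
  have "ereal (r - 3 * K) \<le> E (Inl (\<gamma> T)) (Inr \<xi>)"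
    using ray_converges[OF \<xi> \<gamma> T] K_nonneg unfolding T_def
    by (smt (verit) ereal_less_eq(3) order_trans)
  then have "ereal (r - 3 * K - \<delta>) \<le> E (Inl x) (Inr \<xi>)"
    using E_hyp[of "Inl x" "Inr \<xi>" "Inl (\<gamma> T)" "r - 3 * K"] x TX \<xi> by simp
  then show ?thesis using that x by blast
qed

text \<open>An Arzela-Ascoli argument. Rough segments are not continuous, so countably many times do
  not control them. Tychonoff's theorem is applied to the product over all times instead, where the
  balls are finite and hence compact. That product yields a cluster point but no subsequence, so the
  subsequence is chosen afterwards, using agreement with the cluster point at one time for each
  index.\<close>

lemma bdry_compactness:
  assumes x: "\<And>n::nat. x n \<in> X" and lim: "filterlim (\<lambda>n. len (x n)) at_top sequentially"
  obtains \<xi> \<sigma> where "\<xi> \<in> bdry" "strict_mono \<sigma>"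
    "\<And>n::nat. ereal (real n) \<le> E (Inl (x (\<sigma> n))) (Inr \<xi>)"
proof -
  have "\<exists>l \<gamma>. l \<ge> 0 \<and> \<gamma> \<in> {0..l} \<rightarrow> X \<and> \<gamma> 0 = \<one> \<and> \<gamma> l = x n \<and>
     (\<forall>s t. 0 \<le> s \<longrightarrow> s \<le> l \<longrightarrow> 0 \<le> t \<longrightarrow> t \<le> l \<longrightarrow> \<bar>d (\<gamma> s) (\<gamma> t) - \<bar>s - t\<bar>\<bar> \<le> K)" for n
    using segment[OF one_closed x[of n]] by metis
  then obtain l \<gamma> where l: "\<And>n. l n \<ge> 0" and \<gamma>: "\<And>n. \<gamma> n \<in> {0..l n} \<rightarrow> X"
    "\<And>n. \<gamma> n 0 = \<one>" "\<And>n. \<gamma> n (l n) = x n"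
    "\<And>n s t. 0 \<le> s \<Longrightarrow> s \<le> l n \<Longrightarrow> 0 \<le> t \<Longrightarrow> t \<le> l n \<Longrightarrow> \<bar>d (\<gamma> n s) (\<gamma> n t) - \<bar>s - t\<bar>\<bar> \<le> K"
    by metis
  have lx: "\<bar>len (x n) - l n\<bar> \<le> K" for n
    using \<gamma>(4)[of 0 n "l n"] l[of n] \<gamma>(2)[of n] \<gamma>(3)[of n] by simp
  \<comment> \<open>Past its end a segment is continued by \<open>\<one>\<close>, which lies in
    every \<open>B t\<close>. As \<open>l n\<close> tends to infinity, this does not affect any
    fixed finite set of times in the long run.\<close>
  define \<sigma> where "\<sigma> n = (\<lambda>t\<in>{0..}. if t \<le> l n then \<gamma> n t else \<one>)" for n
  define B where "B t = {g \<in> X. len g \<le> t + K}" for t :: real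
  define Y where "Y = product_topology (\<lambda>t. discrete_topology (B t)) {0::real..}"
  have \<sigma>_in: "\<sigma> n \<in> (\<Pi>\<^sub>E t\<in>{0..}. B t)" for n
  proof
    fix t :: real assume t: "t \<in> {0..}"
    show "\<sigma> n t \<in> B t"
    proof (cases "t \<le> l n")
      case True
      then have "len (\<gamma> n t) \<le> t + K"
        using \<gamma>(4)[of 0 n t] l[of n] \<gamma>(2)[of n] t by simp
      then show ?thesis using True \<gamma>(1)[of n] t by (auto simp: \<sigma>_def B_def)
    qed (use t K_nonneg in \<open>auto simp: \<sigma>_def B_def\<close>)
  qed (simp add: \<sigma>_def)
  have comp: "compact_space Y"
    unfolding Y_def compact_space_product_topology
    using finite_cball by (auto simp: compact_space_discrete_topology B_def)
  have top: "topspace Y = (\<Pi>\<^sub>E t\<in>{0..}. B t)"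
    by (simp add: Y_def)
  define C where "C N = Y closure_of (\<sigma> ` {N..})" for N :: nat
  have "(\<Inter>N. C N) \<noteq> {}"
  proof (rule compact_space_imp_nest[OF comp])
    show "C N \<noteq> {}" for N
    proof -
      have "\<sigma> ` {N..} \<subseteq> C N"
        unfolding C_def by (rule closure_of_subset) (use \<sigma>_in top in auto)
      then show ?thesis by auto
    qed
    show "decseq C"
      unfolding decseq_def C_def by (intro allI impI closure_of_mono image_mono) auto
  qed (simp add: C_def)
  then obtain \<beta> where \<beta>: "\<And>N. \<beta> \<in> C N" by auto
  have \<beta>Y: "\<beta> \<in> (\<Pi>\<^sub>E t\<in>{0..}. B t)"
    using \<beta>[of 0] closure_of_subset_topspace[of Y] unfolding C_def top by blast
  \<comment> \<open>The factors are discrete, so neighbourhoods of \<open>\<beta>\<close> force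
    exact agreement at finitely many times. Two times at once are enough to transfer the rough
    geodesic inequality.\<close>
  have approx: "\<exists>n\<ge>N. \<forall>t\<in>T. \<sigma> n t = \<beta> t" if T: "finite T" "T \<subseteq> {0..}" for T and N :: nat
  proof -
    define U where "U = (\<Pi>\<^sub>E t\<in>{0..}. if t \<in> T then {\<beta> t} else B t)"
    have "openin Y U"
      unfolding Y_def U_def
    proof (rule product_topology_basis)
      show "openin (discrete_topology (B t)) (if t \<in> T then {\<beta> t} else B t)" for t
        using \<beta>Y T by (auto simp: PiE_iff)
      have "{i. (if i \<in> T then {\<beta> i} else B i) \<noteq> topspace (discrete_topology (B i))} \<subseteq> T"
        by auto
      then show "finite {i. (if i \<in> T then {\<beta> i} else B i) \<noteq> topspace (discrete_topology (B i))}"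
        using T finite_subset by blast
    qed
    moreover have "\<beta> \<in> U" using \<beta>Y by (auto simp: U_def PiE_iff)
    ultimately obtain f where "f \<in> \<sigma> ` {N..}" "f \<in> U"
      using \<beta>[of N] unfolding C_def in_closure_of by blast
    then obtain n where n: "n \<ge> N" "\<sigma> n \<in> U" by auto
    have "\<sigma> n t = \<beta> t" if "t \<in> T" for t
    proof -
      have "t \<in> {0..}" using that T by blast
      then have "\<sigma> n t \<in> (if t \<in> T then {\<beta> t} else B t)"
        using n(2) unfolding U_def PiE_iff by blast
      then show ?thesis using that by simp
    qed
    then show ?thesis using n(1) by blast
  qed
  have "\<forall>\<^sub>F n in sequentially. t + K \<le> len (x n)" for t
    using lim by (simp add: filterlim_at_top)
  then have ev0: "\<exists>N. \<forall>n\<ge>N. t + K \<le> len (x n)" for t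
    by (simp add: eventually_sequentially)
  have ev: "\<exists>N. \<forall>n\<ge>N. t \<le> l n" for t
  proof -
    obtain N where N: "\<And>n. n \<ge> N \<Longrightarrow> t + K \<le> len (x n)" using ev0 by blast
    have "t \<le> l n" if "n \<ge> N" for n
      using N[OF that] lx[of n] by linarith
    then show ?thesis by blast
  qed
  have seg: "\<exists>n\<ge>N. \<forall>t\<in>T. \<gamma> n t = \<beta> t \<and> t \<le> l n" if T: "finite T" "T \<subseteq> {0..}" for T N
  proof -
    obtain N' where N': "\<And>n. n \<ge> N' \<Longrightarrow> Max (insert 0 T) \<le> l n"
      using ev by blast
    obtain n where n: "n \<ge> max N N'" "\<And>t. t \<in> T \<Longrightarrow> \<sigma> n t = \<beta> t"
      using approx[OF T, of "max N N'"] by blast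
    have "t \<le> l n" if "t \<in> T" for t
      using N'[of n] n(1) T that by auto
    then have "\<gamma> n t = \<beta> t \<and> t \<le> l n" if "t \<in> T" for t
      using n(2)[OF that] T that by (auto simp: \<sigma>_def split: if_splits)
    then show ?thesis
      using n by (intro exI[of _ n]) auto
  qed
  have "\<bar>d (\<beta> s) (\<beta> t) - \<bar>s - t\<bar>\<bar> \<le> K" if st: "0 \<le> s" "0 \<le> t" for s t
  proof -
    obtain n where "\<gamma> n s = \<beta> s" "s \<le> l n" "\<gamma> n t = \<beta> t" "t \<le> l n"
      using seg[of "{s, t}" 0] st by auto
    then show ?thesis using \<gamma>(4)[of s n t] st by simp
  qed
  moreover have "\<beta> \<in> {0..} \<rightarrow>\<^sub>E X"
    using \<beta>Y by (auto simp: B_def PiE_iff)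
  ultimately have ray: "\<beta> \<in> rays"
    unfolding rough_rays_def roughly_geodesic_on_def by auto
  have \<beta>0: "\<beta> 0 = \<one>"
    using seg[of "{0}" 0] by (simp add: \<gamma>(2))
  obtain \<xi> where \<xi>: "\<xi> \<in> bdry" "\<beta> \<in> \<xi>" using ray_bdry[OF ray] .
  have step: "\<exists>n\<ge>N. ereal (real k) \<le> E (Inl (x n)) (Inr \<xi>)" for k N :: nat
  proof -
    \<comment> \<open>Both products with \<open>\<beta> t\<close> are at least
      \<open>t - 2 * K - \<delta>\<close>, and passing through \<open>\<beta> t\<close> costs
      another \<open>\<delta>\<close>.\<close>
    define t where "t = real k + 2 * K + 2 * \<delta>"
    have t: "0 \<le> t" using K_nonneg delta_nonneg by (simp add: t_def)
    obtain n where n: "n \<ge> N" "\<gamma> n t = \<beta> t" "t \<le> l n"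
      using seg[of "{t}" N] t by auto
    have "gp (x n) (\<beta> t) \<ge> t - 2 * K"
      using \<gamma>(4)[of 0 n t] \<gamma>(4)[of t n "l n"] l[of n] n t \<gamma>(2,3)[of n] lx[of n] K_nonneg
        gp2[of "x n" "\<beta> t"] commute[of "x n" "\<beta> t"]
      by simp
    moreover have "ereal (t - 2 * K - \<delta>) \<le> E (Inl (\<beta> t)) (Inr \<xi>)"
      using ray_converges[OF \<xi> t] by (simp add: \<beta>0)
    ultimately have "ereal (t - 2 * K - \<delta> - \<delta>) \<le> E (Inl (x n)) (Inr \<xi>)"
      using delta_nonneg x \<xi> ray_in[OF ray t]
        E_hyp[of "Inl (x n)" "Inr \<xi>" "Inl (\<beta> t)" "t - 2 * K - \<delta>"] by simp
    then show ?thesis using n by (intro exI[of _ n]) (simp add: t_def)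
  qed
  have "\<exists>\<sigma>. \<forall>n. ereal (real n) \<le> E (Inl (x (\<sigma> n))) (Inr \<xi>) \<and> \<sigma> n < \<sigma> (Suc n)"
  proof (rule dependent_nat_choice)
    show "\<exists>m. ereal (real 0) \<le> E (Inl (x m)) (Inr \<xi>)" using step by blast
    show "\<exists>m'. ereal (real (Suc n)) \<le> E (Inl (x m')) (Inr \<xi>) \<and> m < m'" for m n
      using step[of "Suc m" "Suc n"] by (auto simp: Suc_le_eq)
  qed
  then obtain \<tau> where \<tau>: "\<And>n. ereal (real n) \<le> E (Inl (x (\<tau> n))) (Inr \<xi>)" "\<And>n. \<tau> n < \<tau> (Suc n)"
    by blast
  have "strict_mono \<tau>"
    using \<tau>(2) by (simp add: strict_mono_Suc_iff)
  then show ?thesis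
    using that[OF \<xi>(1) _ \<tau>(1)] by simp
qed

end

subsection \<open>Groups fixing a boundary point\<close>

lemma eventually_shift: "eventually P (at_top :: real filter) \<Longrightarrow> \<forall>\<^sub>F t in at_top. P (t + c)"
proof -
  assume "eventually P (at_top :: real filter)"
  then obtain N where "\<And>n. n \<ge> N \<Longrightarrow> P n" by (auto simp: eventually_at_top_linorder)
  then show ?thesis
    unfolding eventually_at_top_linorder by (intro exI[of _ "N - c"]) auto
qed

text \<open>The first positive term exceeds a nonpositive one by at most \<open>r\<close>.\<close>

lemma drift_hits_bounded:
  fixes u :: "nat \<Rightarrow> real"
  assumes u0: "u 0 \<le> 0" and c: "c > 0" and step: "\<And>n. c \<le> u (Suc n) - u n" "\<And>n. u (Suc n) - u n \<le> r"
  shows "\<exists>n. \<bar>u n\<bar> \<le> r"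
proof -
  have lower: "u n \<ge> u 0 + real n * c" for n
  proof (induction n)
    case (Suc n)
    then show ?case using step(1)[of n] by (simp add: algebra_simps)
  qed simp
  obtain N where "real N * c > - u 0"
    using c reals_Archimedean3 by blast
  then have ex: "u N > 0" using lower[of N] by linarith
  define n where "n = (LEAST n. u n > 0)"
  have n: "u n > 0" unfolding n_def using ex by (rule LeastI)
  then obtain m where m: "n = Suc m" using u0 by (cases n) auto
  then have "u m \<le> 0" using not_less_Least[of m "\<lambda>n. u n > 0"] unfolding n_def by force
  then have "\<bar>u n\<bar> \<le> r" using n step(2)[of m] unfolding m by linarith
  then show ?thesis ..
qed

text \<open>The last hypothesis says that every left coset of the cyclic subgroup meets
  \<open>L\<close>; inverses turn this into the right cosets that \<open>RCOSETS\<close>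
  collects.\<close>

lemma (in group) virtually_cyclicI:
  assumes g: "g \<in> carrier G" and L: "finite L" "L \<subseteq> carrier G"
    and ex: "\<And>x. x \<in> carrier G \<Longrightarrow> \<exists>h\<in>generate G {g}. x \<otimes> h \<in> L"
  shows "virtually_cyclic G"
proof -
  define H where "H = generate G {g}"
  have H: "subgroup H G"
    unfolding H_def using g by (intro generate_is_subgroup) auto
  have "G\<lparr>carrier := H\<rparr> = subgroup_generated G {g}"
    using g by (simp add: subgroup_generated_def H_def)
  then have "cyclic_group (G\<lparr>carrier := H\<rparr>)"
    by (simp add: cyclic_group_generated)
  moreover have "RCOSETS G H \<subseteq> (\<lambda>y. H #> inv y) ` L"
  proof
    fix C assume "C \<in> RCOSETS G H"
    then obtain a where a: "a \<in> carrier G" "C = H #> a"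
      by (auto simp: RCOSETS_def)
    obtain h where h: "h \<in> H" "inv a \<otimes> h \<in> L"
      using ex[of "inv a"] a unfolding H_def by auto
    have hX: "h \<in> carrier G" by (rule subgroup.mem_carrier[OF H h(1)])
    have "inv (inv a \<otimes> h) = inv h \<otimes> a"
      using a hX by (simp add: inv_mult_group)
    moreover have "inv h \<otimes> a \<in> H #> a"
      using subgroup.m_inv_closed[OF H h(1)] by (auto simp: r_coset_def)
    ultimately have "H #> a = H #> inv (inv a \<otimes> h)"
      using repr_independence[OF _ a(1) H, of "inv h \<otimes> a"] by simp
    then show "C \<in> (\<lambda>y. H #> inv y) ` L"
      using a h by blast
  qed
  then have "finite (RCOSETS G H)"
    using L finite_subset by blast
  ultimately show ?thesis
    unfolding virtually_cyclic_def using H by blast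
qed

text \<open>If \<open>b g\<close> is large compared with the defect \<open>B\<close>, each
  multiplication by \<open>g\<close> raises \<open>b\<close> by a positive bounded amount, and each
  multiplication by \<open>inv g\<close> lowers it likewise. So every element can be moved by powers
  of \<open>g\<close> into the finite set where \<open>b\<close> is bounded.\<close>

lemma (in group) quasimorphism_virtually_cyclic:
  fixes b :: "'a \<Rightarrow> real"
  assumes fin: "\<And>r. finite {g \<in> carrier G. \<bar>b g\<bar> \<le> r}"
    and qm: "\<And>g h. g \<in> carrier G \<Longrightarrow> h \<in> carrier G \<Longrightarrow> \<bar>b (g \<otimes> h) - b g - b h\<bar> \<le> B"
  shows "virtually_cyclic G"
proof (cases "finite (carrier G)")
  case True
  then show ?thesis
    by (rule virtually_cyclicI[OF one_closed]) (auto intro!: bexI[of _ \<one>] generate.one)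
next
  case False
  have B: "0 \<le> B" using qm[of \<one> \<one>] by simp
  have b1: "\<bar>b \<one>\<bar> \<le> B" using qm[of \<one> \<one>] by simp
  have binv: "\<bar>b (inv g) + b g\<bar> \<le> 2 * B" if "g \<in> carrier G" for g
    using qm[of g "inv g"] that b1 by simp
  \<comment> \<open>Replacing \<open>g0\<close> by its inverse to make \<open>b\<close> positive can
    cost \<open>2 * B\<close>, which leaves more than \<open>3 * B\<close>. That much is needed
    because multiplication by \<open>inv g\<close> lowers \<open>b\<close> by at least
    \<open>b g - 3 * B\<close>.\<close>
  obtain g0 where g0: "g0 \<in> carrier G" "\<bar>b g0\<bar> > 5 * B"
    using fin[of "5 * B"] False by (smt (verit) mem_Collect_eq finite_subset subsetI)
  obtain g where g: "g \<in> carrier G" "b g > 3 * B"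
  proof (cases "b g0 > 0")
    case True
    then show ?thesis using that[of g0] g0 B by simp
  next
    case False
    then show ?thesis using that[of "inv g0"] g0 binv[of g0] by simp
  qed
  \<comment> \<open>Bounds the steps in both directions: \<open>b g + B\<close> for
    \<open>g\<close>, and \<open>- b (inv g) + B\<close>, which is at most
    \<open>b g + 3 * B\<close>, for its inverse.\<close>
  define r where "r = b g + 3 * B"
  have ig: "\<bar>b (inv g) + b g\<bar> \<le> 2 * B" "inv g \<in> carrier G" using binv g by auto
  have pow: "g [^] n \<in> generate G {g}" "inv g [^] n \<in> generate G {g}" for n :: nat
  proof -
    show "g [^] n \<in> generate G {g}"
      by (induction n) (auto intro: generate.intros)
    show "inv g [^] n \<in> generate G {g}"
      by (induction n) (auto intro: generate.intros)
  qed
  show ?thesis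
  proof (rule virtually_cyclicI[OF g(1) fin[of r]])
    fix x assume x: "x \<in> carrier G"
    have st: "\<bar>b (x \<otimes> h [^] Suc n) - b (x \<otimes> h [^] n) - b h\<bar> \<le> B" if "h \<in> carrier G" for h and n :: nat
      using qm[of "x \<otimes> h [^] n" h] x that by (simp add: m_assoc)
    show "\<exists>h\<in>generate G {g}. x \<otimes> h \<in> {g \<in> carrier G. \<bar>b g\<bar> \<le> r}"
    proof (cases "b x \<le> 0")
      case True
      have "b g - B \<le> b (x \<otimes> g [^] Suc n) - b (x \<otimes> g [^] n)"
        "b (x \<otimes> g [^] Suc n) - b (x \<otimes> g [^] n) \<le> r" for n :: nat
        using st[OF g(1), of n] B by (simp_all only: r_def abs_le_iff, linarith+)
      then have "\<exists>n::nat. \<bar>b (x \<otimes> g [^] n)\<bar> \<le> r"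
        using True x g B by (intro drift_hits_bounded[where c = "b g - B"]) auto
      then obtain n :: nat where "\<bar>b (x \<otimes> g [^] n)\<bar> \<le> r" ..
      then show ?thesis using pow(1)[of n] x g(1) by (intro bexI[of _ "g [^] n"]) auto
    next
      case False
      have "- b (inv g) - B \<le> - b (x \<otimes> inv g [^] Suc n) - - b (x \<otimes> inv g [^] n)"
        "- b (x \<otimes> inv g [^] Suc n) - - b (x \<otimes> inv g [^] n) \<le> r" for n :: nat
        using st[OF ig(2), of n] ig(1) B by (simp_all only: r_def abs_le_iff, linarith+)
      moreover have "- b (inv g) - B > 0" using ig(1) g by linarith
      ultimately have "\<exists>n::nat. \<bar>- b (x \<otimes> inv g [^] n)\<bar> \<le> r"
        using False x by (intro drift_hits_bounded[where c = "- b (inv g) - B"]) auto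
      then obtain n :: nat where "\<bar>- b (x \<otimes> inv g [^] n)\<bar> \<le> r" ..
      then show ?thesis using pow(2)[of n] x g(1) by (intro bexI[of _ "inv g [^] n"]) auto
    qed
  qed auto
qed

context rough_hyperbolic_group
begin

text \<open>The function \<open>len (\<gamma> t) - t\<close> is bounded below and, up to
  \<open>K\<close>, decreasing, so it eventually stays near its infimum \<open>L\<close>. This is a
  coarse Busemann value of the ray.\<close>

lemma ray_len_eventually:
  assumes \<gamma>: "\<gamma> \<in> rays"
  obtains t0 L where "t0 \<ge> 0" "\<And>t. t \<ge> t0 \<Longrightarrow> \<bar>len (\<gamma> t) - t - L\<bar> \<le> K + 1"
proof -
  define f where "f t = len (\<gamma> t) - t" for t
  define L where "L = Inf (f ` {0..})"
  have bdd: "bdd_below (f ` {0..})"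
    unfolding bdd_below_def
    by (intro exI[of _ "- K - len (\<gamma> 0)"]) (use ray_len[OF \<gamma>] in \<open>force simp: f_def\<close>)
  have L: "L \<le> f t" if "0 \<le> t" for t
    unfolding L_def by (rule cInf_lower) (use that bdd in auto)
  have "Inf (f ` {0..}) < L + 1" by (simp add: L_def)
  then have "\<exists>y\<in>f ` {0..}. y < L + 1"
    using cInf_less_iff[OF _ bdd] by auto
  then obtain t0 where t0: "t0 \<ge> 0" "f t0 < L + 1" by auto
  have "\<bar>len (\<gamma> t) - t - L\<bar> \<le> K + 1" if t: "t \<ge> t0" for t
  proof -
    have "len (\<gamma> t) \<le> len (\<gamma> t0) + d (\<gamma> t0) (\<gamma> t)"
      using triangle ray_in[OF \<gamma>] t t0 by simp
    then have "f t \<le> f t0 + K"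
      using ray_dist[OF \<gamma>, of t0 t] t t0 by (simp add: f_def)
    then show ?thesis
      using L[of t] t t0 K_nonneg by (simp add: f_def)
  qed
  then show ?thesis using that t0 by blast
qed

text \<open>Points of the two rays at the same distance from \<open>\<one>\<close> are close,
  because their Gromov product is almost equal to that distance. The bound does not depend on the
  rays, which later makes the defect of the quasimorphism uniform.\<close>

lemma rays_merge:
  assumes \<gamma>: "\<gamma> \<in> rays" "\<gamma>' \<in> rays"
    and lim: "\<And>M. \<forall>\<^sub>F t in at_top. M \<le> gp (\<gamma> t) (\<gamma>' t)"
  shows "\<exists>c. \<forall>\<^sub>F t in at_top. d (\<gamma> t) (\<gamma>' (t + c)) \<le> 5 * K + 4 * \<delta> + 4"
proof -
  obtain t0 L where L: "t0 \<ge> 0" "\<And>t. t \<ge> t0 \<Longrightarrow> \<bar>len (\<gamma> t) - t - L\<bar> \<le> K + 1"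
    using ray_len_eventually[OF \<gamma>(1)] by metis
  obtain t0' L' where L': "t0' \<ge> 0" "\<And>t. t \<ge> t0' \<Longrightarrow> \<bar>len (\<gamma>' t) - t - L'\<bar> \<le> K + 1"
    using ray_len_eventually[OF \<gamma>(2)] by metis
  \<comment> \<open>With this shift both \<open>\<gamma> t\<close> and
    \<open>\<gamma>' (t + c)\<close> have length about \<open>t + L\<close>.\<close>
  define c where "c = L - L'"
  have "d (\<gamma> t) (\<gamma>' (t + c)) \<le> 5 * K + 4 * \<delta> + 4" if t: "t \<ge> t0" "t + c \<ge> t0'" for t
  proof -
    have "\<forall>\<^sub>F T in at_top. t + L \<le> gp (\<gamma> T) (\<gamma>' T) \<and> T \<ge> max t (t + c)"
      using lim eventually_ge_at_top by (rule eventually_conj)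
    then obtain T where T: "t + L \<le> gp (\<gamma> T) (\<gamma>' T)" "T \<ge> t" "T \<ge> t + c"
      using eventually_happens'[OF trivial_limit_at_top_linorder] by fastforce
    define p q P Q where "p = \<gamma> t" "q = \<gamma>' (t + c)" "P = \<gamma> T" "Q = \<gamma>' T"
    note defs = this
    have X: "p \<in> X" "q \<in> X" "P \<in> X" "Q \<in> X"
      using ray_in \<gamma> t T L(1) L'(1) by (auto simp: defs)
    have lens: "\<bar>len p - (t + L)\<bar> \<le> K + 1" "\<bar>len P - (T + L)\<bar> \<le> K + 1"
      "\<bar>len q - (t + L)\<bar> \<le> K + 1" "\<bar>len Q - (T + L')\<bar> \<le> K + 1"
      using L(2)[of t] L(2)[of T] L'(2)[of "t + c"] L'(2)[of T] t T by (auto simp: defs c_def)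
    have "d p P \<le> T - t + K" "d q Q \<le> T - (t + c) + K"
      using ray_dist[OF \<gamma>(1), of t T] ray_dist[OF \<gamma>(2), of "t + c" T] t T L(1) L'(1)
      by (auto simp: defs)
    then have g1: "2 * gp p P \<ge> 2 * (t + L) - 3 * K - 2" and g2: "2 * gp Q q \<ge> 2 * (t + L) - 3 * K - 2"
      using gp2[of p P] gp2[of q Q] gp_sym[of q Q] lens by (auto simp: c_def)
    have "gp p q \<ge> min (gp p P) (gp P q) - \<delta>" "gp P q \<ge> min (gp P Q) (gp Q q) - \<delta>"
      using hyp X by auto
    moreover have "gp P Q \<ge> t + L" using T by (simp add: defs)
    ultimately have "2 * gp p q \<ge> 2 * (t + L) - 3 * K - 2 - 4 * \<delta>"
      using g1 g2 K_nonneg delta_nonneg by (auto simp: min_def split: if_splits)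
    moreover have "len p \<le> t + L + K + 1" "len q \<le> t + L + K + 1"
      using lens(1,3) by linarith+
    ultimately have "d p q \<le> 5 * K + 4 * \<delta> + 4"
      using gp2[of p q] by argo
    then show ?thesis by (simp add: defs)
  qed
  moreover have "\<forall>\<^sub>F t in at_top. t \<ge> max t0 (t0' - c)" by (rule eventually_ge_at_top)
  ultimately have "\<forall>\<^sub>F t in at_top. d (\<gamma> t) (\<gamma>' (t + c)) \<le> 5 * K + 4 * \<delta> + 4"
    by (auto elim!: eventually_mono)
  then show ?thesis by blast
qed

lemma translated_ray:
  assumes "\<gamma> \<in> rays" "g \<in> X"
  shows "(\<lambda>t\<in>{0..}. g \<otimes> \<gamma> t) \<in> rays"
  using assms by (auto simp: rough_rays_def roughly_geodesic_on_def left_inv PiE_iff)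

text \<open>Translating by \<open>g\<close> shifts a ray towards the fixed point by some \<open>b g\<close>, and \<open>b\<close> is a
  quasimorphism. Its sublevel sets are finite: for large \<open>t\<close>, conjugation by \<open>\<gamma> t\<close> embeds any finite
  subset of \<open>{g. \<bar>b g\<bar> \<le> r}\<close> into a ball whose radius does not depend on \<open>t\<close>.\<close>

lemma boundary_fixed_point_virtually_cyclic:
  assumes \<gamma>: "\<gamma> \<in> rays"
    and fix_pt: "\<And>a M. a \<in> X \<Longrightarrow> \<forall>\<^sub>F t in at_top. M \<le> gp (a \<otimes> \<gamma> t) (\<gamma> t)"
  shows "virtually_cyclic G"
proof -
  define C where "C = 5 * K + 4 * \<delta> + 4"
  have "\<exists>c. \<forall>\<^sub>F t in at_top. d (g \<otimes> \<gamma> t) (\<gamma> (t + c)) \<le> C" if g: "g \<in> X" for g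
  proof -
    have ev0: "\<forall>\<^sub>F t::real in at_top. t \<ge> 0" by (rule eventually_ge_at_top)
    have "\<exists>c. \<forall>\<^sub>F t in at_top. d ((\<lambda>t\<in>{0..}. g \<otimes> \<gamma> t) t) (\<gamma> (t + c)) \<le> C"
      unfolding C_def
    proof (rule rays_merge[OF translated_ray[OF \<gamma> g] \<gamma>])
      show "\<forall>\<^sub>F t in at_top. M \<le> gp ((\<lambda>t\<in>{0..}. g \<otimes> \<gamma> t) t) (\<gamma> t)" for M
        using fix_pt[OF g, of M] ev0 by eventually_elim simp
    qed
    then obtain c where "\<forall>\<^sub>F t in at_top. d ((\<lambda>t\<in>{0..}. g \<otimes> \<gamma> t) t) (\<gamma> (t + c)) \<le> C" ..
    then have "\<forall>\<^sub>F t in at_top. d (g \<otimes> \<gamma> t) (\<gamma> (t + c)) \<le> C"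
      using ev0 by eventually_elim simp
    then show ?thesis ..
  qed
  then obtain b where b: "\<And>g. g \<in> X \<Longrightarrow> \<forall>\<^sub>F t in at_top. d (g \<otimes> \<gamma> t) (\<gamma> (t + b g)) \<le> C"
    by metis
  show ?thesis
  proof (rule quasimorphism_virtually_cyclic)
    fix g h assume gh: "g \<in> X" "h \<in> X"
    \<comment> \<open>Both points are compared with
      \<open>g \<otimes> (h \<otimes> \<gamma> t)\<close>: once by shifting for
      \<open>g \<otimes> h\<close>, once by shifting for \<open>h\<close>, translating by
      \<open>g\<close> and shifting for \<open>g\<close>.\<close>
    have "\<forall>\<^sub>F t in at_top. d (\<gamma> (t + b (g \<otimes> h))) (\<gamma> (t + b h + b g)) \<le> 3 * C \<and>
        0 \<le> t + b (g \<otimes> h) \<and> 0 \<le> t + b h + b g"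
      using b[OF m_closed[OF gh]] b[OF gh(2)] eventually_shift[OF b[OF gh(1)], of "b h"]
        eventually_ge_at_top[of 0] eventually_ge_at_top[of "- b h"]
        eventually_ge_at_top[of "- b h - b g"] eventually_ge_at_top[of "- b (g \<otimes> h)"]
    proof eventually_elim
      case (elim t)
      define p q r s where "p = \<gamma> (t + b (g \<otimes> h))" "q = g \<otimes> (h \<otimes> \<gamma> t)"
        "r = g \<otimes> \<gamma> (t + b h)" "s = \<gamma> (t + b h + b g)"
      note defs = this
      have \<gamma>X: "\<gamma> t \<in> X" "\<gamma> (t + b h) \<in> X" using ray_in[OF \<gamma>] elim by auto
      have X: "p \<in> X" "q \<in> X" "r \<in> X" "s \<in> X"
        using \<gamma>X ray_in[OF \<gamma>] gh elim by (auto simp: defs)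
      have "d p q \<le> C" using elim gh \<gamma>X by (simp add: defs m_assoc commute)
      moreover have "d q r \<le> C" using elim gh \<gamma>X by (simp add: defs left_inv)
      moreover have "d r s \<le> C" using elim by (simp add: defs)
      ultimately have "d p s \<le> 3 * C"
        using triangle[of p q s] triangle[of q r s] X by linarith
      then show ?case using elim by (simp add: defs)
    qed
    then obtain t where t: "d (\<gamma> (t + b (g \<otimes> h))) (\<gamma> (t + b h + b g)) \<le> 3 * C"
        "0 \<le> t + b (g \<otimes> h)" "0 \<le> t + b h + b g"
      using eventually_happens'[OF trivial_limit_at_top_linorder] by blast
    show "\<bar>b (g \<otimes> h) - b g - b h\<bar> \<le> 3 * C + K"
      using t(1) ray_dist[OF \<gamma> t(2,3)] by linarith
  next
    fix r
    \<comment> \<open>The time from which the shift estimate holds depends on the element, so one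
      \<open>t\<close> serves only finitely many of them. The bound on the cardinality is the same
      for all \<open>F\<close>.\<close>
    have "card F \<le> bcard (C + r + K)" if F: "F \<subseteq> {g \<in> X. \<bar>b g\<bar> \<le> r}" "finite F" for F
    proof -
      have "\<forall>\<^sub>F t in at_top. \<forall>g\<in>F. d (g \<otimes> \<gamma> t) (\<gamma> (t + b g)) \<le> C"
        using F by (intro eventually_ball_finite) (auto intro: b)
      then have "\<forall>\<^sub>F t in at_top. (\<forall>g\<in>F. d (g \<otimes> \<gamma> t) (\<gamma> (t + b g)) \<le> C) \<and> t \<ge> \<bar>r\<bar>"
        by (rule eventually_conj) (rule eventually_ge_at_top)
      then obtain t where t: "\<And>g. g \<in> F \<Longrightarrow> d (g \<otimes> \<gamma> t) (\<gamma> (t + b g)) \<le> C" "t \<ge> \<bar>r\<bar>"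
        using eventually_happens'[OF trivial_limit_at_top_linorder] by blast
      have tX: "\<gamma> t \<in> X" using ray_in[OF \<gamma>] t(2) by simp
      have "card F = card ((\<lambda>g. g \<otimes> \<gamma> t) ` F)"
      proof (rule card_image[symmetric], rule inj_onI)
        fix x y assume "x \<in> F" "y \<in> F" "x \<otimes> \<gamma> t = y \<otimes> \<gamma> t"
        moreover from this have "x \<in> X" "y \<in> X" using F by auto
        ultimately show "x = y" using tX by simp
      qed
      also have "\<dots> \<le> card {y \<in> X. d (\<gamma> t) y \<le> C + r + K}"
      proof (rule card_mono[OF finite_translated_ball[OF tX]], clarify)
        fix g assume g: "g \<in> F"
        then have gX: "g \<in> X" "\<bar>b g\<bar> \<le> r" using F by auto
        then have "0 \<le> t + b g" using t(2) by linarith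
        moreover have "0 \<le> t" using t(2) by linarith
        ultimately have "d (\<gamma> t) (\<gamma> (t + b g)) \<le> r + K" "\<gamma> (t + b g) \<in> X"
          using ray_dist[OF \<gamma>, of t "t + b g"] gX ray_in[OF \<gamma>] by auto
        then show "g \<otimes> \<gamma> t \<in> X \<and> d (\<gamma> t) (g \<otimes> \<gamma> t) \<le> C + r + K"
          using t(1)[OF g] gX tX triangle'[of "\<gamma> t" "\<gamma> (t + b g)" "g \<otimes> \<gamma> t"] by simp
      qed
      finally show ?thesis using card_translated_ball tX by simp
    qed
    then show "finite {g \<in> X. \<bar>b g\<bar> \<le> r}"
      using finite_if_finite_subsets_card_bdd by blast
  qed
qed

text \<open>If this fails, there are \<open>u n\<close> and \<open>y n\<close> such that \<open>u n\<close> and all short translates of \<open>y n\<close>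
  converge to the same boundary point, which is then fixed by the whole group.\<close>

lemma almost_additive_products:
  assumes nve: "\<not> virtually_cyclic G"
  obtains C where "C \<ge> 0"
    "\<And>x y. x \<in> X \<Longrightarrow> y \<in> X \<Longrightarrow> \<exists>a\<in>X. len a \<le> C \<and> len (x \<otimes> a \<otimes> y) \<ge> len x + len y - C"
proof (rule ccontr)
  assume neg: "\<not> thesis"
  have "\<exists>u\<in>X. \<exists>y\<in>X. \<forall>a\<in>X. len a \<le> real n \<longrightarrow> gp u (a \<otimes> y) \<ge> real n" for n :: nat
  proof -
    \<comment> \<open>Of the defect \<open>3 * n\<close>, at most \<open>n\<close> is lost in
      comparing \<open>y\<close> with \<open>a \<otimes> y\<close>; the remaining
      \<open>2 * n\<close> is twice the desired Gromov product.\<close>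
    have "\<exists>x\<in>X. \<exists>y\<in>X. \<forall>a\<in>X. len a \<le> 3 * real n \<longrightarrow> \<not> len (x \<otimes> a \<otimes> y) \<ge> len x + len y - 3 * real n"
      using neg that[of "3 * real n"] by fastforce
    then obtain x y where xy: "x \<in> X" "y \<in> X"
      "\<And>a. a \<in> X \<Longrightarrow> len a \<le> 3 * real n \<Longrightarrow> len (x \<otimes> a \<otimes> y) < len x + len y - 3 * real n"
      by (meson not_le)
    have "gp (inv x) (a \<otimes> y) \<ge> real n" if a: "a \<in> X" "len a \<le> real n" for a
    proof -
      have "d (inv x) (a \<otimes> y) = len (x \<otimes> a \<otimes> y)"
        using dist_eq_len[of "inv x" "a \<otimes> y"] a xy by (simp add: m_assoc)
      moreover have "len y \<le> len a + len (a \<otimes> y)"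
        using len_mult[of "inv a" "a \<otimes> y"] a xy by (simp add: len_inv m_assoc[symmetric])
      moreover have "len (x \<otimes> a \<otimes> y) < len x + len y - 3 * real n"
        using xy(3)[of a] a by simp
      ultimately show ?thesis
        using gp2[of "inv x" "a \<otimes> y"] len_inv[OF xy(1)] a(2) by linarith
    qed
    then show ?thesis using xy by (intro bexI[of _ "inv x"] bexI[of _ y]) auto
  qed
  then obtain u y where uy: "\<And>n. u n \<in> X" "\<And>n. y n \<in> X"
    "\<And>n a. a \<in> X \<Longrightarrow> len a \<le> real n \<Longrightarrow> gp (u n) (a \<otimes> y n) \<ge> real n"
    by metis
  have "real n \<le> len (u n)" for n
    using uy(3)[of \<one> n] gp_le_len[of "u n" "y n"] uy(1,2) by simp
  then have "filterlim (\<lambda>n. len (u n)) at_top sequentially"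
    by (intro filterlim_at_top_mono[OF filterlim_real_sequentially] always_eventually) auto
  then obtain \<xi> \<sigma> where \<xi>: "\<xi> \<in> bdry" "strict_mono \<sigma>"
    "\<And>n::nat. ereal (real n) \<le> E (Inl (u (\<sigma> n))) (Inr \<xi>)"
    using bdry_compactness[of u] uy(1) by blast
  obtain \<gamma> where \<gamma>: "\<gamma> \<in> \<xi>" using bdry_nonempty \<xi> by blast
  then have ray: "\<gamma> \<in> rays" using bdry_ray \<xi> by blast
  have conv: "\<forall>\<^sub>F t in at_top. real n - \<delta> - 1 < gp (a \<otimes> y (\<sigma> n)) (\<gamma> t)" if a: "a \<in> X" "len a \<le> real n" for n a
  proof -
    have "n \<le> \<sigma> n" using strict_mono_imp_increasing[OF \<xi>(2)] .
    then have "gp (u (\<sigma> n)) (a \<otimes> y (\<sigma> n)) \<ge> real n"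
      using uy(3)[of a "\<sigma> n"] a by (smt (verit) of_nat_mono)
    then have "ereal (real n - \<delta>) \<le> E (Inl (a \<otimes> y (\<sigma> n))) (Inr \<xi>)"
      using E_hyp[of "Inl (a \<otimes> y (\<sigma> n))" "Inr \<xi>" "Inl (u (\<sigma> n))" "real n"] \<xi> uy a by (simp add: gp_sym)
    from E_geD[OF this, of "\<lambda>_. a \<otimes> y (\<sigma> n)" \<gamma> "real n - \<delta> - 1"] \<gamma> show ?thesis by simp
  qed
  have "virtually_cyclic G"
  proof (rule boundary_fixed_point_virtually_cyclic[OF ray])
    fix a M assume a: "a \<in> X"
    obtain n :: nat where n: "real n \<ge> \<bar>M\<bar> + 2 * \<delta> + 1 + len a"
      using real_arch_simple by blast
    have la: "len a \<le> real n" using n delta_nonneg by linarith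
    have l1: "len \<one> \<le> real n" by simp
    show "\<forall>\<^sub>F t in at_top. M \<le> gp (a \<otimes> \<gamma> t) (\<gamma> t)"
      using conv[OF a la] conv[OF one_closed l1] eventually_ge_at_top[of 0]
    proof eventually_elim
      case (elim t)
      have X: "\<gamma> t \<in> X" "y (\<sigma> n) \<in> X" using ray_in[OF ray] elim uy by auto
      have "gp (\<gamma> t) (y (\<sigma> n)) > real n - \<delta> - 1"
        using elim X by (simp add: gp_sym)
      then have "gp (a \<otimes> \<gamma> t) (a \<otimes> y (\<sigma> n)) \<ge> real n - \<delta> - 1 - len a"
        using gp_left_mult[OF a X] by linarith
      moreover have "gp (a \<otimes> \<gamma> t) (\<gamma> t) \<ge>
          min (gp (a \<otimes> \<gamma> t) (a \<otimes> y (\<sigma> n))) (gp (a \<otimes> y (\<sigma> n)) (\<gamma> t)) - \<delta>"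
        using hyp X a by auto
      ultimately show ?case using elim n nonneg[of \<one> a] by linarith
    qed
  qed
  then show False using nve by simp
qed

end

subsection \<open>Growth\<close>

text \<open>Monotonicity allows a real argument \<open>x\<close> to be rounded up to a multiple of
  \<open>r\<close>, which reduces the claim to Fekete's argument. The limit is the infimum of the
  quotients, and this gives the linear lower bound on \<open>f\<close>.\<close>

lemma fekete_real:
  fixes f :: "real \<Rightarrow> real"
  assumes sub: "\<And>x y. 0 \<le> x \<Longrightarrow> 0 \<le> y \<Longrightarrow> f (x + y) \<le> f x + f y"
    and mono: "\<And>x y. 0 \<le> x \<Longrightarrow> x \<le> y \<Longrightarrow> f x \<le> f y"
    and nonneg: "\<And>x. 0 \<le> x \<Longrightarrow> 0 \<le> f x"
  obtains L where "L \<ge> 0" "((\<lambda>x. f x / x) \<longlongrightarrow> L) at_top" "\<And>x. 0 \<le> x \<Longrightarrow> L * x \<le> f x"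
proof -
  define L where "L = Inf ((\<lambda>x. f x / x) ` {0<..})"
  have bdd: "bdd_below ((\<lambda>x. f x / x) ` {0<..})"
    unfolding bdd_below_def by (intro exI[of _ 0]) (auto intro!: divide_nonneg_pos nonneg)
  have L_le: "L \<le> f x / x" if "0 < x" for x
    unfolding L_def by (rule cInf_lower) (use that bdd in auto)
  have L0: "L \<ge> 0"
    unfolding L_def by (rule cInf_greatest) (auto intro!: divide_nonneg_pos nonneg)
  have lower: "L * x \<le> f x" if "0 \<le> x" for x
    using L_le[of x] that nonneg[of x] by (cases "x = 0") (auto simp: field_simps)
  have mult: "f (real k * r) \<le> real k * f r + f 0" if "0 \<le> r" for k r
  proof (induction k)
    case (Suc k)
    have "f (real k * r + r) \<le> f (real k * r) + f r" using sub that by simp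
    then show ?case using Suc by (simp add: algebra_simps)
  qed simp
  have "((\<lambda>x. f x / x) \<longlongrightarrow> L) at_top"
  proof (rule tendstoI)
    fix e :: real assume e: "0 < e"
    have "Inf ((\<lambda>x. f x / x) ` {0<..}) < L + e / 2" using e by (simp add: L_def)
    then obtain r where r: "0 < r" "f r / r < L + e / 2"
      using cInf_less_iff[OF _ bdd] by auto
    have "\<forall>\<^sub>F x in at_top. x > 2 * (f r + f 0) / e" by (rule eventually_gt_at_top)
    moreover have "\<forall>\<^sub>F x in at_top. x > (0::real)" by (rule eventually_gt_at_top)
    ultimately show "\<forall>\<^sub>F x in at_top. dist (f x / x) L < e"
    proof eventually_elim
      case (elim x)
      define k where "k = nat \<lfloor>x / r\<rfloor>"
      have k: "real k * r \<le> x" "x \<le> real k * r + r"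
      proof -
        have "real k = real_of_int \<lfloor>x / r\<rfloor>" using elim r by (simp add: k_def)
        then have "real k \<le> x / r" "x / r \<le> real k + 1" by linarith+
        then show "real k * r \<le> x" "x \<le> real k * r + r" using r by (simp_all add: field_simps)
      qed
      have "f x \<le> f (real k * r + r)" using mono elim k by simp
      also have "\<dots> \<le> f (real k * r) + f r" using sub r by simp
      also have "\<dots> \<le> real k * f r + f 0 + f r" using mult[of r k] r by simp
      also have "real k * f r = (real k * r) * (f r / r)" using r by simp
      also have "\<dots> \<le> x * (f r / r)"
        using k r nonneg[of r] by (intro mult_right_mono) auto
      finally have "f x / x \<le> f r / r + (f r + f 0) / x"
        using elim r by (simp add: field_simps)
      also have "(f r + f 0) / x < e / 2"
        using elim e by (simp add: field_simps)
      finally have "f x / x < L + e" using r by simp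
      then show ?case using L_le[of x] elim by (simp add: dist_real_def)
    qed
  qed
  then show ?thesis using that L0 lower by blast
qed

locale nonelementary_hyperbolic_group = rough_hyperbolic_group +
  assumes nonelementary: "\<not> virtually_cyclic G"
begin

lemma infinite_carrier: "infinite X"
proof
  assume "finite X"
  then have "virtually_cyclic G"
    by (intro virtually_cyclicI[OF one_closed]) (auto intro!: bexI[of _ \<one>] generate.one)
  then show False using nonelementary by simp
qed

lemma ex_long: "\<exists>g\<in>X. len g \<ge> r"
proof (rule ccontr)
  assume "\<not> ?thesis"
  then have "X \<subseteq> {g \<in> X. len g \<le> r}" by auto
  then show False using finite_cball[of r] infinite_carrier finite_subset by blast
qed

lemma ball_truncate:
  assumes "g \<in> X" "0 \<le> r"
  shows "\<exists>x\<in>X. len x \<le> r \<and> d x g \<le> max 0 (len g - r) + 10 * K"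
proof -
  consider "len g \<le> r" | "len g > r" "r < 2 * K" | "len g > r" "2 * K \<le> r" by linarith
  then show ?thesis
  proof cases
    case 1
    then show ?thesis using assms K_nonneg by (intro bexI[of _ g]) auto
  next
    case 2
    then show ?thesis using assms K_nonneg by (intro bexI[of _ \<one>]) auto
  next
    case 3
    \<comment> \<open>Truncation may overshoot by \<open>2 * K\<close>, so it is done at
      \<open>r - 2 * K\<close> to stay inside the ball.\<close>
    have r: "0 \<le> r - 2 * K" "r - 2 * K \<le> len g" using 3 K_nonneg by linarith+
    obtain x where x: "x \<in> X" "\<bar>len x - (r - 2 * K)\<bar> \<le> 2 * K" "gp x g \<ge> r - 2 * K - 3 * K"
      using truncate[OF assms(1) r] by metis
    have "len x \<le> r" using x by linarith
    moreover have "d x g \<le> len g - r + 10 * K" using dist_eq_gp[of x g] x by linarith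
    ultimately show ?thesis using x 3 by (intro bexI[of _ x]) auto
  qed
qed

lemma bcard_shift:
  assumes "0 \<le> r" "0 \<le> c"
  shows "bcard (r + c) \<le> bcard (2 * c + 20 * K) * bcard r"
proof -
  obtain f where f: "\<And>g. g \<in> X \<Longrightarrow> f g \<in> X \<and> len (f g) \<le> r \<and> d (f g) g \<le> max 0 (len g - r) + 10 * K"
    using ball_truncate[OF _ assms(1)] by metis
  show ?thesis
    unfolding bcard_def[of "r + c"] bcard_def[of r]
  proof (rule card_le_close_fibres[OF finite_cball _ finite_cball])
    fix a a' assume *: "a \<in> {g \<in> X. len g \<le> r + c}" "a' \<in> {g \<in> X. len g \<le> r + c}" "f a = f a'"
    then have "d (f a) a \<le> c + 10 * K" "d (f a) a' \<le> c + 10 * K"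
      using f[of a] f[of a'] assms by auto
    then show "d a a' \<le> 2 * c + 20 * K"
      using triangle''[of a "f a" a'] f[of a] * by auto
  qed (use f in auto)
qed

text \<open>An element is cut at length \<open>m\<close> into two factors, which determine it. The
  second factor may exceed \<open>n\<close> by \<open>10 * K\<close>, and \<open>bcard_shift\<close>
  with that excess produces the constant \<open>bcard (40 * K)\<close>.\<close>

lemma bcard_submult:
  assumes "0 \<le> m" "0 \<le> n"
  shows "bcard (m + n) \<le> bcard (40 * K) * (bcard m * bcard n)"
proof -
  obtain f where f: "\<And>g. g \<in> X \<Longrightarrow> f g \<in> X \<and> len (f g) \<le> m \<and> d (f g) g \<le> max 0 (len g - m) + 10 * K"
    using ball_truncate[OF _ assms(1)] by metis
  define \<phi> where "\<phi> g = (f g, inv (f g) \<otimes> g)" for g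
  have "bcard (m + n) \<le> card ({g \<in> X. len g \<le> m} \<times> {g \<in> X. len g \<le> n + 10 * K})"
    unfolding bcard_def
  proof (rule card_inj_on_le[of \<phi>])
    show "inj_on \<phi> {g \<in> X. len g \<le> m + n}"
    proof (rule inj_onI)
      fix x y assume "x \<in> {g \<in> X. len g \<le> m + n}" "y \<in> {g \<in> X. len g \<le> m + n}" "\<phi> x = \<phi> y"
      then have *: "x \<in> X" "y \<in> X" "inv (f x) \<otimes> x = inv (f x) \<otimes> y" by (auto simp: \<phi>_def)
      show "x = y" using f[OF *(1)] * by simp
    qed
    show "\<phi> ` {g \<in> X. len g \<le> m + n} \<subseteq> {g \<in> X. len g \<le> m} \<times> {g \<in> X. len g \<le> n + 10 * K}"
    proof (rule image_subsetI)
      fix g assume "g \<in> {g \<in> X. len g \<le> m + n}"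
      then have g: "g \<in> X" "len g \<le> m + n" by auto
      have "len (inv (f g) \<otimes> g) = d (f g) g" using f g by (simp add: dist_eq_len[of "f g" g])
      moreover have "max 0 (len g - m) \<le> n" using g assms by simp
      moreover have "d (f g) g \<le> max 0 (len g - m) + 10 * K" using f[OF g(1)] by blast
      ultimately have "len (inv (f g) \<otimes> g) \<le> n + 10 * K" by linarith
      then show "\<phi> g \<in> {g \<in> X. len g \<le> m} \<times> {g \<in> X. len g \<le> n + 10 * K}"
        using f[OF g(1)] g by (simp add: \<phi>_def)
    qed
  qed (simp add: finite_cball)
  also have "\<dots> = bcard m * bcard (n + 10 * K)"
    by (simp add: card_cartesian_product bcard_def)
  also have "\<dots> \<le> bcard m * (bcard (2 * (10 * K) + 20 * K) * bcard n)"
    using bcard_shift[OF assms(2), of "10 * K"] K_nonneg by (intro mult_left_mono) auto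
  finally show ?thesis by (simp add: algebra_simps)
qed

definition "\<omega> = growth_rate G d"

text \<open>\<open>growth_rate\<close> is a \<open>Lim\<close>, so it has its intended meaning only
  once the limit exists. The factor \<open>M\<close> makes \<open>ln (M * bcard R)\<close>
  subadditive, and Fekete's lemma then gives the limit and the lower bound on balls
  together.\<close>

lemma growth:
  obtains M where "M \<ge> 1" "\<omega> \<ge> 1"
    "((\<lambda>R. ln (real (bcard R)) / R) \<longlongrightarrow> ln \<omega>) at_top"
    "\<And>R. 0 \<le> R \<Longrightarrow> \<omega> powr R \<le> M * real (bcard R)"
proof -
  define M where "M = real (bcard (40 * K))"
  have M: "M \<ge> 1" using bcard_ge_1[of "40 * K"] K_nonneg by (simp add: M_def)
  define f where "f R = ln (M * real (bcard R))" for R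
  have b1: "real (bcard R) \<ge> 1" if "0 \<le> R" for R using bcard_ge_1[OF that] by simp
  have pos: "M * real (bcard R) \<ge> 1" if "0 \<le> R" for R
    using mult_mono[OF M b1[OF that]] M by simp
  have expf: "exp (f R) = M * real (bcard R)" if "0 \<le> R" for R
    using pos[OF that] by (simp add: f_def)
  obtain L where L: "L \<ge> 0" "((\<lambda>x. f x / x) \<longlongrightarrow> L) at_top" "\<And>x. 0 \<le> x \<Longrightarrow> L * x \<le> f x"
  proof (rule fekete_real[of f])
    fix x y :: real assume xy: "0 \<le> x" "0 \<le> y"
    have "M * real (bcard (x + y)) \<le> M * (M * (real (bcard x) * real (bcard y)))"
      using bcard_submult[OF xy] M unfolding M_def by (intro mult_left_mono) (simp_all flip: of_nat_mult)
    also have "\<dots> = (M * real (bcard x)) * (M * real (bcard y))" by simp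
    finally have "f (x + y) \<le> ln ((M * real (bcard x)) * (M * real (bcard y)))"
      unfolding f_def using pos[of "x + y"] xy by (intro ln_mono) auto
    also have "\<dots> = f x + f y"
      unfolding f_def using pos[OF xy(1)] pos[OF xy(2)] by (intro ln_mult_pos) auto
    finally show "f (x + y) \<le> f x + f y" .
  next
    fix x y :: real assume xy: "0 \<le> x" "x \<le> y"
    show "f x \<le> f y"
      unfolding f_def using pos[OF xy(1)] M bcard_mono[OF xy(2)]
      by (intro ln_mono mult_left_mono) auto
  next
    fix x :: real assume "0 \<le> x"
    then show "0 \<le> f x" using pos by (simp add: f_def)
  qed blast
  have lim: "((\<lambda>R. ln (real (bcard R)) / R) \<longlongrightarrow> L) at_top"
  proof -
    have 1: "((\<lambda>R. f R / R - ln M / R) \<longlongrightarrow> L - 0) at_top"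
      by (intro tendsto_diff L(2) real_tendsto_divide_at_top[OF tendsto_const] filterlim_ident)
    have 2: "\<forall>\<^sub>F R in at_top. f R / R - ln M / R = ln (real (bcard R)) / R"
      using eventually_ge_at_top[of 0]
    proof eventually_elim
      case (elim R)
      have "f R = ln M + ln (real (bcard R))"
        unfolding f_def using M b1[OF elim] by (intro ln_mult_pos) auto
      then show ?case by (simp add: field_simps diff_divide_distrib[symmetric])
    qed
    show ?thesis using tendsto_cong[OF 2] 1 by simp
  qed
  have "((\<lambda>R. real (bcard R) powr (1 / R)) \<longlongrightarrow> exp L) at_top"
  proof -
    have "\<forall>\<^sub>F R in at_top. exp (ln (real (bcard R)) / R) = real (bcard R) powr (1 / R)"
      using eventually_ge_at_top[of 0]
      by eventually_elim (use b1 in \<open>force simp: powr_def\<close>)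
    then show ?thesis by (rule Lim_transform_eventually[OF tendsto_exp[OF lim]])
  qed
  then have \<omega>: "\<omega> = exp L"
    unfolding \<omega>_def growth_rate_def bcard_def by (intro tendsto_Lim) auto
  show ?thesis
  proof (rule that[OF M])
    show "\<omega> \<ge> 1" using L(1) by (simp add: \<omega>)
    show "((\<lambda>R. ln (real (bcard R)) / R) \<longlongrightarrow> ln \<omega>) at_top" using lim by (simp add: \<omega>)
    fix R :: real assume R: "0 \<le> R"
    have "\<omega> powr R = exp (L * R)" by (simp add: \<omega> powr_def mult.commute)
    also have "\<dots> \<le> exp (f R)" using L(3)[OF R] by simp
    finally show "\<omega> powr R \<le> M * real (bcard R)" using expf[OF R] by simp
  qed
qed

lemma omega_ge_1: "\<omega> \<ge> 1"
  using growth by metis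

lemma omega_powr_mono: "x \<le> y \<Longrightarrow> \<omega> powr x \<le> \<omega> powr y"
  using omega_ge_1 by (simp add: powr_mono)

section \<open>Purely exponential growth of annuli\<close>

definition "ann r w = {g \<in> X. \<bar>len g - r\<bar> \<le> w}"

lemma finite_ann: "finite (ann r w)"
  by (rule finite_subset[OF _ finite_cball[of "r + w"]]) (auto simp: ann_def)

lemma ann_nonempty: "0 \<le> r \<Longrightarrow> ann r (2 * K) \<noteq> {}"
proof -
  assume r: "0 \<le> r"
  obtain g where g: "g \<in> X" "r \<le> len g" using ex_long by blast
  obtain x where "x \<in> X" "\<bar>len x - r\<bar> \<le> 2 * K" using truncate[OF g(1) r g(2)] by metis
  then show ?thesis by (auto simp: ann_def)
qed

lemma card_ann_ge_1: "0 \<le> r \<Longrightarrow> 1 \<le> card (ann r (2 * K))"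
  using ann_nonempty finite_ann by (simp add: Suc_leI card_gt_0_iff)

text \<open>The shift \<open>c\<close> makes \<open>x \<otimes> a \<otimes> y\<close> long enough to be truncated to length \<open>m + n\<close>; this keeps the
  width of the annuli fixed, so that the inequality can be iterated.\<close>

lemma ann_supermult:
  obtains c M where "c \<ge> 0" "M \<ge> 1"
    "\<And>m n. 0 \<le> m \<Longrightarrow> 0 \<le> n \<Longrightarrow>
       card (ann m (2 * K)) * card (ann (n + c) (2 * K)) \<le> M * card (ann (m + n) (2 * K))"
proof -
  obtain C where C: "C \<ge> 0" "\<And>x y. x \<in> X \<Longrightarrow> y \<in> X \<Longrightarrow> \<exists>a\<in>X. len a \<le> C \<and> len (x \<otimes> a \<otimes> y) \<ge> len x + len y - C"
    using almost_additive_products[OF nonelementary] by metis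
  obtain a where a: "\<And>x y. x \<in> X \<Longrightarrow> y \<in> X \<Longrightarrow> a x y \<in> X \<and> len (a x y) \<le> C \<and> len (x \<otimes> a x y \<otimes> y) \<ge> len x + len y - C"
    using C(2) by metis
  \<comment> \<open>Compensates the two annulus errors of \<open>2 * K\<close> and the defect
    \<open>C\<close>, so that the product has length at least \<open>m + n\<close>.\<close>
  define c where "c = 4 * K + C"
  \<comment> \<open>\<open>c1\<close> bounds the distance between a product and its truncation
    \<open>w\<close>. \<open>c2\<close> bounds the distance between the first factors of two pairs
    with the same truncation, since both lie near the point at depth \<open>m\<close> on the way to
    it.\<close>
  define c1 where "c1 = 12 * K + c + C"
  define c2 where "c2 = 8 * K + 2 * C + 2 * c1 + 2 * \<delta>"
  define M where "M = bcard c2 * (bcard C * bcard (2 * c1))"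
  have nn: "c \<ge> 0" "c1 \<ge> 0" "c2 \<ge> 0" using K_nonneg C delta_nonneg by (auto simp: c_def c1_def c2_def)
  have "1 * (1 * 1) \<le> M"
    unfolding M_def by (intro mult_le_mono bcard_ge_1) (use nn C(1) in auto)
  then have M1: "M \<ge> 1" by simp
  show ?thesis
  proof (rule that[OF nn(1) M1])
    fix m n :: real assume mn: "0 \<le> m" "0 \<le> n"
    define A where "A = ann m (2 * K) \<times> ann (n + c) (2 * K)"
    define g where "g = (\<lambda>(x, y). x \<otimes> a x y \<otimes> y)"
    have A: "fst p \<in> X" "snd p \<in> X" "\<bar>len (fst p) - m\<bar> \<le> 2 * K" "\<bar>len (snd p) - (n + c)\<bar> \<le> 2 * K"
      if "p \<in> A" for p using that by (auto simp: A_def ann_def)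
    have g: "g p \<in> X" "len (g p) \<ge> len (fst p) + len (snd p) - C" if "p \<in> A" for p
      using a[of "fst p" "snd p"] A[OF that] by (auto simp: g_def case_prod_beta)
    have "\<exists>w\<in>X. \<bar>len w - (m + n)\<bar> \<le> 2 * K \<and> gp w (g p) \<ge> m + n - 3 * K" if p: "p \<in> A" for p
    proof -
      have "m + n \<le> len (g p)" using g[OF p] A[OF p] by (simp add: c_def)
      then show ?thesis using truncate[of "g p" "m + n"] g[OF p] mn by (metis add_nonneg_nonneg)
    qed
    then obtain w where w: "\<And>p. p \<in> A \<Longrightarrow> w p \<in> X \<and> \<bar>len (w p) - (m + n)\<bar> \<le> 2 * K \<and> gp (w p) (g p) \<ge> m + n - 3 * K"
      by metis
    have g_le: "len (g p) \<le> len (fst p) + C + len (snd p)" and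
      d_g: "d (fst p) (g p) \<le> C + len (snd p)" if p: "p \<in> A" for p
    proof -
      define x y where "x = fst p" "y = snd p"
      have X: "x \<in> X" "y \<in> X" "a x y \<in> X" "len (a x y) \<le> C" using a A[OF p] by (auto simp: x_y_def)
      have gp: "g p = x \<otimes> (a x y \<otimes> y)" using X by (simp add: g_def x_y_def case_prod_beta m_assoc)
      have 1: "d x (g p) \<le> C + len y"
        using len_mult[of "a x y" y] X dist_mult[of x "a x y \<otimes> y"] by (simp add: gp)
      then show "d (fst p) (g p) \<le> C + len (snd p)" by (simp add: x_y_def)
      have "len (g p) \<le> len x + d x (g p)" using triangle X g(1)[OF p] by blast
      then show "len (g p) \<le> len (fst p) + C + len (snd p)" using 1 by (simp add: x_y_def)
    qed
    have dw: "d (g p) (w p) \<le> c1" if p: "p \<in> A" for p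
    proof -
      have "len (g p) \<le> (m + 2 * K) + C + (n + c + 2 * K)" using g_le[OF p] A(3,4)[OF p] by argo
      moreover have "len (w p) \<le> m + n + 2 * K" "gp (w p) (g p) \<ge> m + n - 3 * K"
        using w[OF p] by linarith+
      ultimately show ?thesis
        using dist_eq_gp[of "g p" "w p"] gp_sym[of "g p" "w p"] unfolding c1_def by argo
    qed
    have gpw: "gp (fst p) (w p) \<ge> m - 2 * K - C - c1" if p: "p \<in> A" for p
    proof -
      have "2 * gp (fst p) (g p) \<ge> 2 * len (fst p) - 2 * C"
        using gp2[of "fst p" "g p"] g(2)[OF p] d_g[OF p] by linarith
      then show ?thesis
        using gp_change[of "fst p" "w p" "g p"] dw[OF p] A[OF p] w[OF p] g(1)[OF p] by auto
    qed
    have "card A \<le> M * card (ann (m + n) (2 * K))"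
    proof (rule card_le_fibres)
      show "finite A" by (simp add: A_def finite_ann)
      show "finite (ann (m + n) (2 * K))" by (rule finite_ann)
      show "w ` A \<subseteq> ann (m + n) (2 * K)" using w by (auto simp: ann_def)
      fix p assume p: "p \<in> A"
      \<comment> \<open>The product and its first two factors determine the third. With the
        truncation fixed, each of these three elements is confined to a ball of fixed
        radius.\<close>
      define \<phi> where "\<phi> q = (fst q, a (fst q) (snd q), g q)" for q
      have "card {q \<in> A. w q = w p} \<le>
          card ({x \<in> X. d (fst p) x \<le> c2} \<times> {x \<in> X. len x \<le> C} \<times> {x \<in> X. d (g p) x \<le> 2 * c1})"
      proof (rule card_inj_on_le[of \<phi>])
        show "inj_on \<phi> {q \<in> A. w q = w p}"
        proof (rule inj_onI)
          fix q q' assume q: "q \<in> {q \<in> A. w q = w p}" "q' \<in> {q \<in> A. w q = w p}" and eq: "\<phi> q = \<phi> q'"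
          then have *: "fst q = fst q'" "a (fst q) (snd q) = a (fst q') (snd q')" "g q = g q'" by (auto simp: \<phi>_def)
          have "fst q \<otimes> a (fst q) (snd q) \<otimes> snd q = fst q \<otimes> a (fst q) (snd q) \<otimes> snd q'"
            using * by (simp add: g_def case_prod_beta)
          then have "snd q = snd q'"
            using A q a[of "fst q" "snd q"] by simp
          then show "q = q'" using * by (simp add: prod_eq_iff)
        qed
        show "\<phi> ` {q \<in> A. w q = w p} \<subseteq> {x \<in> X. d (fst p) x \<le> c2} \<times> {x \<in> X. len x \<le> C} \<times> {x \<in> X. d (g p) x \<le> 2 * c1}"
        proof (rule image_subsetI)
          fix q assume "q \<in> {q \<in> A. w q = w p}"
          then have q: "q \<in> A" "w q = w p" by auto
          have "d (g p) (g q) \<le> 2 * c1"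
            using triangle'[OF g(1)[OF p] conjunct1[OF w[OF p]] g(1)[OF q(1)]] dw[OF p] dw[OF q(1)] q(2)
            by simp
          moreover have "gp (fst p) (fst q) \<ge> m - 2 * K - C - c1 - \<delta>"
            using hyp[OF A(1)[OF p] A(1)[OF q(1)] conjunct1[OF w[OF p]]] gpw[OF p] gpw[OF q(1)] q(2)
              gp_sym[of "fst q" "w p"] by simp
          then have "d (fst p) (fst q) \<le> c2"
            using dist_eq_gp[of "fst p" "fst q"] A(3)[OF p] A(3)[OF q(1)] unfolding c2_def by linarith
          ultimately show "\<phi> q \<in> {x \<in> X. d (fst p) x \<le> c2} \<times> {x \<in> X. len x \<le> C} \<times> {x \<in> X. d (g p) x \<le> 2 * c1}"
            using A[OF q(1)] g(1)[OF q(1)] a by (simp add: \<phi>_def)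
        qed
      qed (use A[OF p] g[OF p] in \<open>simp add: finite_translated_ball finite_cball\<close>)
      also have "\<dots> = M"
        using A[OF p] g[OF p] by (simp add: M_def card_cartesian_product card_translated_ball)
      finally show "card {q \<in> A. w q = w p} \<le> M" .
    qed
    then show "card (ann m (2 * K)) * card (ann (n + c) (2 * K)) \<le> M * card (ann (m + n) (2 * K))"
      by (simp add: A_def card_cartesian_product)
  qed
qed

text \<open>Supermultiplicativity bounds the \<open>k\<close>-th power of \<open>s r\<close> by
  \<open>s (k * r)\<close> times the \<open>k\<close>-th power of a constant, and the exponential
  rate of \<open>s (k * r)\<close> is at most \<open>\<omega>\<close>. Taking \<open>k\<close>-th
  roots and letting \<open>k\<close> grow removes every subexponential factor and leaves the
  constant \<open>M\<^sup>2\<close>.\<close>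

lemma card_ann_upper_thin:
  obtains C where "C \<ge> 1" "\<And>r. 0 \<le> r \<Longrightarrow> real (card (ann r (2 * K))) \<le> C * \<omega> powr r"
proof -
  define s where "s r = real (card (ann r (2 * K)))" for r
  obtain c M0 where M0: "c \<ge> 0" "M0 \<ge> (1::nat)" "\<And>m n. 0 \<le> m \<Longrightarrow> 0 \<le> n \<Longrightarrow>
       card (ann m (2 * K)) * card (ann (n + c) (2 * K)) \<le> M0 * card (ann (m + n) (2 * K))"
    using ann_supermult by metis
  define M where "M = real M0"
  have M: "M \<ge> 1" using M0 by (simp add: M_def)
  have sm: "s m * s (n + c) \<le> M * s (m + n)" if "0 \<le> m" "0 \<le> n" for m n
    using M0(3)[OF that] unfolding s_def M_def by (simp only: of_nat_mult[symmetric] of_nat_le_iff)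
  have s1: "s r \<ge> 1" if "0 \<le> r" for r using card_ann_ge_1[OF that] by (simp add: s_def)
  \<comment> \<open>The annulus at radius \<open>c + c\<close> is nonempty, so supermultiplicativity
    with second argument \<open>c\<close> undoes the shift in \<open>sm\<close>.\<close>
  have shift: "s n \<le> M * s (n + c)" if "0 \<le> n" for n
  proof -
    have "s n * 1 \<le> s n * s (c + c)"
      using s1[of "c + c"] s1[of n] M0(1) that by (intro mult_left_mono) auto
    then show ?thesis using sm[OF that M0(1)] by simp
  qed
  have super: "s m * s n \<le> M\<^sup>2 * s (m + n)" if mn: "0 \<le> m" "0 \<le> n" for m n
  proof -
    have "s m * s n \<le> s m * (M * s (n + c))"
      using shift[OF mn(2)] s1[OF mn(1)] by (intro mult_left_mono) auto
    also have "\<dots> = M * (s m * s (n + c))" by simp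
    also have "\<dots> \<le> M * (M * s (m + n))"
      using sm[OF mn] M by (intro mult_left_mono) auto
    finally show ?thesis by (simp add: power2_eq_square algebra_simps)
  qed
  have pow: "s r ^ k \<le> (M\<^sup>2) ^ k * s (real k * r)" if r: "0 \<le> r" for r k
  proof (induction k)
    case 0
    then show ?case using s1[of 0] by simp
  next
    case (Suc k)
    have "s r ^ Suc k \<le> s r * ((M\<^sup>2) ^ k * s (real k * r))"
      using mult_left_mono[OF Suc, of "s r"] s1[OF r] by simp
    also have "\<dots> = (M\<^sup>2) ^ k * (s r * s (real k * r))" by simp
    also have "\<dots> \<le> (M\<^sup>2) ^ k * (M\<^sup>2 * s (r + real k * r))"
      using super[of r "real k * r"] r M by (intro mult_left_mono) auto
    finally show ?case by (simp add: algebra_simps)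
  qed
  have lim: "((\<lambda>R. ln (real (bcard R)) / R) \<longlongrightarrow> ln \<omega>) at_top" using growth by metis
  have bound: "s r \<le> M\<^sup>2 * \<omega> powr r" if r: "r > 0" for r
  proof -
    define B where "B = real (bcard (2 * (2 * K) + 20 * K))"
    have B: "B \<ge> 1" unfolding B_def using bcard_ge_1[of "2 * (2 * K) + 20 * K"] K_nonneg by simp
    have le: "ln (s r) \<le> ln (M\<^sup>2) + ln B / real k + ln (real (bcard (real k * r))) / real k" if k: "k \<ge> 1" for k
    proof -
      have "s (real k * r) \<le> real (bcard (real k * r + 2 * K))"
        unfolding s_def bcard_def of_nat_le_iff
        by (intro card_mono finite_cball) (auto simp: ann_def)
      also have "\<dots> \<le> B * real (bcard (real k * r))"
        using bcard_shift[of "real k * r" "2 * K"] r K_nonneg unfolding B_def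
        by (simp only: of_nat_mult[symmetric] of_nat_le_iff) simp
      finally have "s r ^ k \<le> (M\<^sup>2) ^ k * (B * real (bcard (real k * r)))"
        using pow[of r k] r by (meson mult_left_mono order_trans less_imp_le zero_le_power zero_le_power2)
      then have "ln (s r ^ k) \<le> ln ((M\<^sup>2) ^ k * (B * real (bcard (real k * r))))"
        using s1[of r] r by (intro ln_mono) auto
      also have "\<dots> = real k * ln (M\<^sup>2) + (ln B + ln (real (bcard (real k * r))))"
        using M B bcard_ge_1[of "real k * r"] r by (subst ln_mult_pos ln_realpow | simp)+
      finally have "real k * ln (s r) \<le> real k * ln (M\<^sup>2) + (ln B + ln (real (bcard (real k * r))))"
        using s1[of r] r by (simp add: ln_realpow)
      then show ?thesis using k by (simp add: field_simps)
    qed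
    have "(\<lambda>k. ln (M\<^sup>2) + ln B / real k + r * (ln (real (bcard (real k * r))) / (real k * r))) \<longlonglongrightarrow> ln (M\<^sup>2) + 0 + r * ln \<omega>"
    proof (intro tendsto_add tendsto_mult[OF tendsto_const] tendsto_const)
      show "(\<lambda>k. ln B / real k) \<longlonglongrightarrow> 0" by (rule lim_const_over_n)
      have "filterlim (\<lambda>k. real k * r) at_top sequentially"
        using r by (intro filterlim_at_top_mult_tendsto_pos[OF tendsto_const _ filterlim_real_sequentially])
      from filterlim_compose[OF lim this]
      show "(\<lambda>k. ln (real (bcard (real k * r))) / (real k * r)) \<longlonglongrightarrow> ln \<omega>" .
    qed
    then have "ln (s r) \<le> ln (M\<^sup>2) + 0 + r * ln \<omega>"
      by (rule tendsto_lowerbound)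
         (use le r in \<open>auto intro!: eventually_mono[OF eventually_ge_at_top[of 1]]\<close>)
    then have "exp (ln (s r)) \<le> exp (ln (M\<^sup>2) + r * ln \<omega>)" by simp
    then show ?thesis
      using s1[of r] r M omega_ge_1 by (simp add: exp_add powr_def)
  qed
  \<comment> \<open>For \<open>r = 0\<close> the multiples of \<open>r\<close> do not tend to
    infinity and the root argument gives nothing, so this value is included by hand.\<close>
  define C where "C = max (M\<^sup>2) (s 0)"
  show ?thesis
  proof (rule that[of C])
    show "C \<ge> 1" using s1[of 0] by (simp add: C_def)
    fix r :: real assume r: "0 \<le> r"
    show "real (card (ann r (2 * K))) \<le> C * \<omega> powr r"
    proof (cases "r = 0")
      case True
      then show ?thesis using omega_ge_1 by (simp add: C_def s_def)
    next
      case False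
      then have "s r \<le> M\<^sup>2 * \<omega> powr r" using bound r by simp
      also have "\<dots> \<le> C * \<omega> powr r" by (intro mult_right_mono) (auto simp: C_def)
      finally show ?thesis by (simp add: s_def)
    qed
  qed
qed

lemma card_ann_upper:
  assumes w: "0 \<le> w"
  obtains C where "C > 0" "\<And>r. real (card (ann r w)) \<le> C * \<omega> powr r"
proof -
  obtain C0 where C0: "C0 \<ge> 1" "\<And>r. 0 \<le> r \<Longrightarrow> real (card (ann r (2 * K))) \<le> C0 * \<omega> powr r"
    using card_ann_upper_thin by metis
  define B where "B = real (bcard (4 * w + 16 * K))"
  define B' where "B' = real (bcard (2 * w)) * \<omega> powr w"
  have B: "B \<ge> 1" using bcard_ge_1[of "4 * w + 16 * K"] w K_nonneg by (simp add: B_def)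
  have B': "B' \<ge> 0" by (simp add: B'_def)
  show ?thesis
  proof (rule that[of "B * C0 + B'"])
    have "B * C0 > 0" using B C0(1) by simp
    then show "B * C0 + B' > 0" using B' by linarith
    fix r :: real
    consider "r < - w" | "- w \<le> r" "r < w" | "w \<le> r" by linarith
    then show "real (card (ann r w)) \<le> (B * C0 + B') * \<omega> powr r"
    proof cases
      case 1
      then have "ann r w = {}" using w nonneg[of \<one>] by (auto simp: ann_def) (smt (verit) nonneg)
      then show ?thesis using \<open>B * C0 > 0\<close> B' by simp
    next
      case 2
      have "real (card (ann r w)) \<le> real (bcard (2 * w))"
        unfolding bcard_def of_nat_le_iff using 2 by (intro card_mono finite_cball) (auto simp: ann_def)
      also have "\<dots> \<le> real (bcard (2 * w)) * \<omega> powr (w + r)"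
        using omega_powr_mono[of 0 "w + r"] 2 omega_ge_1 by (simp add: mult_le_cancel_left1)
      also have "\<dots> = B' * \<omega> powr r" by (simp add: B'_def powr_add)
      also have "\<dots> \<le> (B * C0 + B') * \<omega> powr r"
        using \<open>B * C0 > 0\<close> by (intro mult_right_mono) auto
      finally show ?thesis .
    next
      case 3
      have "\<exists>x\<in>X. \<bar>len x - (r - w)\<bar> \<le> 2 * K \<and> gp x g \<ge> r - w - 3 * K" if g: "g \<in> ann r w" for g
      proof -
        have "g \<in> X" "0 \<le> r - w" "r - w \<le> len g" using g 3 by (auto simp: ann_def)
        then show ?thesis using truncate[of g "r - w"] by metis
      qed
      then obtain f where f: "\<And>g. g \<in> ann r w \<Longrightarrow> f g \<in> X \<and> \<bar>len (f g) - (r - w)\<bar> \<le> 2 * K \<and> gp (f g) g \<ge> r - w - 3 * K"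
        by metis
      have df: "d (f g) g \<le> 2 * w + 8 * K" if g: "g \<in> ann r w" for g
      proof -
        have "len g \<le> r + w" "len (f g) \<le> r - w + 2 * K" "gp (f g) g \<ge> r - w - 3 * K"
          using g f[OF g] by (auto simp: ann_def)
        then show ?thesis using gp2[of "f g" g] by argo
      qed
      have "card (ann r w) \<le> bcard (4 * w + 16 * K) * card (ann (r - w) (2 * K))"
      proof (rule card_le_close_fibres[OF finite_ann _ finite_ann])
        show "ann r w \<subseteq> X" by (auto simp: ann_def)
        show "f ` ann r w \<subseteq> ann (r - w) (2 * K)" using f by (auto simp: ann_def)
        fix a a' assume *: "a \<in> ann r w" "a' \<in> ann r w" "f a = f a'"
        have "a \<in> X" "a' \<in> X" "f a \<in> X" using * f by (auto simp: ann_def)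
        then show "d a a' \<le> 4 * w + 16 * K"
          using triangle''[of a "f a" a'] df[OF *(1)] df[OF *(2)] *(3) by simp
      qed
      then have "real (card (ann r w)) \<le> B * real (card (ann (r - w) (2 * K)))"
        unfolding B_def by (simp only: of_nat_mult[symmetric] of_nat_le_iff)
      also have "\<dots> \<le> B * (C0 * \<omega> powr r)"
      proof -
        have "real (card (ann (r - w) (2 * K))) \<le> C0 * \<omega> powr (r - w)" using C0 3 by simp
        also have "\<dots> \<le> C0 * \<omega> powr r" using omega_powr_mono[of "r - w" r] w C0(1) by simp
        finally show ?thesis using B by simp
      qed
      also have "\<dots> \<le> (B * C0 + B') * \<omega> powr r"
        using B' by (simp add: algebra_simps)
      finally show ?thesis .
    qed
  qed
qed

text \<open>The annuli up to radius \<open>r\<close> are bounded by a geometric series, which for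
  \<open>\<omega> > 1\<close> is comparable to its last term.\<close>

lemma bcard_upper:
  assumes "\<omega> > 1"
  obtains C where "C > 0" "\<And>r. 0 \<le> r \<Longrightarrow> real (bcard r) \<le> C * \<omega> powr r"
proof -
  obtain C where C: "C > 0" "\<And>r. real (card (ann r 1)) \<le> C * \<omega> powr r"
    using card_ann_upper[of 1] by auto
  show ?thesis
  proof (rule that[of "C * (\<omega> / (\<omega> - 1))"])
    show "C * (\<omega> / (\<omega> - 1)) > 0" using C assms by simp
    fix r :: real assume r: "0 \<le> r"
    define n where "n = nat \<lfloor>r\<rfloor>"
    have n: "real n \<le> r" "r < real n + 1" using r by (auto simp: n_def)
    have "{g \<in> X. len g \<le> r} \<subseteq> (\<Union>i\<le>n. ann (real i) 1)"
    proof
      fix g assume g: "g \<in> {g \<in> X. len g \<le> r}"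
      define i where "i = nat \<lfloor>len g\<rfloor>"
      have "real i \<le> len g" "len g < real i + 1" by (auto simp: i_def)
      moreover from this g n have "i \<le> n" by simp
      ultimately show "g \<in> (\<Union>i\<le>n. ann (real i) 1)"
        using g by (intro UN_I[of i]) (auto simp: ann_def)
    qed
    then have "bcard r \<le> card (\<Union>i\<le>n. ann (real i) 1)"
      unfolding bcard_def by (intro card_mono) (auto simp: finite_ann)
    also have "\<dots> \<le> (\<Sum>i\<le>n. card (ann (real i) 1))" by (rule card_UN_le) simp
    finally have "real (bcard r) \<le> (\<Sum>i\<le>n. real (card (ann (real i) 1)))"
      by (simp only: of_nat_sum[symmetric] of_nat_le_iff)
    also have "\<dots> \<le> (\<Sum>i\<le>n. C * \<omega> ^ i)"
      using C(2)[of "real _"] assms by (intro sum_mono) (simp add: powr_realpow)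
    also have "\<dots> = C * ((\<omega> ^ Suc n - 1) / (\<omega> - 1))"
      using assms geometric_sum[of \<omega> "Suc n"]
      by (simp only: sum_distrib_left[symmetric] lessThan_Suc_atMost)
    also have "\<dots> \<le> C * (\<omega> ^ Suc n / (\<omega> - 1))"
      using C assms by (intro mult_left_mono divide_right_mono) auto
    also have "\<dots> = C * (\<omega> / (\<omega> - 1)) * \<omega> ^ n" by simp
    also have "\<dots> \<le> C * (\<omega> / (\<omega> - 1)) * \<omega> powr r"
      using omega_powr_mono[OF n(1)] assms C by (intro mult_left_mono) (auto simp: powr_realpow)
    finally show "real (bcard r) \<le> C * (\<omega> / (\<omega> - 1)) * \<omega> powr r" .
  qed
qed

text \<open>With bounds of the same exponential order on both sides, a ball of radius
  \<open>r - j\<close> contains at most half of what a ball of radius \<open>r\<close> must contain,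
  if \<open>j\<close> is large. The case \<open>\<omega> = 1\<close> is settled by nonempty annuli
  instead of being excluded.\<close>

lemma card_ann_lower:
  obtains w c where "w \<ge> 0" "c > 0" "\<And>r. 0 \<le> r \<Longrightarrow> c * \<omega> powr r \<le> real (card (ann r w))"
proof (cases "\<omega> = 1")
  case True
  show ?thesis
    by (rule that[of "2 * K" 1]) (use True K_nonneg card_ann_ge_1 in \<open>auto simp: Suc_le_eq\<close>)
next
  case False
  then have \<omega>: "\<omega> > 1" using omega_ge_1 by simp
  obtain M where M: "M \<ge> 1" "\<And>R. 0 \<le> R \<Longrightarrow> \<omega> powr R \<le> M * real (bcard R)" using growth by metis
  obtain C where C: "C > 0" "\<And>r. 0 \<le> r \<Longrightarrow> real (bcard r) \<le> C * \<omega> powr r"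
    using bcard_upper[OF \<omega>] by metis
  obtain j where j: "2 * M * C < \<omega> ^ j" using real_arch_pow[OF \<omega>] by blast
  \<comment> \<open>The second term is for \<open>r < j\<close>, where the annulus contains
    \<open>\<one>\<close> and \<open>\<omega> powr r\<close> is at most
    \<open>\<omega> powr j\<close>.\<close>
  define c where "c = min (1 / (2 * M)) (\<omega> powr - real j)"
  show ?thesis
  proof (rule that[of "real j" c])
    show "c > 0" using M \<omega> by (simp add: c_def)
    fix r :: real assume r: "0 \<le> r"
    show "c * \<omega> powr r \<le> real (card (ann r (real j)))"
    proof (cases "r < real j")
      case True
      have "c * \<omega> powr r \<le> \<omega> powr - real j * \<omega> powr r" by (intro mult_right_mono) (auto simp: c_def)
      also have "\<dots> = \<omega> powr (r - real j)" by (simp add: powr_add[symmetric])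
      also have "\<dots> \<le> \<omega> powr 0" using True by (intro omega_powr_mono) auto
      also have "\<dots> = 1" using \<omega> by simp
      also have "1 \<le> real (card (ann r (real j)))"
      proof -
        have "\<one> \<in> ann r (real j)" using True r by (simp add: ann_def)
        then have "card (ann r (real j)) > 0" using finite_ann card_gt_0_iff by blast
        then show ?thesis by simp
      qed
      finally show ?thesis .
    next
      case False
      have "{g \<in> X. len g \<le> r} \<subseteq> {g \<in> X. len g \<le> r - real j} \<union> ann r (real j)"
        by (auto simp: ann_def)
      then have "bcard r \<le> card ({g \<in> X. len g \<le> r - real j} \<union> ann r (real j))"
        unfolding bcard_def by (intro card_mono) (auto simp: finite_cball finite_ann)
      also have "\<dots> \<le> bcard (r - real j) + card (ann r (real j))"
        unfolding bcard_def by (rule card_Un_le)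
      finally have 1: "real (bcard r) \<le> real (bcard (r - real j)) + real (card (ann r (real j)))" by simp
      have "C * \<omega> powr (r - real j) = C / \<omega> ^ j * \<omega> powr r"
        using \<omega> by (simp add: powr_diff powr_realpow)
      also have "\<dots> \<le> 1 / (2 * M) * \<omega> powr r"
        using j M(1) \<omega> by (intro mult_right_mono) (auto simp: field_simps)
      finally have 2: "real (bcard (r - real j)) \<le> 1 / (2 * M) * \<omega> powr r"
        using C(2)[of "r - real j"] False by linarith
      have "1 / M * \<omega> powr r \<le> real (bcard r)" using M(1) M(2)[OF r] by (simp add: field_simps)
      then have "1 / (2 * M) * \<omega> powr r \<le> real (card (ann r (real j)))"
        using 1 2 by (simp add: field_simps)
      moreover have "c * \<omega> powr r \<le> 1 / (2 * M) * \<omega> powr r" by (intro mult_right_mono) (auto simp: c_def)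
      ultimately show ?thesis by linarith
    qed
  qed simp
qed

end

subsection \<open>Hausdorff measure is a Borel measure\<close>

context Metric_space
begin

definition hausdorff_covers :: "real \<Rightarrow> 'a set \<Rightarrow> (nat \<Rightarrow> 'a set) set" where
  "hausdorff_covers \<delta> E = {U. (\<forall>i. U i \<subseteq> M \<and> ediam d (U i) \<le> ennreal \<delta>) \<and> E \<subseteq> (\<Union>i. U i)}"

definition hausdorff_pre :: "real \<Rightarrow> real \<Rightarrow> 'a set \<Rightarrow> ennreal" where
  "hausdorff_pre s \<delta> E = (INF U\<in>hausdorff_covers \<delta> E. \<Sum>i. diam_pow d s (U i))"

lemma hausdorff_outer_eq: "hausdorff_outer M d s E = (SUP \<delta>\<in>{0<..}. hausdorff_pre s \<delta> E)"
  by (simp add: hausdorff_outer_def hausdorff_pre_def hausdorff_covers_def)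

lemma ediam_empty [simp]: "ediam d {} = 0"
  by (simp add: ediam_def bot_ennreal)

lemma diam_pow_empty [simp]: "diam_pow d s {} = 0"
  by (simp add: diam_pow_def)

lemma dist_le_ediam: "x \<in> U \<Longrightarrow> y \<in> U \<Longrightarrow> ennreal (d x y) \<le> ediam d U"
  unfolding ediam_def by (meson SUP_upper2 order_refl)

lemma ediam_leI: "(\<And>x y. x \<in> U \<Longrightarrow> y \<in> U \<Longrightarrow> d x y \<le> r) \<Longrightarrow> ediam d U \<le> ennreal r"
  unfolding ediam_def by (intro SUP_least ennreal_leI)

lemma hausdorff_pre_mono: "A \<subseteq> B \<Longrightarrow> hausdorff_pre s \<delta> A \<le> hausdorff_pre s \<delta> B"
  unfolding hausdorff_pre_def by (intro INF_superset_mono) (auto simp: hausdorff_covers_def)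

lemma hausdorff_pre_antimono:
  assumes "\<delta> \<le> \<delta>'"
  shows "hausdorff_pre s \<delta>' A \<le> hausdorff_pre s \<delta> A"
proof -
  have "hausdorff_covers \<delta> A \<subseteq> hausdorff_covers \<delta>' A"
    using ennreal_leI[OF assms] unfolding hausdorff_covers_def by (auto intro: order_trans)
  then show ?thesis
    unfolding hausdorff_pre_def by (intro INF_superset_mono) auto
qed

lemma hausdorff_pre_le_outer: "0 < \<delta> \<Longrightarrow> hausdorff_pre s \<delta> A \<le> hausdorff_outer M d s A"
  unfolding hausdorff_outer_eq by (intro SUP_upper) auto

lemma hausdorff_outer_mono: "A \<subseteq> B \<Longrightarrow> hausdorff_outer M d s A \<le> hausdorff_outer M d s B"
  unfolding hausdorff_outer_eq by (intro SUP_mono) (auto intro: hausdorff_pre_mono)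

lemma hausdorff_pre_le: "U \<in> hausdorff_covers \<delta> E \<Longrightarrow> hausdorff_pre s \<delta> E \<le> (\<Sum>i. diam_pow d s (U i))"
  unfolding hausdorff_pre_def by (intro INF_lower)

lemma hausdorff_outer_empty [simp]: "hausdorff_outer M d s {} = 0"
proof -
  have "hausdorff_pre s \<delta> {} \<le> 0" for \<delta>
    using hausdorff_pre_le[of "\<lambda>_. {}" \<delta> "{}" s] by (simp add: hausdorff_covers_def)
  then show ?thesis
    unfolding hausdorff_outer_eq by (intro antisym SUP_least) auto
qed

lemma hausdorff_pre_countably_subadditive:
  "hausdorff_pre s \<delta> (\<Union>n::nat. A n) \<le> (\<Sum>n. hausdorff_pre s \<delta> (A n))"
proof (rule ennreal_le_epsilon)
  fix e :: real assume e: "0 < e" and fin: "(\<Sum>n. hausdorff_pre s \<delta> (A n)) < top_class.top"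
  have "\<exists>U\<in>hausdorff_covers \<delta> (A n). (\<Sum>i. diam_pow d s (U i)) \<le> hausdorff_pre s \<delta> (A n) + e * (1/2) ^ Suc n" for n
  proof -
    have "hausdorff_pre s \<delta> (A n) < top_class.top" using ennreal_suminf_lessD[OF fin] .
    then have "hausdorff_pre s \<delta> (A n) < hausdorff_pre s \<delta> (A n) + e * (1/2) ^ Suc n"
      using e by (auto simp: less_top)
    then have "(INF U\<in>hausdorff_covers \<delta> (A n). \<Sum>i. diam_pow d s (U i)) < hausdorff_pre s \<delta> (A n) + e * (1/2) ^ Suc n"
      by (simp add: hausdorff_pre_def)
    then show ?thesis unfolding INF_less_iff by (auto intro: less_imp_le)
  qed
  then obtain U where U: "\<And>n. U n \<in> hausdorff_covers \<delta> (A n)"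
    "\<And>n. (\<Sum>i. diam_pow d s (U n i)) \<le> hausdorff_pre s \<delta> (A n) + e * (1/2) ^ Suc n"
    by metis
  define V where "V = case_prod U \<circ> prod_decode"
  have "V \<in> hausdorff_covers \<delta> (\<Union>n. A n)"
    unfolding hausdorff_covers_def
  proof (intro CollectI conjI allI)
    show "V i \<subseteq> M" "ediam d (V i) \<le> ennreal \<delta>" for i
      using U(1) by (auto simp: V_def hausdorff_covers_def split: prod.splits)
    show "(\<Union>n. A n) \<subseteq> (\<Union>i. V i)"
    proof
      fix x assume "x \<in> (\<Union>n. A n)"
      then obtain n i where "x \<in> U n i" using U(1) by (force simp: hausdorff_covers_def)
      then have "x \<in> V (prod_encode (n, i))" by (simp add: V_def)
      then show "x \<in> (\<Union>i. V i)" by blast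
    qed
  qed
  then have "hausdorff_pre s \<delta> (\<Union>n. A n) \<le> (\<Sum>i. diam_pow d s (V i))"
    by (rule hausdorff_pre_le)
  also have "\<dots> = (\<Sum>i. (\<lambda>p. diam_pow d s (case_prod U p)) (prod_decode i))"
    by (simp add: V_def)
  also have "\<dots> = (\<Sum>n. \<Sum>i. diam_pow d s (U n i))"
    by (rule suminf_ennreal_2dimen) simp
  also have "\<dots> \<le> (\<Sum>n. hausdorff_pre s \<delta> (A n) + e * (1/2) ^ Suc n)"
    by (intro suminf_le U(2)) auto
  also have "\<dots> = (\<Sum>n. hausdorff_pre s \<delta> (A n)) + (\<Sum>n. ennreal e * ennreal ((1/2) ^ Suc n))"
    using e by (subst suminf_add[symmetric])
      (auto simp del: ennreal_suminf_cmult simp add: ennreal_mult[symmetric])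
  also have "\<dots> = (\<Sum>n. hausdorff_pre s \<delta> (A n)) + e"
    unfolding ennreal_suminf_cmult
    by (subst suminf_ennreal_eq[OF zero_le_power power_half_series]) auto
  finally show "hausdorff_pre s \<delta> (\<Union>n. A n) \<le> (\<Sum>n. hausdorff_pre s \<delta> (A n)) + ennreal e" .
qed

lemma hausdorff_outer_countably_subadditive:
  "hausdorff_outer M d s (\<Union>n::nat. A n) \<le> (\<Sum>n. hausdorff_outer M d s (A n))"
proof -
  have "hausdorff_pre s \<delta> (\<Union>n. A n) \<le> (\<Sum>n. hausdorff_outer M d s (A n))" if "0 < \<delta>" for \<delta>
    using hausdorff_pre_countably_subadditive[of s \<delta> A]
    by (rule order_trans) (intro suminf_le hausdorff_pre_le_outer that; simp)
  then show ?thesis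
    unfolding hausdorff_outer_eq[of s "\<Union>n. A n"] by (intro SUP_least) auto
qed

lemma hausdorff_outer_subadditive:
  "hausdorff_outer M d s (A \<union> B) \<le> hausdorff_outer M d s A + hausdorff_outer M d s B"
proof -
  define C where "C n = (if n = 0 then A else if n = Suc 0 then B else {})" for n :: nat
  have "A \<union> B = (\<Union>n. C n)" by (auto simp: C_def split: if_splits) 
  moreover have "(\<Sum>n. hausdorff_outer M d s (C n)) = (\<Sum>n\<in>{0, Suc 0}. hausdorff_outer M d s (C n))"
    by (rule suminf_finite) (auto simp: C_def)
  ultimately show ?thesis
    using hausdorff_outer_countably_subadditive[of s C] by (simp add: C_def)
qed

text \<open>At scales below \<open>r\<close> no member of a cover meets both sets, so every cover
  splits into a cover of \<open>A\<close> and one of \<open>B\<close>; the claim survives the limit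
  because the scales are directed.\<close>

lemma hausdorff_outer_separated:
  assumes r: "0 < r" and sep: "\<And>x y. x \<in> A \<Longrightarrow> y \<in> B \<Longrightarrow> r \<le> d x y"
  shows "hausdorff_outer M d s A + hausdorff_outer M d s B \<le> hausdorff_outer M d s (A \<union> B)"
proof -
  let ?pre = "hausdorff_pre s"
  have small: "?pre \<delta> A + ?pre \<delta> B \<le> ?pre \<delta> (A \<union> B)" if \<delta>: "0 < \<delta>" "\<delta> < r" for \<delta>
    unfolding hausdorff_pre_def[of s \<delta> "A \<union> B"]
  proof (rule INF_greatest)
    fix U assume U: "U \<in> hausdorff_covers \<delta> (A \<union> B)"
    \<comment> \<open>Discarded members become \<open>{}\<close>, which costs 0 by convention even
      for \<open>s = 0\<close>.\<close>
    define V where "V i = (if U i \<inter> A = {} then {} else U i)" for i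
    define W where "W i = (if U i \<inter> B = {} then {} else U i)" for i
    have V: "V \<in> hausdorff_covers \<delta> A" and W: "W \<in> hausdorff_covers \<delta> B"
      using U by (auto simp: V_def W_def hausdorff_covers_def) blast+
    have le: "diam_pow d s (V i) + diam_pow d s (W i) \<le> diam_pow d s (U i)" for i
    proof -
      have "U i \<inter> A = {} \<or> U i \<inter> B = {}"
      proof (rule ccontr)
        assume "\<not> ?thesis"
        then obtain x y where xy: "x \<in> U i" "x \<in> A" "y \<in> U i" "y \<in> B" by blast
        have "ennreal (d x y) \<le> ennreal \<delta>"
          using dist_le_ediam[OF xy(1,3)] U by (auto simp: hausdorff_covers_def intro: order_trans)
        then show False using sep[OF xy(2,4)] \<delta> by (simp add: ennreal_le_iff)
      qed
      then show ?thesis by (auto simp: V_def W_def)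
    qed
    have "?pre \<delta> A + ?pre \<delta> B \<le> (\<Sum>i. diam_pow d s (V i)) + (\<Sum>i. diam_pow d s (W i))"
      by (intro add_mono hausdorff_pre_le V W)
    also have "\<dots> = (\<Sum>i. diam_pow d s (V i) + diam_pow d s (W i))"
      by (rule suminf_add) auto
    also have "\<dots> \<le> (\<Sum>i. diam_pow d s (U i))"
      by (intro suminf_le le) auto
    finally show "?pre \<delta> A + ?pre \<delta> B \<le> (\<Sum>i. diam_pow d s (U i))" .
  qed
  have "hausdorff_outer M d s A + hausdorff_outer M d s B = (SUP \<delta>\<in>{0<..}. ?pre \<delta> A + ?pre \<delta> B)"
    unfolding hausdorff_outer_eq
  proof (rule SUP_add_directed_ennreal[symmetric])
    fix i j :: real assume "i \<in> {0<..}" "j \<in> {0<..}"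
    then show "\<exists>k\<in>{0<..}. ?pre i A + ?pre j B \<le> ?pre k A + ?pre k B"
      by (intro bexI[of _ "min i j"] add_mono hausdorff_pre_antimono) auto
  qed
  also have "\<dots> \<le> hausdorff_outer M d s (A \<union> B)"
  proof (rule SUP_least)
    fix \<delta> :: real assume \<delta>: "\<delta> \<in> {0<..}"
    define \<delta>' where "\<delta>' = min \<delta> (r / 2)"
    have \<delta>': "0 < \<delta>'" "\<delta>' < r" "\<delta>' \<le> \<delta>" using \<delta> r by (auto simp: \<delta>'_def)
    have "?pre \<delta> A + ?pre \<delta> B \<le> ?pre \<delta>' A + ?pre \<delta>' B"
      by (intro add_mono hausdorff_pre_antimono \<delta>')
    also have "\<dots> \<le> ?pre \<delta>' (A \<union> B)" using small \<delta>' by simp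
    also have "\<dots> \<le> hausdorff_outer M d s (A \<union> B)" by (rule hausdorff_pre_le_outer[OF \<delta>'(1)])
    finally show "?pre \<delta> A + ?pre \<delta> B \<le> hausdorff_outer M d s (A \<union> B)" .
  qed
  finally show ?thesis .
qed

text \<open>Caratheodory's criterion: \<open>Q - C\<close> is exhausted by the sets \<open>A n\<close> of points at distance at least
  \<open>1 / (n + 1)\<close> from \<open>C\<close>, and every other difference \<open>D n\<close> is separated from the previous ones, so
  that their outer measures are summable.\<close>

lemma closed_Caratheodory_hausdorff:
  assumes C: "closedin mtopology C" and Q: "Q \<subseteq> M"
  shows "hausdorff_outer M d s (Q \<inter> C) + hausdorff_outer M d s (Q - C) \<le> hausdorff_outer M d s Q"
proof (cases "hausdorff_outer M d s Q = top_class.top")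
  case False
  let ?H = "hausdorff_outer M d s"
  have CM: "C \<subseteq> M" using closedin_subset[OF C] by simp
  define A where "A n = {x \<in> Q. \<forall>c\<in>C. 1 / real (Suc n) \<le> d x c}" for n :: nat
  define D where "D n = A (Suc n) - A n" for n
  have A_mono: "A m \<subseteq> A n" if "m \<le> n" for m n
  proof
    fix x assume x: "x \<in> A m"
    have "1 / real (Suc n) \<le> 1 / real (Suc m)" using that by (simp add: frac_le)
    then show "x \<in> A n" using x unfolding A_def by (auto intro: order_trans)
  qed
  have A_union: "Q - C = (\<Union>n. A n)"
  proof (intro equalityI subsetI)
    fix x assume x: "x \<in> Q - C"
    then have "x \<in> M - C" using Q by auto
    moreover have "openin mtopology (M - C)" using C by (simp add: closedin_def)
    ultimately obtain r where r: "r > 0" "mball x r \<subseteq> M - C"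
      by (meson openin_mtopology)
    obtain n where n: "1 / real (Suc n) < r" using nat_approx_posE[OF r(1)] by metis
    have "1 / real (Suc n) \<le> d x c" if "c \<in> C" for c
    proof (rule ccontr)
      assume "\<not> ?thesis"
      then have "c \<in> mball x r" using n that CM x Q by (auto simp: subset_iff)
      then show False using r that by auto
    qed
    then show "x \<in> (\<Union>n. A n)" using x by (auto simp: A_def)
  next
    fix x assume "x \<in> (\<Union>n. A n)"
    then obtain n where "x \<in> Q" "\<And>c. c \<in> C \<Longrightarrow> 1 / real (Suc n) \<le> d x c" by (auto simp: A_def)
    moreover have "x \<notin> C"
    proof
      assume "x \<in> C"
      then have "1 / real (Suc n) \<le> d x x" using calculation by blast
      then show False using \<open>x \<in> C\<close> CM by (auto simp: subset_iff)
    qed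
    ultimately show "x \<in> Q - C" by simp
  qed
  have sep: "1 / real (Suc m) - 1 / real (Suc n) \<le> d x y" if "x \<in> A m" "y \<in> Q - A n" for x y m n
  proof -
    have "\<not> (\<forall>c\<in>C. 1 / real (Suc n) \<le> d y c)" using that(2) unfolding A_def by blast
    then obtain c where c: "c \<in> C" "d y c < 1 / real (Suc n)" by (meson not_le)
    have "1 / real (Suc m) \<le> d x c" using that c by (auto simp: A_def)
    also have "\<dots> \<le> d x y + d y c"
      using triangle[of x y c] that c CM Q by (auto simp: A_def subset_iff)
    finally show ?thesis using c by simp
  qed
  \<comment> \<open>Used with \<open>i\<close> equal to 0 and 1. A whole layer is left out between
    \<open>D (2 * N + i)\<close> and the earlier sets, which gives a positive distance. It may
    shrink with \<open>N\<close>, since one set is added at a time.\<close>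
  have partial: "(\<Sum>k<N. ?H (D (2 * k + i))) \<le> ?H (\<Union>k<N. D (2 * k + i))" for N i
  proof (induction N)
    case (Suc N)
    define B where "B = (\<Union>k<N. D (2 * k + i))"
    have H: "?H B + ?H (D (2 * N + i)) \<le> ?H (B \<union> D (2 * N + i))"
    proof (cases "N = 0")
      case False
      then obtain m where m: "2 * N + i = Suc m" by (cases "2 * N + i") auto
      show ?thesis
      proof (rule hausdorff_outer_separated[of "1 / real (Suc m) - 1 / real (Suc (Suc m))"])
        show "0 < 1 / real (Suc m) - 1 / real (Suc (Suc m))"
          using divide_strict_left_mono[of "real (Suc m)" "real (Suc (Suc m))" 1] by simp
        fix x y assume x: "x \<in> B" and y: "y \<in> D (2 * N + i)"
        obtain k where k: "k < N" "x \<in> D (2 * k + i)" using x by (auto simp: B_def)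
        then have "x \<in> A (Suc (2 * k + i))" by (simp add: D_def)
        moreover have "Suc (2 * k + i) \<le> m" using k m by linarith
        ultimately have "x \<in> A m" using A_mono by blast
        moreover have "y \<in> Q - A (Suc m)" using y by (auto simp: D_def m A_def)
        ultimately show "1 / real (Suc m) - 1 / real (Suc (Suc m)) \<le> d x y" by (rule sep)
      qed
    qed (simp add: B_def)
    have "(\<Sum>k<Suc N. ?H (D (2 * k + i))) \<le> ?H B + ?H (D (2 * N + i))"
      using Suc by (simp add: B_def add_mono)
    also note H
    also have "B \<union> D (2 * N + i) = (\<Union>k<Suc N. D (2 * k + i))"
      by (auto simp: B_def lessThan_Suc)
    finally show ?case .
  qed simp
  have fin: "(\<Sum>k. ?H (D (2 * k + i))) \<noteq> top_class.top" for i
  proof -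
    have "(\<Sum>k. ?H (D (2 * k + i))) \<le> ?H Q"
      unfolding suminf_eq_SUP
    proof (rule SUP_least)
      fix N
      have "(\<Union>k<N. D (2 * k + i)) \<subseteq> Q" by (auto simp: D_def A_def)
      then show "(\<Sum>k<N. ?H (D (2 * k + i))) \<le> ?H Q"
        by (rule order_trans[OF partial hausdorff_outer_mono])
    qed
    then show ?thesis using False by (auto simp: top_unique)
  qed
  show ?thesis
  proof (rule ennreal_le_epsilon)
    fix e :: real assume e: "0 < e"
    have tail: "\<exists>N. \<forall>n\<ge>N. (\<Sum>k. ?H (D (2 * (k + n) + i))) \<le> ennreal (e / 2)" for i
    proof -
      define h where "h k = enn2real (?H (D (2 * k + i)))" for k
      have "?H (D (2 * k + i)) \<noteq> top_class.top" for k
        using fin[of i] ennreal_suminf_lessD[of "\<lambda>k. ?H (D (2 * k + i))" top_class.top k] by (auto simp: less_top)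
      then have h: "?H (D (2 * k + i)) = ennreal (h k)" for k
        by (simp add: h_def less_top)
      have summ: "summable h"
      proof (rule summable_suminf_not_top)
        show "(\<Sum>k. ennreal (h k)) \<noteq> top_class.top" using fin[of i] unfolding h .
      qed (simp add: h_def)
      then obtain N where N: "\<And>n. n \<ge> N \<Longrightarrow> norm (\<Sum>k. h (k + n)) < e / 2"
        using suminf_exist_split[of "e / 2" h] e by auto
      have "(\<Sum>k. ?H (D (2 * (k + n) + i))) \<le> ennreal (e / 2)" if "n \<ge> N" for n
      proof -
        have "(\<Sum>k. ?H (D (2 * (k + n) + i))) = (\<Sum>k. ennreal (h (k + n)))" by (simp only: h)
        also have "\<dots> = ennreal (\<Sum>k. h (k + n))"
        proof (rule suminf_ennreal2)
          show "summable (\<lambda>k. h (k + n))" using summ by (simp only: summable_iff_shift)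
        qed (simp add: h_def)
        also have "\<dots> \<le> ennreal (e / 2)" using N[OF that] by (intro ennreal_leI) auto
        finally show ?thesis .
      qed
      then show ?thesis by blast
    qed
    obtain N0 N1 where N: "\<And>n. n \<ge> N0 \<Longrightarrow> (\<Sum>k. ?H (D (2 * (k + n) + 0))) \<le> ennreal (e / 2)"
      "\<And>n. n \<ge> N1 \<Longrightarrow> (\<Sum>k. ?H (D (2 * (k + n) + 1))) \<le> ennreal (e / 2)"
      using tail[of 0] tail[of 1] by metis
    define n where "n = max N0 N1"
    have cover: "Q - C \<subseteq> A (2 * n) \<union> ((\<Union>k. D (2 * (k + n) + 0)) \<union> (\<Union>k. D (2 * (k + n) + 1)))"
    proof
      fix x assume x: "x \<in> Q - C"
      then have ex: "\<exists>m. x \<in> A m" using A_union by auto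
      define m where "m = (LEAST m. x \<in> A m)"
      have m: "x \<in> A m" unfolding m_def using ex by (rule LeastI_ex)
      show "x \<in> A (2 * n) \<union> ((\<Union>k. D (2 * (k + n) + 0)) \<union> (\<Union>k. D (2 * (k + n) + 1)))"
      proof (cases "m \<le> 2 * n")
        case True
        then show ?thesis using m A_mono by blast
      next
        case False
        then obtain j where j: "m = Suc j" "2 * n \<le> j" by (cases m) auto
        have "x \<notin> A j" using not_less_Least[of j "\<lambda>m. x \<in> A m"] j unfolding m_def by simp
        then have xD: "x \<in> D j" using m j by (simp add: D_def)
        define k where "k = j div 2 - n"
        have "j = 2 * (k + n) + 0 \<or> j = 2 * (k + n) + 1" using j(2) unfolding k_def by presburger
        then show ?thesis using xD by blast
      qed
    qed
    have "?H (Q - C) \<le> ?H (A (2 * n) \<union> ((\<Union>k. D (2 * (k + n) + 0)) \<union> (\<Union>k. D (2 * (k + n) + 1))))"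
      by (rule hausdorff_outer_mono[OF cover])
    also have "\<dots> \<le> ?H (A (2 * n)) + (?H (\<Union>k. D (2 * (k + n) + 0)) + ?H (\<Union>k. D (2 * (k + n) + 1)))"
      by (meson add_left_mono hausdorff_outer_subadditive order_trans)
    also have "\<dots> \<le> ?H (A (2 * n)) + (ennreal (e / 2) + ennreal (e / 2))"
      using N[of n] hausdorff_outer_countably_subadditive[of s] unfolding n_def
      by (intro add_left_mono add_mono) (meson max.cobounded1 max.cobounded2 order_trans)+
    also have "\<dots> = ?H (A (2 * n)) + ennreal e" using e by (simp flip: ennreal_plus)
    finally have 1: "?H (Q - C) \<le> ?H (A (2 * n)) + ennreal e" .
    have "?H (Q \<inter> C) + ?H (A (2 * n)) \<le> ?H (Q \<inter> C \<union> A (2 * n))"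
    proof (rule hausdorff_outer_separated[of "1 / real (Suc (2 * n))"])
      fix x y assume "x \<in> Q \<inter> C" "y \<in> A (2 * n)"
      then show "1 / real (Suc (2 * n)) \<le> d x y" by (auto simp: A_def commute[of x y])
    qed simp
    also have "\<dots> \<le> ?H Q" by (rule hausdorff_outer_mono) (auto simp: A_def)
    finally have 2: "?H (Q \<inter> C) + ?H (A (2 * n)) \<le> ?H Q" .
    have "?H (Q \<inter> C) + ?H (Q - C) \<le> (?H (Q \<inter> C) + ?H (A (2 * n))) + ennreal e"
      using add_left_mono[OF 1] by (simp add: add.assoc)
    also have "\<dots> \<le> ?H Q + ennreal e" using 2 by (rule add_right_mono)
    finally show "?H (Q \<inter> C) + ?H (Q - C) \<le> ?H Q + ennreal e" .
  qed
qed (simp add: top_greatest)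

lemma sets_borel_of_mtopology: "sets (borel_of mtopology) = sigma_sets M {U. openin mtopology U}"
proof -
  have "{U. openin mtopology U} \<subseteq> Pow M" using openin_subset by fastforce
  then show ?thesis by (simp add: borel_of_def)
qed

text \<open>\<open>measure_of\<close> takes the intended values only if the given function is a
  measure on the generated sigma-algebra; otherwise it is 0 everywhere. Caratheodory's lemma
  provides a measure on the \<open>lambda_system\<close>, which contains the open sets because
  closed sets satisfy the criterion.\<close>

lemma
  shows space_hausdorff_measure: "space (hausdorff_measure M d s) = M"
    and sets_hausdorff_measure: "sets (hausdorff_measure M d s) = sets (borel_of mtopology)"
    and emeasure_hausdorff_measure:
      "A \<in> sets (borel_of mtopology) \<Longrightarrow> emeasure (hausdorff_measure M d s) A = hausdorff_outer M d s A"
proof -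
  let ?H = "hausdorff_outer M d s"
  have sub: "sets (borel_of mtopology) \<subseteq> Pow M"
    unfolding sets_borel_of_mtopology using openin_subset[of mtopology]
    by (intro subsetI PowI sigma_sets_into_sp[of "{U. openin mtopology U}"]) auto
  have sig: "sigma_sets M (sets (borel_of mtopology)) = sets (borel_of mtopology)"
    unfolding sets_borel_of_mtopology by (rule sigma_sets_sigma_sets_eq) (use openin_subset in fastforce)
  show sp: "space (hausdorff_measure M d s) = M"
    unfolding hausdorff_measure_def using sub by (rule space_measure_of)
  show sets: "sets (hausdorff_measure M d s) = sets (borel_of mtopology)"
    unfolding hausdorff_measure_def using sub sig by simp
  interpret P: sigma_algebra M "Pow M" by (rule sigma_algebra_Pow)
  have pos: "positive (Pow M) ?H" by (simp add: positive_def)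
  have "outer_measure_space (Pow M) ?H"
    unfolding outer_measure_space_def
    using pos by (auto simp: increasing_def countably_subadditive_def
        intro: hausdorff_outer_mono hausdorff_outer_countably_subadditive)
  from P.caratheodory_lemma[OF this]
  have ms: "measure_space M (lambda_system M (Pow M) ?H) ?H" .
  then interpret L: sigma_algebra M "lambda_system M (Pow M) ?H"
    by (simp add: measure_space_def)
  have "{U. openin mtopology U} \<subseteq> lambda_system M (Pow M) ?H"
  proof
    fix U assume "U \<in> {U. openin mtopology U}"
    then have U: "U \<subseteq> M" "closedin mtopology (M - U)"
      using openin_subset[of mtopology U] by auto
    have "?H (U \<inter> Q) + ?H ((M - U) \<inter> Q) = ?H Q" if Q: "Q \<subseteq> M" for Q
    proof (rule antisym)
      have "Q \<inter> (M - U) = (M - U) \<inter> Q" "Q - (M - U) = U \<inter> Q" using Q U by auto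
      then show "?H (U \<inter> Q) + ?H ((M - U) \<inter> Q) \<le> ?H Q"
        using closed_Caratheodory_hausdorff[OF U(2) Q, of s] by (simp add: add.commute)
      have "Q = (U \<inter> Q) \<union> ((M - U) \<inter> Q)" using Q by auto
      then show "?H Q \<le> ?H (U \<inter> Q) + ?H ((M - U) \<inter> Q)"
        by (metis hausdorff_outer_subadditive)
    qed
    then show "U \<in> lambda_system M (Pow M) ?H"
      using U by (auto simp: lambda_system_def)
  qed
  then have "sets (borel_of mtopology) \<subseteq> lambda_system M (Pow M) ?H"
    unfolding sets_borel_of_mtopology by (rule L.sigma_sets_subset)
  moreover have "sigma_algebra M (sets (borel_of mtopology))"
    unfolding sets_borel_of_mtopology by (rule sigma_algebra_sigma_sets) (use openin_subset in fastforce)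
  ultimately have ms': "measure_space M (sets (borel_of mtopology)) ?H"
    using measure_down[OF ms] by blast
  show "A \<in> sets (borel_of mtopology) \<Longrightarrow> emeasure (hausdorff_measure M d s) A = ?H A"
    unfolding hausdorff_measure_def
    using ms' by (intro emeasure_measure_of_sigma) (auto simp: measure_space_def)
qed

end

lemma (in Metric_space) hausdorff_pre_finite_cover:
  assumes F: "finite F" "\<And>U. U \<in> F \<Longrightarrow> U \<subseteq> M" "\<And>U x y. U \<in> F \<Longrightarrow> x \<in> U \<Longrightarrow> y \<in> U \<Longrightarrow> d x y \<le> t"
    and E: "E \<subseteq> \<Union>F" and t: "0 < t" "t \<le> \<delta>" and s: "0 \<le> s"
  shows "hausdorff_pre s \<delta> E \<le> ennreal (real (card F) * t powr s)"
proof -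
  obtain f where f: "bij_betw f {..<card F} F"
    using ex_bij_betw_nat_finite[OF F(1)] by (auto simp: atLeast0LessThan)
  define U where "U i = (if i < card F then f i else {})" for i
  have UF: "U i \<in> F" if "i < card F" for i
    using f that by (auto simp: U_def bij_betw_def)
  have diam: "ediam d (U i) \<le> ennreal t" for i
  proof (cases "i < card F")
    case True
    then show ?thesis using F(3)[OF UF] by (intro ediam_leI) auto
  qed (simp add: U_def)
  have pow: "diam_pow d s (U i) \<le> ennreal (t powr s)" for i
  proof -
    have "enn2real (ediam d (U i)) \<le> t"
      using diam[of i] t(1) by (simp add: enn2real_leI)
    then have "enn2real (ediam d (U i)) powr s \<le> t powr s" using s by (intro powr_mono2) auto
    then show ?thesis using t(1) by (auto simp: diam_pow_def intro: ennreal_leI)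
  qed
  have "U \<in> hausdorff_covers \<delta> E"
    unfolding hausdorff_covers_def
  proof (intro CollectI conjI allI)
    show "U i \<subseteq> M" for i using F(2)[OF UF] by (cases "i < card F") (auto simp: U_def)
    show "ediam d (U i) \<le> ennreal \<delta>" for i
      using diam[of i] ennreal_leI[OF t(2)] by (rule order_trans)
    show "E \<subseteq> (\<Union>i. U i)"
    proof
      fix x assume "x \<in> E"
      then obtain V where "V \<in> F" "x \<in> V" using E by auto
      then obtain i where "i < card F" "f i = V" using f unfolding bij_betw_def by (metis imageE lessThan_iff)
      then show "x \<in> (\<Union>i. U i)" using \<open>x \<in> V\<close> by (auto simp: U_def)
    qed
  qed
  then have "hausdorff_pre s \<delta> E \<le> (\<Sum>i. diam_pow d s (U i))" by (rule hausdorff_pre_le)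
  also have "\<dots> = (\<Sum>i<card F. diam_pow d s (U i))"
    by (rule suminf_finite) (auto simp: U_def)
  also have "\<dots> \<le> (\<Sum>i<card F. ennreal (t powr s))" by (intro sum_mono pow)
  also have "\<dots> = ennreal (real (card F) * t powr s)"
    by (simp add: ennreal_mult ennreal_of_nat_eq_real_of_nat)
  finally show ?thesis .
qed

section \<open>Hausdorff measure and dimension of the visual boundary\<close>

locale visual_boundary = nonelementary_hyperbolic_group +
  fixes \<epsilon> Cv :: real and \<rho>
  assumes eps_pos: "\<epsilon> > 0" and Cv_pos: "Cv > 0"
    and boundary_metric: "Metric_space (gromov_boundary (carrier G) d K) \<rho>"
    and visual: "\<lbrakk>\<xi> \<in> gromov_boundary (carrier G) d K; \<eta> \<in> gromov_boundary (carrier G) d K\<rbrakk> \<Longrightarrow>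
      inverse Cv * exp_neg_mult \<epsilon> (ext_gromov_product G d (Inr \<xi>) (Inr \<eta>)) \<le> \<rho> \<xi> \<eta> \<and>
      \<rho> \<xi> \<eta> \<le> Cv * exp_neg_mult \<epsilon> (ext_gromov_product G d (Inr \<xi>) (Inr \<eta>))"

sublocale visual_boundary \<subseteq> B: Metric_space "gromov_boundary (carrier G) d K" \<rho>
  by (rule boundary_metric)

context visual_boundary
begin

abbreviation "EB \<xi> \<eta> \<equiv> E (Inr \<xi>) (Inr \<eta>)"

text \<open>Chosen so that \<open>\<omega> powr (- n)\<close> is the power of exponent
  \<open>dimB\<close> of the visual radius \<open>exp (- \<epsilon> * n)\<close>;
  \<open>hausdorff_dim_boundary\<close> identifies it as the dimension.\<close>

definition "dimB = ln \<omega> / \<epsilon>"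

lemma dimB_nonneg: "dimB \<ge> 0"
  using omega_ge_1 eps_pos by (simp add: dimB_def)

lemma omega_powr_eq: "\<omega> powr x = exp (\<epsilon> * dimB * x)"
  using omega_ge_1 eps_pos by (simp add: dimB_def powr_def)

lemma EB_nonneg: "\<xi> \<in> bdry \<Longrightarrow> \<eta> \<in> bdry \<Longrightarrow> 0 \<le> EB \<xi> \<eta>"
  by (rule E_nonneg) auto

lemma visual_upper:
  assumes X: "\<xi> \<in> bdry" "\<eta> \<in> bdry" and r: "ereal r \<le> EB \<xi> \<eta>"
  shows "\<rho> \<xi> \<eta> \<le> Cv * exp (- \<epsilon> * r)"
proof -
  have "exp_neg_mult \<epsilon> (EB \<xi> \<eta>) \<le> exp (- \<epsilon> * r)"
    using EB_nonneg[OF X] r eps_pos by (cases "EB \<xi> \<eta>") (auto simp: exp_neg_mult_def)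
  then have "Cv * exp_neg_mult \<epsilon> (EB \<xi> \<eta>) \<le> Cv * exp (- \<epsilon> * r)"
    using Cv_pos by (intro mult_left_mono) auto
  then show ?thesis using visual[OF X] by linarith
qed

lemma visual_lower:
  assumes X: "\<xi> \<in> bdry" "\<eta> \<in> bdry" and r: "Cv * \<rho> \<xi> \<eta> \<le> exp (- \<epsilon> * r)"
  shows "ereal r \<le> EB \<xi> \<eta>"
proof -
  have "exp_neg_mult \<epsilon> (EB \<xi> \<eta>) \<le> Cv * \<rho> \<xi> \<eta>"
    using Cv_pos visual[OF X] by (simp add: field_simps)
  then have "exp_neg_mult \<epsilon> (EB \<xi> \<eta>) \<le> exp (- \<epsilon> * r)" using r by (rule order_trans)
  then show ?thesis
    using EB_nonneg[OF X] eps_pos by (cases "EB \<xi> \<eta>") (auto simp: exp_neg_mult_def)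
qed

text \<open>Stands in for being contained in a shadow of depth \<open>r\<close>. No group element
  casting the shadow is named, so the members of an arbitrary cover can be treated in the same
  way.\<close>

definition "clustered r S \<longleftrightarrow> S \<subseteq> bdry \<and> (\<forall>\<xi>\<in>S. \<forall>\<eta>\<in>S. ereal r \<le> EB \<xi> \<eta>)"

lemma clusteredD: "clustered r S \<Longrightarrow> \<xi> \<in> S \<Longrightarrow> \<eta> \<in> S \<Longrightarrow> ereal r \<le> EB \<xi> \<eta>"
  by (simp add: clustered_def)

lemma clustered_subset: "clustered r S \<Longrightarrow> S \<subseteq> bdry"
  by (simp add: clustered_def)

lemma clustered_boundary: "clustered 0 bdry"
  using EB_nonneg by (simp add: clustered_def zero_ereal_def)

text \<open>All points of \<open>S\<close> are seen through one element \<open>x\<close> of length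
  about \<open>n\<close>. An element \<open>y\<close> of length about \<open>m\<close> on the way to
  a point of \<open>S\<close> differs from \<open>x\<close> by an element of length about
  \<open>m - n\<close>, so an annulus of that radius indexes the cover.\<close>

lemma shadow_covers:
  obtains C1 C2 where "C1 > 0" "C2 \<ge> 0"
    "\<And>S n m. clustered n S \<Longrightarrow> 0 \<le> m \<Longrightarrow> n \<le> m \<Longrightarrow>
       \<exists>F. finite F \<and> real (card F) \<le> C1 * \<omega> powr (m - n) \<and> S \<subseteq> \<Union>F \<and> (\<forall>U\<in>F. clustered (m - C2) U)"
proof -
  \<comment> \<open>The distance of \<open>x\<close> and \<open>y\<close> exceeds
    \<open>m - n\<close> by at most \<open>4 * K\<close> from their lengths and
    \<open>6 * K + 6 * \<delta>\<close> from twice the error of their product.\<close>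
  define w where "w = 10 * K + 6 * \<delta>"
  have w: "0 \<le> w" using K_nonneg delta_nonneg by (simp add: w_def)
  obtain C1 where C1: "C1 > 0" "\<And>r. real (card (ann r w)) \<le> C1 * \<omega> powr r"
    using card_ann_upper[OF w] by metis
  define C2 where "C2 = 3 * K + 2 * \<delta>"
  have C2: "C2 \<ge> 0" using K_nonneg delta_nonneg by (simp add: C2_def)
  have main: "\<exists>F. finite F \<and> real (card F) \<le> C1 * \<omega> powr (m - n) \<and> S \<subseteq> \<Union>F \<and> (\<forall>U\<in>F. clustered (m - C2) U)"
    if S_cl: "clustered n S" and nm: "0 \<le> n" "n \<le> m" for S n m
  proof (cases "S = {}")
    case True
    then show ?thesis using C1(1) by (intro exI[of _ "{}"]) auto
  next
    case False
    then obtain \<xi>0 where \<xi>0: "\<xi>0 \<in> S" by auto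
    note S = clustered_subset[OF S_cl] and EB = clusteredD[OF S_cl]
    have \<xi>0B: "\<xi>0 \<in> bdry" using S \<xi>0 by auto
    obtain x where x: "x \<in> X" "\<bar>len x - n\<bar> \<le> 2 * K" "ereal (n - 3 * K - \<delta>) \<le> E (Inl x) (Inr \<xi>0)"
      using bdry_point[OF \<xi>0B nm(1)] by metis
    define U where "U y = {\<xi> \<in> bdry. ereal (m - 3 * K - \<delta>) \<le> E (Inl y) (Inr \<xi>)}" for y
    define F where "F = (\<lambda>z. U (x \<otimes> z)) ` ann (m - n) w"
    have annX: "z \<in> X" if "z \<in> ann r v" for z r v using that by (simp add: ann_def)
    have "S \<subseteq> \<Union>F"
    proof
      fix \<xi> assume \<xi>: "\<xi> \<in> S"
      then have \<xi>B: "\<xi> \<in> bdry" using S by auto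
      have m0: "0 \<le> m" using nm by linarith
      obtain y where y: "y \<in> X" "\<bar>len y - m\<bar> \<le> 2 * K" "ereal (m - 3 * K - \<delta>) \<le> E (Inl y) (Inr \<xi>)"
        using bdry_point[OF \<xi>B m0] by metis
      have 0: "ereal (n - 3 * K - \<delta>) \<le> EB \<xi>0 \<xi>"
        by (rule order_trans[OF _ EB[OF \<xi>0 \<xi>]]) (use K_nonneg delta_nonneg in simp)
      have 1: "ereal (n - 3 * K - \<delta> - \<delta>) \<le> E (Inl x) (Inr \<xi>)"
        by (rule E_hyp[OF _ _ _ x(3) 0]) (use x(1) \<xi>0B \<xi>B in auto)
      have 2: "ereal (n - 3 * K - \<delta> - \<delta>) \<le> E (Inr \<xi>) (Inl y)"
        unfolding E_sym[of "Inr \<xi>"]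
        by (rule order_trans[OF _ y(3)]) (use nm delta_nonneg in simp)
      have "ereal (n - 3 * K - \<delta> - \<delta> - \<delta>) \<le> E (Inl x) (Inl y)"
        by (rule E_hyp[OF _ _ _ 1 2]) (use x(1) y(1) \<xi>B in auto)
      then have g: "n - 3 * K - 3 * \<delta> \<le> gp x y" by simp
      define z where "z = inv x \<otimes> y"
      have z: "z \<in> X" "x \<otimes> z = y" "len z = d x y"
        using x(1) y(1) dist_eq_len[OF x(1) y(1)] by (simp_all add: z_def m_assoc[symmetric])
      have "len x \<le> n + 2 * K" "len y \<le> m + 2 * K" "m - 2 * K \<le> len y" using x(2) y(2) by linarith+
      moreover have "len y - len x \<le> d x y" using len_diff[OF x(1) y(1)] by linarith
      ultimately have "len z - (m - n) \<le> w" "- w \<le> len z - (m - n)"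
        using z(3) g dist_eq_gp[of x y] K_nonneg delta_nonneg unfolding w_def by argo+
      then have "z \<in> ann (m - n) w" using z(1) by (auto simp: ann_def)
      moreover have "\<xi> \<in> U (x \<otimes> z)" using y \<xi>B z(2) by (simp add: U_def)
      ultimately show "\<xi> \<in> \<Union>F" by (auto simp: F_def)
    qed
    moreover have "real (card F) \<le> C1 * \<omega> powr (m - n)"
    proof -
      have "card F \<le> card (ann (m - n) w)" unfolding F_def by (intro card_image_le finite_ann)
      then show ?thesis using C1(2)[of "m - n"] by linarith
    qed
    moreover have "ereal (m - C2) \<le> EB \<xi> \<eta>" if V: "V \<in> F" "\<xi> \<in> V" "\<eta> \<in> V" for V \<xi> \<eta>
    proof -
      obtain z where z: "z \<in> ann (m - n) w" "V = U (x \<otimes> z)" using V by (auto simp: F_def)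
      have X: "x \<otimes> z \<in> X" using x(1) annX[OF z(1)] by simp
      have "ereal (m - 3 * K - \<delta> - \<delta>) \<le> EB \<xi> \<eta>"
        using V X unfolding z(2) by - (rule E_hyp[of _ _ "Inl (x \<otimes> z)"], auto simp: U_def E_sym)
      then show ?thesis by (simp add: C2_def algebra_simps)
    qed
    ultimately show ?thesis
      by (intro exI[of _ F]) (auto simp: F_def finite_ann U_def clustered_def)
  qed
  show ?thesis
  proof (rule that[OF C1(1) C2])
    fix S :: "(real \<Rightarrow> 'a) set set" and n m :: real
    assume S: "clustered n S" and m: "0 \<le> m" "n \<le> m"
    \<comment> \<open>Products are nonnegative, so a negative depth says no more than depth 0, and
      raising it to 0 only improves the count.\<close>
    have n': "0 \<le> max n 0" "max n 0 \<le> m" using m by auto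
    have "clustered (max n 0) S"
      using S EB_nonneg by (auto simp: clustered_def max_def zero_ereal_def)
    from main[OF this n'] obtain F where F: "finite F" "real (card F) \<le> C1 * \<omega> powr (m - max n 0)" "S \<subseteq> \<Union>F"
      "\<forall>U\<in>F. clustered (m - C2) U" by auto
    have "C1 * \<omega> powr (m - max n 0) \<le> C1 * \<omega> powr (m - n)"
      using C1(1) omega_powr_mono[of "m - max n 0" "m - n"] by (intro mult_left_mono) auto
    then show "\<exists>F. finite F \<and> real (card F) \<le> C1 * \<omega> powr (m - n) \<and> S \<subseteq> \<Union>F \<and> (\<forall>U\<in>F. clustered (m - C2) U)"
      using F by (intro exI[of _ F]) auto
  qed
qed

text \<open>The cover at depth \<open>m\<close> has of the order of
  \<open>\<omega> powr (m - n)\<close> members of diameter of the order of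
  \<open>exp (- \<epsilon> * m)\<close>. In the resulting sum \<open>m\<close> cancels for
  \<open>s = dimB\<close>, which bounds the measure of shadows; for larger \<open>s\<close> the sum
  tends to 0, which bounds the dimension.\<close>

lemma hausdorff_pre_upper:
  assumes s: "0 \<le> s"
  obtains C where "C > 0"
    "\<And>S n r. clustered n S \<Longrightarrow> 0 < r \<Longrightarrow>
      \<exists>m0. \<forall>m\<ge>m0. B.hausdorff_pre s r S \<le> ennreal (C * \<omega> powr (- n) * exp (\<epsilon> * (dimB - s) * m))"
proof -
  obtain C1 C2 where C: "C1 > 0" "C2 \<ge> 0"
    "\<And>S n m. clustered n S \<Longrightarrow> 0 \<le> m \<Longrightarrow> n \<le> m \<Longrightarrow>
       \<exists>F. finite F \<and> real (card F) \<le> C1 * \<omega> powr (m - n) \<and> S \<subseteq> \<Union>F \<and> (\<forall>U\<in>F. clustered (m - C2) U)"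
    using shadow_covers by blast
  define t where "t m = Cv * exp (- \<epsilon> * (m - C2))" for m
  have t_pos: "t m > 0" for m using Cv_pos by (simp add: t_def)
  define C where "C = C1 * (Cv * exp (\<epsilon> * C2)) powr s"
  have C_pos: "C > 0" using C(1) Cv_pos by (simp add: C_def)
  show ?thesis
  proof (rule that[OF C_pos])
    fix S :: "(real \<Rightarrow> 'a) set set" and n r :: real
    assume S: "clustered n S" and r: "0 < r"
    define m0 where "m0 = max (max n 0) (C2 - ln (r / Cv) / \<epsilon>)"
    have "B.hausdorff_pre s r S \<le> ennreal (C * \<omega> powr (- n) * exp (\<epsilon> * (dimB - s) * m))" if m: "m \<ge> m0" for m
    proof -
      have m': "0 \<le> m" "n \<le> m" using m by (auto simp: m0_def)
      have "- \<epsilon> * (m - C2) \<le> ln (r / Cv)"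
        using m eps_pos by (simp add: m0_def field_simps)
      then have "exp (- \<epsilon> * (m - C2)) \<le> r / Cv"
        using r Cv_pos by (simp add: ln_ge_iff)
      then have tr: "t m \<le> r" using Cv_pos by (simp add: t_def field_simps)
      from C(3)[OF S m'] obtain F where F: "finite F" "real (card F) \<le> C1 * \<omega> powr (m - n)" "S \<subseteq> \<Union>F"
        "\<And>U. U \<in> F \<Longrightarrow> clustered (m - C2) U" by metis
      have "\<rho> \<xi> \<eta> \<le> t m" if "U \<in> F" "\<xi> \<in> U" "\<eta> \<in> U" for U \<xi> \<eta>
        unfolding t_def using that clustered_subset[OF F(4)[OF that(1)]]
        by (intro visual_upper clusteredD[OF F(4)[OF that(1)]]) auto
      then have "B.hausdorff_pre s r S \<le> ennreal (real (card F) * t m powr s)"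
        by (intro B.hausdorff_pre_finite_cover F(1,3) t_pos tr s clustered_subset[OF F(4)]) auto
      also have "\<dots> \<le> ennreal (C1 * \<omega> powr (m - n) * t m powr s)"
        by (intro ennreal_leI mult_right_mono F(2)) auto
      also have "C1 * \<omega> powr (m - n) * t m powr s = C * \<omega> powr (- n) * exp (\<epsilon> * (dimB - s) * m)"
      proof -
        have "t m = (Cv * exp (\<epsilon> * C2)) * exp (- \<epsilon> * m)"
          by (simp add: t_def exp_add[symmetric] algebra_simps)
        then have "t m powr s = (Cv * exp (\<epsilon> * C2)) powr s * exp (- \<epsilon> * m * s)"
          using Cv_pos by (simp only: powr_mult) (simp add: powr_def)
        moreover have "\<omega> powr (m - n) = \<omega> powr (- n) * exp (\<epsilon> * dimB * m)"
          by (simp add: omega_powr_eq exp_add[symmetric] algebra_simps)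
        moreover have "exp (\<epsilon> * dimB * m) * exp (- \<epsilon> * m * s) = exp (\<epsilon> * (dimB - s) * m)"
          by (simp add: exp_add[symmetric] algebra_simps)
        ultimately show ?thesis
          unfolding C_def by (metis (no_types, lifting) mult.assoc mult.left_commute)
      qed
      finally show ?thesis .
    qed
    then show "\<exists>m0. \<forall>m\<ge>m0. B.hausdorff_pre s r S \<le> ennreal (C * \<omega> powr (- n) * exp (\<epsilon> * (dimB - s) * m))"
      by blast
  qed
qed

abbreviation "HB \<equiv> hausdorff_outer bdry \<rho>"

lemma hausdorff_shadow_upper:
  obtains C where "C > 0" "\<And>S n. clustered n S \<Longrightarrow> HB dimB S \<le> ennreal (C * \<omega> powr (- n))"
proof -
  obtain C where C: "C > 0" "\<And>S n r. clustered n S \<Longrightarrow> 0 < r \<Longrightarrow>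
      \<exists>m0. \<forall>m\<ge>m0. B.hausdorff_pre dimB r S \<le> ennreal (C * \<omega> powr (- n) * exp (\<epsilon> * (dimB - dimB) * m))"
    using hausdorff_pre_upper[OF dimB_nonneg] by blast
  have "HB dimB S \<le> ennreal (C * \<omega> powr (- n))" if S: "clustered n S" for S n
    unfolding B.hausdorff_outer_eq
  proof (rule SUP_least)
    fix r :: real assume "r \<in> {0<..}"
    then have "0 < r" by simp
    from C(2)[OF S this] show "B.hausdorff_pre dimB r S \<le> ennreal (C * \<omega> powr (- n))" by auto
  qed
  then show ?thesis using that C(1) by blast
qed

lemma hausdorff_zero_above:
  assumes s: "dimB < s"
  shows "HB s bdry = 0"
proof -
  have s0: "0 \<le> s" using s dimB_nonneg by linarith
  obtain C where C: "C > 0" "\<And>S n r. clustered n S \<Longrightarrow> 0 < r \<Longrightarrow>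
      \<exists>m0. \<forall>m\<ge>m0. B.hausdorff_pre s r S \<le> ennreal (C * \<omega> powr (- n) * exp (\<epsilon> * (dimB - s) * m))"
    using hausdorff_pre_upper[OF s0] by blast
  have "B.hausdorff_pre s r bdry \<le> 0" if r: "0 < r" for r
  proof (rule ennreal_le_epsilon)
    fix e :: real assume e: "0 < e"
    from C(2)[OF clustered_boundary r] obtain m0 where
      m0: "\<And>m. m \<ge> m0 \<Longrightarrow> B.hausdorff_pre s r bdry \<le> ennreal (C * \<omega> powr (- 0) * exp (\<epsilon> * (dimB - s) * m))"
      by blast
    define k where "k = \<epsilon> * (s - dimB)"
    have k: "k > 0" using s eps_pos by (simp add: k_def)
    define m where "m = max m0 (- ln (e / C) / k)"
    have "- k * m \<le> ln (e / C)" using k by (simp add: m_def field_simps max_def)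
    then have "exp (- k * m) \<le> e / C" using e C(1) by (simp add: ln_ge_iff)
    then have "C * exp (- k * m) \<le> e" using C(1) by (simp add: field_simps)
    moreover have "\<epsilon> * (dimB - s) * m = - k * m" by (simp add: k_def algebra_simps)
    ultimately have "C * \<omega> powr (- 0) * exp (\<epsilon> * (dimB - s) * m) \<le> e"
      using omega_ge_1 by simp
    then show "B.hausdorff_pre s r bdry \<le> 0 + ennreal e"
      using m0[of m] by (simp add: m_def) (meson ennreal_leI order_trans)
  qed
  then show ?thesis
    unfolding B.hausdorff_outer_eq by (intro antisym SUP_least) auto
qed

text \<open>A set of diameter \<open>t\<close> has depth about \<open>- ln t / \<epsilon>\<close>,
  and there \<open>\<omega> powr (- n)\<close> equals \<open>t powr dimB\<close>. A set of diameter
  0 has no finite depth; it is given a small positive diameter, whose cost is at most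
  \<open>\<tau>\<close>.\<close>

lemma covering_set_depth:
  obtains C where "C \<ge> 0"
    "\<And>S \<tau>. S \<subseteq> bdry \<Longrightarrow> S \<noteq> {} \<Longrightarrow> ediam \<rho> S \<le> ennreal 1 \<Longrightarrow> 0 < \<tau> \<Longrightarrow>
      \<exists>n\<ge>0. clustered (n - C) S \<and> ennreal (\<omega> powr (- n)) \<le> diam_pow \<rho> dimB S + ennreal \<tau>"
proof -
  \<comment> \<open>The multiplicative constant of the visual metric becomes this additive loss of
    depth.\<close>
  define C where "C = \<bar>ln Cv\<bar> / \<epsilon>"
  have C: "C \<ge> 0" using eps_pos by (simp add: C_def)
  show ?thesis
  proof (rule that[OF C])
    fix S :: "(real \<Rightarrow> 'a) set set" and \<tau> :: real
    assume S: "S \<subseteq> bdry" "S \<noteq> {}" "ediam \<rho> S \<le> ennreal 1" and \<tau>: "0 < \<tau>"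
    show "\<exists>n\<ge>0. clustered (n - C) S \<and> ennreal (\<omega> powr (- n)) \<le> diam_pow \<rho> dimB S + ennreal \<tau>"
    proof (cases "dimB = 0")
      case True
      \<comment> \<open>In dimension 0 every nonempty set costs 1 by convention, so depth 0 serves
        for all of them.\<close>
      then have "\<omega> = 1" using omega_powr_eq[of 1] omega_ge_1 by simp
      moreover have "ereal (0 - C) \<le> EB \<xi> \<eta>" if "\<xi> \<in> S" "\<eta> \<in> S" for \<xi> \<eta>
      proof -
        have "ereal (0 - C) \<le> 0" using C by (simp add: zero_ereal_def)
        also have "0 \<le> EB \<xi> \<eta>" by (rule EB_nonneg) (use that S in auto)
        finally show ?thesis .
      qed
      ultimately show ?thesis
        using S True by (intro exI[of _ 0]) (auto simp: diam_pow_def add_increasing2 clustered_def)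
    next
      case False
      then have D: "dimB > 0" using dimB_nonneg by simp
      define t where "t = enn2real (ediam \<rho> S)"
      have "ediam \<rho> S < top_class.top" by (rule le_less_trans[OF S(3)]) simp
      then have t: "0 \<le> t" "t \<le> 1" "ediam \<rho> S = ennreal t"
        using S(3) by (simp_all add: t_def enn2real_leI)
      define t' where "t' = (if t > 0 then t else min 1 (\<tau> powr (1 / dimB)))"
      have t': "0 < t'" "t' \<le> 1" "t \<le> t'" using t \<tau> by (auto simp: t'_def)
      have t'D: "t' powr dimB \<le> t powr dimB + \<tau>"
      proof (cases "t > 0")
        case False
        have "t' powr dimB \<le> (\<tau> powr (1 / dimB)) powr dimB"
          using False D t' by (intro powr_mono2) (auto simp: t'_def)
        also have "\<dots> = \<tau>" using D \<tau> by (simp add: powr_powr)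
        finally show ?thesis by (simp add: add_increasing)
      qed (use \<tau> in \<open>simp add: t'_def\<close>)
      define n where "n = - ln t' / \<epsilon>"
      have n: "n \<ge> 0" "exp (- \<epsilon> * n) = t'"
        using t' eps_pos divide_nonpos_pos[of "ln t'" \<epsilon>] by (auto simp: n_def)
      have "ereal (n - C) \<le> EB \<xi> \<eta>" if "\<xi> \<in> S" "\<eta> \<in> S" for \<xi> \<eta>
      proof (rule visual_lower)
        show "\<xi> \<in> bdry" "\<eta> \<in> bdry" using that S by auto
        have "ennreal (\<rho> \<xi> \<eta>) \<le> ennreal t" using B.dist_le_ediam[OF that] t by simp
        then have "\<rho> \<xi> \<eta> \<le> t" using t(1) by (simp add: ennreal_le_iff)
        then have "\<rho> \<xi> \<eta> \<le> t'" using t' by simp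
        moreover have "Cv \<le> exp \<bar>ln Cv\<bar>" using Cv_pos by (metis abs_ge_self exp_le_cancel_iff exp_ln)
        ultimately have "Cv * \<rho> \<xi> \<eta> \<le> exp \<bar>ln Cv\<bar> * t'" using Cv_pos by (intro mult_mono) auto
        also have "\<dots> = exp (- \<epsilon> * (n - C))"
        proof -
          have "- \<epsilon> * (n - C) = \<bar>ln Cv\<bar> + - \<epsilon> * n" using eps_pos by (simp add: C_def algebra_simps)
          then show ?thesis by (simp only: exp_add n(2))
        qed
        finally show "Cv * \<rho> \<xi> \<eta> \<le> exp (- \<epsilon> * (n - C))" .
      qed
      moreover have "\<omega> powr (- n) = t' powr dimB"
      proof -
        have eq: "\<epsilon> * dimB * - n = dimB * ln t'" using eps_pos by (simp add: n_def)
        show ?thesis unfolding omega_powr_eq eq using t'(1) by (simp add: powr_def)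
      qed
      then have "ennreal (\<omega> powr (- n)) \<le> ennreal (t powr dimB) + ennreal \<tau>"
        using t'D \<tau> by (simp flip: ennreal_plus add: ennreal_leI)
      moreover have "diam_pow \<rho> dimB S = ennreal (t powr dimB)"
        using S(2) D by (simp add: diam_pow_def t_def)
      ultimately show ?thesis using n(1) S(1) by (intro exI[of _ n]) (auto simp: clustered_def)
    qed
  qed
qed

text \<open>A counting argument replaces the mass distribution principle: if a cover were too light, the
  shadows of its members would miss a point \<open>g N\<close> of every annulus, and a limit point of
  the sequence \<open>g\<close> would be uncovered.\<close>

lemma hausdorff_pre_positive: "\<exists>c>0. ennreal c \<le> B.hausdorff_pre dimB 1 bdry"
proof -
  obtain C3 where C3: "C3 \<ge> 0"
    "\<And>S \<tau>. S \<subseteq> bdry \<Longrightarrow> S \<noteq> {} \<Longrightarrow> ediam \<rho> S \<le> ennreal 1 \<Longrightarrow> 0 < \<tau> \<Longrightarrow>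
      \<exists>n\<ge>0. clustered (n - C3) S \<and> ennreal (\<omega> powr (- n)) \<le> diam_pow \<rho> dimB S + ennreal \<tau>"
    using covering_set_depth by blast
  obtain w c where wc: "w \<ge> 0" "c > 0" "\<And>r. 0 \<le> r \<Longrightarrow> c * \<omega> powr r \<le> real (card (ann r w))"
    using card_ann_lower by blast
  \<comment> \<open>From \<open>g\<close> to \<open>x i\<close> the argument passes through the
    limit point and the chosen point of \<open>U i\<close>. This costs \<open>\<delta>\<close>
    twice, on top of the errors \<open>C3\<close> of the depth and \<open>3 * K + \<delta>\<close>
    of \<open>x i\<close>.\<close>
  define C5 where "C5 = C3 + 3 * K + 3 * \<delta>"
  define w' where "w' = 2 * K + w + 2 * C5"
  have nn: "0 \<le> C5" "0 \<le> w'" using C3 wc K_nonneg delta_nonneg by (auto simp: C5_def w'_def)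
  obtain C6 where C6: "C6 > 0" "\<And>r. real (card (ann r w')) \<le> C6 * \<omega> powr r"
    using card_ann_upper[OF nn(2)] by blast
  \<comment> \<open>A cover lighter than \<open>\<tau>\<close>, with corrections adding up to
    another \<open>\<tau>\<close>, hides at most \<open>2 * \<tau> * C6\<close>, that is
    \<open>c / 2\<close>, times \<open>\<omega> powr N\<close> elements of the annulus, fewer than
    it contains.\<close>
  define \<tau> where "\<tau> = c / (4 * C6)"
  have \<tau>: "\<tau> > 0" using wc C6 by (simp add: \<tau>_def)
  have "ennreal \<tau> \<le> (\<Sum>i. diam_pow \<rho> dimB (U i))" if U: "U \<in> B.hausdorff_covers 1 bdry" for U
  proof (rule ccontr)
    assume neg: "\<not> ?thesis"
    have Us: "U i \<subseteq> bdry" "ediam \<rho> (U i) \<le> ennreal 1" "bdry \<subseteq> (\<Union>i. U i)" for i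
      using U by (auto simp: B.hausdorff_covers_def)
    define I where "I = {i. U i \<noteq> {}}"
    have "\<exists>n\<ge>0. clustered (n - C3) (U i) \<and> ennreal (\<omega> powr (- n)) \<le> diam_pow \<rho> dimB (U i) + ennreal (\<tau> * (1/2) ^ Suc i)" if "i \<in> I" for i
      using C3(2)[of "U i" "\<tau> * (1/2) ^ Suc i"] Us that \<tau> by (simp add: I_def)
    then obtain n where n: "\<And>i. i \<in> I \<Longrightarrow> n i \<ge> 0"
      "\<And>i. i \<in> I \<Longrightarrow> clustered (n i - C3) (U i)"
      "\<And>i. i \<in> I \<Longrightarrow> ennreal (\<omega> powr (- n i)) \<le> diam_pow \<rho> dimB (U i) + ennreal (\<tau> * (1/2) ^ Suc i)"
      by metis
    have "\<exists>\<xi>. \<xi> \<in> U i" if "i \<in> I" for i using that by (auto simp: I_def)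
    then obtain \<xi> where \<xi>: "\<And>i. i \<in> I \<Longrightarrow> \<xi> i \<in> U i" by metis
    have \<xi>B: "\<xi> i \<in> bdry" if "i \<in> I" for i using \<xi>[OF that] Us(1) by auto
    have "\<exists>x\<in>X. \<bar>len x - n i\<bar> \<le> 2 * K \<and> ereal (n i - 3 * K - \<delta>) \<le> E (Inl x) (Inr (\<xi> i))" if "i \<in> I" for i
      using bdry_point[OF \<xi>B[OF that] n(1)[OF that]] by metis
    then obtain x where x: "\<And>i. i \<in> I \<Longrightarrow> x i \<in> X" "\<And>i. i \<in> I \<Longrightarrow> \<bar>len (x i) - n i\<bar> \<le> 2 * K"
      "\<And>i. i \<in> I \<Longrightarrow> ereal (n i - 3 * K - \<delta>) \<le> E (Inl (x i)) (Inr (\<xi> i))" by metis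
    have sum_le: "(\<Sum>i\<in>J. \<omega> powr (- n i)) \<le> 2 * \<tau>" if J: "finite J" "J \<subseteq> I" for J
    proof -
      have "ennreal (\<Sum>i\<in>J. \<omega> powr (- n i)) = (\<Sum>i\<in>J. ennreal (\<omega> powr (- n i)))"
        by (simp add: sum_ennreal)
      also have "\<dots> \<le> (\<Sum>i\<in>J. diam_pow \<rho> dimB (U i) + ennreal (\<tau> * (1/2) ^ Suc i))"
        using J by (intro sum_mono n(3)) auto
      also have "\<dots> = (\<Sum>i\<in>J. diam_pow \<rho> dimB (U i)) + (\<Sum>i\<in>J. ennreal (\<tau> * (1/2) ^ Suc i))"
        by (simp add: sum.distrib)
      also have "\<dots> \<le> (\<Sum>i. diam_pow \<rho> dimB (U i)) + (\<Sum>i. ennreal (\<tau> * (1/2) ^ Suc i))"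
        using J by (intro add_mono sum_le_suminf) auto
      also have "(\<Sum>i. ennreal (\<tau> * (1/2) ^ Suc i)) = ennreal (\<tau> * 1)"
        using \<tau> by (intro suminf_ennreal_eq sums_mult power_half_series) auto
      also have "(\<Sum>i. diam_pow \<rho> dimB (U i)) + ennreal (\<tau> * 1) \<le> ennreal \<tau> + ennreal (\<tau> * 1)"
        using neg by (intro add_mono) auto
      also have "\<dots> = ennreal (2 * \<tau>)" using \<tau> by (simp flip: ennreal_plus)
      finally show ?thesis using \<tau> by (simp add: ennreal_le_iff)
    qed
    \<comment> \<open>The elements of the annulus that lie behind the member \<open>U i\<close>.
      They differ from \<open>x i\<close> by elements of length about \<open>real N - n i\<close>,
      which bounds their number.\<close>
    define bad where "bad N i = {g \<in> ann (real N) w. n i - C5 \<le> gp g (x i)}" for N i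
    have bad_card: "real (card (bad N i)) \<le> C6 * \<omega> powr (real N - n i)" if i: "i \<in> I" for N i
    proof -
      have "card (bad N i) \<le> card (ann (real N - n i) w')"
      proof (rule card_inj_on_le[of "\<lambda>g. inv (x i) \<otimes> g"])
        show "inj_on (\<lambda>g. inv (x i) \<otimes> g) (bad N i)"
          using x(1)[OF i] by (auto simp: inj_on_def bad_def ann_def)
        show "(\<lambda>g. inv (x i) \<otimes> g) ` bad N i \<subseteq> ann (real N - n i) w'"
        proof (rule image_subsetI)
          fix g assume "g \<in> bad N i"
          then have g: "g \<in> X" "\<bar>len g - real N\<bar> \<le> w" "n i - C5 \<le> gp g (x i)"
            by (auto simp: bad_def ann_def)
          have "len g \<le> real N + w" "real N - w \<le> len g" "len (x i) \<le> n i + 2 * K"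
            using g(2) x(2)[OF i] by linarith+
          moreover have "len g - len (x i) \<le> d g (x i)" using len_diff[OF g(1) x(1)[OF i]] by linarith
          ultimately have "d g (x i) - (real N - n i) \<le> w'" "- w' \<le> d g (x i) - (real N - n i)"
            using gp2[of g "x i"] g(3) nn K_nonneg wc(1) unfolding w'_def by argo+
          moreover have "len (inv (x i) \<otimes> g) = d g (x i)"
            using dist_eq_len[of "x i" g] x(1)[OF i] g(1) by (simp add: commute)
          ultimately show "inv (x i) \<otimes> g \<in> ann (real N - n i) w'"
            using x(1)[OF i] g(1) by (simp add: ann_def)
        qed
      qed (rule finite_ann)
      then show ?thesis using C6(2)[of "real N - n i"] by linarith
    qed
    have "\<exists>g\<in>ann (real N) w. \<forall>i\<in>I. \<not> n i - C5 \<le> gp g (x i)" for N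
    proof (rule ccontr)
      assume "\<not> ?thesis"
      then have "\<forall>g\<in>ann (real N) w. \<exists>i\<in>I. g \<in> bad N i" by (auto simp: bad_def)
      then obtain h where h: "\<And>g. g \<in> ann (real N) w \<Longrightarrow> h g \<in> I \<and> g \<in> bad N (h g)" by metis
      \<comment> \<open>Infinitely many members may hide elements, but the annulus is finite. One
        chosen member for each element gives a finite set of indices, as the union bound and
        \<open>sum_le\<close> require.\<close>
      define J where "J = h ` ann (real N) w"
      have J: "finite J" "J \<subseteq> I" using h by (auto simp: J_def finite_ann)
      have fb: "finite (bad N i)" for i by (rule finite_subset[OF _ finite_ann]) (auto simp: bad_def)
      have "card (ann (real N) w) \<le> card (\<Union>i\<in>J. bad N i)"
        by (intro card_mono finite_UN_I[OF J(1) fb]) (use h in \<open>auto simp: J_def\<close>)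
      also have "\<dots> \<le> (\<Sum>i\<in>J. card (bad N i))" by (rule card_UN_le[OF J(1)])
      finally have "real (card (ann (real N) w)) \<le> (\<Sum>i\<in>J. real (card (bad N i)))"
        by (simp only: of_nat_sum[symmetric] of_nat_le_iff)
      also have "\<dots> \<le> (\<Sum>i\<in>J. C6 * \<omega> powr (real N - n i))"
        using J by (intro sum_mono bad_card) auto
      also have "\<dots> = C6 * \<omega> powr real N * (\<Sum>i\<in>J. \<omega> powr (- n i))"
        by (simp add: sum_distrib_left powr_add[symmetric] mult.assoc)
      also have "\<dots> \<le> C6 * \<omega> powr real N * (2 * \<tau>)"
        using C6(1) by (intro mult_left_mono sum_le J) auto
      also have "\<dots> = c / 2 * \<omega> powr real N" using C6(1) by (simp add: \<tau>_def)
      also have "\<dots> < c * \<omega> powr real N" using wc(2) omega_ge_1 by simp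
      finally show False using wc(3)[of "real N"] by simp
    qed
    then obtain g where g: "\<And>N. g N \<in> ann (real N) w" "\<And>N i. i \<in> I \<Longrightarrow> gp (g N) (x i) < n i - C5"
      by (metis not_le)
    have gX: "g N \<in> X" for N using g(1)[of N] by (simp add: ann_def)
    have "\<bar>len (g N) - real N\<bar> \<le> w" for N using g(1)[of N] by (simp add: ann_def)
    then have "real N - w \<le> len (g N)" for N by (smt (verit))
    then have ev: "\<forall>\<^sub>F N in sequentially. real N - w \<le> len (g N)" by (intro always_eventually) blast
    have "filterlim (\<lambda>N. real N - w) at_top sequentially"
      using filterlim_tendsto_add_at_top[OF tendsto_const filterlim_real_sequentially, of "- w"]
      by (simp add: algebra_simps)
    from filterlim_at_top_mono[OF this ev]
    have "filterlim (\<lambda>N. len (g N)) at_top sequentially" .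
    then obtain \<zeta> \<sigma> where \<zeta>: "\<zeta> \<in> bdry" "\<And>n::nat. ereal (real n) \<le> E (Inl (g (\<sigma> n))) (Inr \<zeta>)"
      using bdry_compactness[of g, OF gX] by metis
    obtain i where i: "\<zeta> \<in> U i" using Us(3) \<zeta>(1) by auto
    then have iI: "i \<in> I" by (auto simp: I_def)
    define r where "r = n i - C3 - 3 * K - \<delta>"
    have 1: "ereal r \<le> E (Inl (x i)) (Inr (\<xi> i))"
      by (rule order_trans[OF _ x(3)[OF iI]]) (use C3 in \<open>simp add: r_def\<close>)
    have 0: "ereal r \<le> EB (\<xi> i) \<zeta>"
      by (rule order_trans[OF _ clusteredD[OF n(2)[OF iI] \<xi>[OF iI] i]]) (use K_nonneg delta_nonneg in \<open>simp add: r_def\<close>)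
    have "ereal (r - \<delta>) \<le> E (Inl (x i)) (Inr \<zeta>)"
      by (rule E_hyp[OF _ _ _ 1 0]) (use x(1)[OF iI] \<xi>B[OF iI] \<zeta>(1) in auto)
    then have 2: "ereal (r - \<delta>) \<le> E (Inr \<zeta>) (Inl (x i))" by (simp add: E_sym)
    obtain k :: nat where k: "r - \<delta> \<le> real k" using real_arch_simple by blast
    have 3: "ereal (r - \<delta>) \<le> E (Inl (g (\<sigma> k))) (Inr \<zeta>)"
      by (rule order_trans[OF _ \<zeta>(2)]) (use k in simp)
    have "ereal (r - \<delta> - \<delta>) \<le> E (Inl (g (\<sigma> k))) (Inl (x i))"
      by (rule E_hyp[OF _ _ _ 3 2]) (use x(1)[OF iI] gX \<zeta>(1) in auto)
    then have "r - 2 * \<delta> \<le> gp (g (\<sigma> k)) (x i)" by simp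
    then show False using g(2)[OF iI, of "\<sigma> k"] by (simp add: r_def C5_def)
  qed
  then have "ennreal \<tau> \<le> B.hausdorff_pre dimB 1 bdry"
    unfolding B.hausdorff_pre_def by (intro INF_greatest)
  then show ?thesis using \<tau> by blast
qed

lemma hausdorff_positive: "0 < HB dimB bdry"
proof -
  obtain c where "c > 0" "ennreal c \<le> B.hausdorff_pre dimB 1 bdry" using hausdorff_pre_positive by blast
  then show ?thesis
    using B.hausdorff_pre_le_outer[of 1 dimB bdry] by (metis ennreal_less_zero_iff order_less_le_trans zero_less_one)
qed

text \<open>At scale 1 all diameters are at most 1, so lowering the exponent raises every term. For
  \<open>s = 0\<close> this rests on the convention that a nonempty set costs 1.\<close>

lemma hausdorff_positive_below:
  assumes s: "0 \<le> s" "s \<le> dimB"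
  shows "HB s bdry \<noteq> 0"
proof -
  obtain c where c: "c > 0" "ennreal c \<le> B.hausdorff_pre dimB 1 bdry" using hausdorff_pre_positive by blast
  have "B.hausdorff_pre dimB 1 bdry \<le> B.hausdorff_pre s 1 bdry"
    unfolding B.hausdorff_pre_def
  proof (rule INF_mono)
    fix U assume U: "U \<in> B.hausdorff_covers 1 bdry"
    have "diam_pow \<rho> dimB (U i) \<le> diam_pow \<rho> s (U i)" for i
    proof -
      define t where "t = enn2real (ediam \<rho> (U i))"
      have "ediam \<rho> (U i) \<le> ennreal 1" using U by (auto simp: B.hausdorff_covers_def)
      then have t: "0 \<le> t" "t \<le> 1" by (auto simp: t_def enn2real_leI)
      have "t powr dimB \<le> t powr s" using t s by (intro powr_mono') auto
      moreover have "t powr dimB \<le> 1" using t dimB_nonneg by (simp add: powr_le1)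
      ultimately show ?thesis
        using s by (auto simp: diam_pow_def t_def[symmetric] intro: ennreal_leI)
    qed
    then show "\<exists>V\<in>B.hausdorff_covers 1 bdry. (\<Sum>i. diam_pow \<rho> dimB (V i)) \<le> (\<Sum>i. diam_pow \<rho> s (U i))"
      using U by (intro bexI[of _ U] suminf_le) auto
  qed
  also have "\<dots> \<le> HB s bdry" by (rule B.hausdorff_pre_le_outer) simp
  finally have "ennreal c \<le> HB s bdry" using c by (meson order_trans)
  then show ?thesis using c by auto
qed

lemma hausdorff_dim_boundary: "hausdorff_dim bdry \<rho> = ereal dimB"
proof -
  have "{s. 0 \<le> s \<and> HB s bdry = 0} = {dimB<..}"
    using hausdorff_zero_above hausdorff_positive_below dimB_nonneg
    by (auto intro: ccontr)
  then have "hausdorff_dim bdry \<rho> = Inf (ereal ` {dimB<..})"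
    by (simp add: hausdorff_dim_def)
  also have "\<dots> = ereal dimB"
  proof (rule antisym)
    show "Inf (ereal ` {dimB<..}) \<le> ereal dimB"
    proof (rule dense_ge)
      fix x assume "ereal dimB < x"
      then obtain y where "ereal dimB < ereal y" "ereal y \<le> x"
        by (metis ereal_dense2 less_imp_le)
      then show "Inf (ereal ` {dimB<..}) \<le> x" by (intro Inf_lower2[of "ereal y"]) auto
    qed
  qed (auto intro!: Inf_greatest)
  finally show ?thesis .
qed

end

subsection \<open>The compactification\<close>

lemma limitin_subseq: "limitin T p l sequentially \<Longrightarrow> strict_mono (\<sigma> :: nat \<Rightarrow> nat) \<Longrightarrow> limitin T (p \<circ> \<sigma>) l sequentially"
  unfolding limitin_def comp_def using eventually_subseq by blast

lemma space_borel_of: "space (borel_of T) = topspace T"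
  by (simp add: borel_of_def space_measure_of_conv)

lemma openin_imp_sets_borel_of: "openin T U \<Longrightarrow> U \<in> sets (borel_of T)"
  unfolding borel_of_def by (subst sets_measure_of) (auto dest: openin_subset)

lemma continuous_imp_borel_of:
  assumes f: "continuous_map T euclideanreal f"
  shows "f \<in> borel_measurable (borel_of T)"
proof (rule borel_measurableI)
  fix S :: "real set" assume "open S"
  then have "openin T {x \<in> topspace T. f x \<in> S}"
    using openin_continuous_map_preimage[OF f] by simp
  moreover have "f -` S \<inter> space (borel_of T) = {x \<in> topspace T. f x \<in> S}"
    by (auto simp: space_borel_of)
  ultimately show "f -` S \<inter> space (borel_of T) \<in> sets (borel_of T)"
    by (simp add: openin_imp_sets_borel_of)
qed

lemma measurable_borel_ofI:
  assumes f: "f \<in> space N \<rightarrow> topspace T"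
    and U: "\<And>U. openin T U \<Longrightarrow> f -` U \<inter> space N \<in> sets N"
  shows "f \<in> measurable N (borel_of T)"
  unfolding borel_of_def
  by (rule measurable_measure_of) (use f U in \<open>auto dest: openin_subset\<close>)

context rough_hyperbolic_group
begin

abbreviation "CT \<equiv> completion_topology G d K"

lemma limitin_boundary:
  assumes p: "\<And>n. p n \<in> compl" and \<xi>: "\<xi> \<in> bdry"
    and E: "\<And>r. \<forall>\<^sub>F n in sequentially. ereal r \<le> E (p n) (Inr \<xi>)"
  shows "limitin CT p (Inr \<xi>) sequentially"
  unfolding limitin_def topspace_completion_topology openin_completion_topology
proof (intro conjI allI impI)
  show "Inr \<xi> \<in> compl" using \<xi> by simp
  fix U assume U: "completion_open G d K U \<and> Inr \<xi> \<in> U"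
  have "(\<lambda>n. E (p n) (Inr \<xi>)) \<longlonglongrightarrow> \<infinity>"
    unfolding tendsto_PInfty
  proof
    fix r :: real
    show "\<forall>\<^sub>F n in sequentially. ereal r < E (p n) (Inr \<xi>)"
      using E[of "r + 1"] by eventually_elim (auto intro: less_le_trans[of _ "ereal (r + 1)"])
  qed
  then show "\<forall>\<^sub>F n in sequentially. p n \<in> U"
    using U p unfolding completion_open_def by blast
qed

text \<open>A boundary point \<open>p n\<close> is replaced by an element \<open>x n\<close> of
  length about \<open>n\<close> that is close to it. If the lengths tend to infinity,
  \<open>bdry_compactness\<close> applies. Otherwise infinitely many lengths are bounded, which for
  large \<open>n\<close> happens only where \<open>p n\<close> is itself the element
  \<open>x n\<close>, and a finite ball yields a constant subsequence.\<close>

lemma completion_seq_compact: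
  assumes p: "\<And>n::nat. p n \<in> compl"
  obtains \<tau> l where "strict_mono \<tau>" "l \<in> compl" "limitin CT (p \<circ> \<tau>) l sequentially"
proof -
  define A where "A = 3 * K + \<delta>"
  have A: "A \<ge> 0" using K_nonneg delta_nonneg by (simp add: A_def)
  have "\<exists>x\<in>X. p n = Inl x \<or> (\<bar>len x - real n\<bar> \<le> 2 * K \<and> ereal (real n - A) \<le> E (p n) (Inl x))" for n
  proof (cases "p n")
    case (Inl x)
    then show ?thesis using p[of n] by (intro bexI[of _ x]) auto
  next
    case (Inr \<xi>)
    then have "\<xi> \<in> bdry" using p[of n] by simp
    then obtain x where "x \<in> X" "\<bar>len x - real n\<bar> \<le> 2 * K" "ereal (real n - 3 * K - \<delta>) \<le> E (Inl x) (Inr \<xi>)"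
      using bdry_point[of \<xi> "real n"] by auto
    then show ?thesis using Inr by (intro bexI[of _ x]) (auto simp: A_def E_sym algebra_simps)
  qed
  then obtain x where x: "\<And>n. x n \<in> X"
    "\<And>n. p n = Inl (x n) \<or> (\<bar>len (x n) - real n\<bar> \<le> 2 * K \<and> ereal (real n - A) \<le> E (p n) (Inl (x n)))"
    by metis
  show thesis
  proof (cases "\<exists>r. infinite {n. len (x n) \<le> r}")
    case True
    then obtain r where r: "infinite {n. len (x n) \<le> r}" by blast
    \<comment> \<open>The lower bound on \<open>n\<close> excludes the boundary terms, for which
      \<open>len (x n)\<close> is at least \<open>n - 2 * K\<close> and hence larger than
      \<open>r\<close>.\<close>
    define N where "N = {n. len (x n) \<le> r \<and> r + 2 * K < real n}"
    obtain k :: nat where k: "r + 2 * K \<le> real k" using real_arch_simple by blast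
    have "{n. len (x n) \<le> r} \<subseteq> N \<union> {..k}" using k by (auto simp: N_def)
    then have N: "infinite N" using r finite_subset by blast
    have pN: "p n = Inl (x n)" if "n \<in> N" for n
      using x(2)[of n] that by (auto simp: N_def)
    have "finite (x ` N)"
      by (rule finite_subset[OF _ finite_cball[of r]]) (use x in \<open>auto simp: N_def\<close>)
    from pigeonhole_infinite[OF N this] obtain n0 where n0: "n0 \<in> N" "infinite {n \<in> N. x n = x n0}" by blast
    define S where "S = {n \<in> N. x n = x n0}"
    define \<tau> where "\<tau> = enumerate S"
    have \<tau>: "strict_mono \<tau>" "\<And>n. \<tau> n \<in> S"
      using n0(2) strict_mono_enumerate enumerate_in_set unfolding \<tau>_def S_def by blast+
    have "(p \<circ> \<tau>) = (\<lambda>n. Inl (x n0))" using \<tau>(2) pN by (force simp: S_def)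
    then show thesis
      using that[OF \<tau>(1), of "Inl (x n0)"] x(1) by (simp add: topspace_completion_topology)
  next
    case False
    have "filterlim (\<lambda>n. len (x n)) at_top sequentially"
      unfolding filterlim_at_top
    proof
      fix r :: real
      have "finite {n. len (x n) \<le> r}" using False by blast
      then obtain k where k: "\<And>n. n \<in> {n. len (x n) \<le> r} \<Longrightarrow> n \<le> k"
        by (auto simp: finite_nat_set_iff_bounded_le)
      have "r \<le> len (x n)" if "n \<ge> Suc k" for n using k[of n] that by force
      then show "\<forall>\<^sub>F n in sequentially. r \<le> len (x n)" by (auto simp: eventually_sequentially)
    qed
    then obtain \<xi> \<tau> where \<xi>: "\<xi> \<in> bdry" "strict_mono \<tau>" "\<And>n::nat. ereal (real n) \<le> E (Inl (x (\<tau> n))) (Inr \<xi>)"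
      using bdry_compactness[of x, OF x(1)] by metis
    have lower: "ereal (real n - A - \<delta>) \<le> E (p (\<tau> n)) (Inr \<xi>)" for n
      using x(2)[of "\<tau> n"]
    proof
      assume "p (\<tau> n) = Inl (x (\<tau> n))"
      moreover have "ereal (real n - A - \<delta>) \<le> ereal (real n)" using A delta_nonneg by simp
      ultimately show ?thesis using \<xi>(3)[of n] by (metis order_trans)
    next
      assume *: "\<bar>len (x (\<tau> n)) - real (\<tau> n)\<bar> \<le> 2 * K \<and> ereal (real (\<tau> n) - A) \<le> E (p (\<tau> n)) (Inl (x (\<tau> n)))"
      have "n \<le> \<tau> n" using strict_mono_imp_increasing[OF \<xi>(2)] .
      then have "ereal (real n - A) \<le> ereal (real (\<tau> n) - A)" by simp
      then have 1: "ereal (real n - A) \<le> E (p (\<tau> n)) (Inl (x (\<tau> n)))" using * by (metis order_trans)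
      have "ereal (real n - A) \<le> ereal (real n)" using A by simp
      then have 2: "ereal (real n - A) \<le> E (Inl (x (\<tau> n))) (Inr \<xi>)" using \<xi>(3)[of n] by (metis order_trans)
      show ?thesis by (rule E_hyp[OF _ _ _ 1 2]) (use p x \<xi> in auto)
    qed
    have "limitin CT (p \<circ> \<tau>) (Inr \<xi>) sequentially"
    proof (rule limitin_boundary)
      fix r
      obtain k :: nat where k: "r + A + \<delta> \<le> real k" using real_arch_simple by blast
      have "ereal r \<le> E ((p \<circ> \<tau>) n) (Inr \<xi>)" if "n \<ge> k" for n
        by (rule order_trans[OF _ lower[of n, folded comp_apply[of p \<tau>]]]) (use that k in auto)
      then show "\<forall>\<^sub>F n in sequentially. ereal r \<le> E ((p \<circ> \<tau>) n) (Inr \<xi>)"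
        by (auto simp: eventually_sequentially)
    qed (use p \<xi> in auto)
    then show thesis using that[OF \<xi>(2), of "Inr \<xi>"] \<xi>(1) by simp
  qed
qed

lemma continuous_map_completion_square_limit:
  assumes f: "continuous_map (completion_square G d K) euclideanreal f"
    and p: "limitin CT p l sequentially" and q: "limitin CT q l' sequentially"
  shows "(\<lambda>n. f (p n, q n)) \<longlonglongrightarrow> f (l, l')"
proof -
  have "limitin (completion_square G d K) (\<lambda>n. (p n, q n)) (l, l') sequentially"
    unfolding completion_square_def using p q by (simp add: limitin_pairwise comp_def)
  from continuous_map_limit[OF f this] show ?thesis by (simp add: comp_def)
qed

text \<open>Provides the dominating constant for the weak limit. A sequence with unbounded values
  would have a convergent subsequence in each coordinate, along which the values of \<open>f\<close>
  converge.\<close>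

lemma continuous_map_completion_square_bounded:
  assumes f: "continuous_map (completion_square G d K) euclideanreal f"
  obtains B where "\<And>p q. p \<in> compl \<Longrightarrow> q \<in> compl \<Longrightarrow> \<bar>f (p, q)\<bar> \<le> B"
proof (rule ccontr)
  assume neg: "\<not> thesis"
  have "\<exists>p\<in>compl. \<exists>q\<in>compl. real n < \<bar>f (p, q)\<bar>" for n :: nat
    using neg that[of "real n"] by (meson not_le)
  then obtain p q where pq: "\<And>n. p n \<in> compl" "\<And>n. q n \<in> compl" "\<And>n::nat. real n < \<bar>f (p n, q n)\<bar>"
    by metis
  obtain \<sigma> l where l: "strict_mono \<sigma>" "limitin CT (p \<circ> \<sigma>) l sequentially"
    using completion_seq_compact[of p, OF pq(1)] by metis
  have "(q \<circ> \<sigma>) n \<in> compl" for n using pq by simp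
  then obtain \<tau> l' where l': "strict_mono \<tau>" "limitin CT ((q \<circ> \<sigma>) \<circ> \<tau>) l' sequentially"
    using completion_seq_compact[of "q \<circ> \<sigma>"] by metis
  have "(\<lambda>n. f ((p \<circ> \<sigma> \<circ> \<tau>) n, (q \<circ> \<sigma> \<circ> \<tau>) n)) \<longlonglongrightarrow> f (l, l')"
    by (rule continuous_map_completion_square_limit[OF f limitin_subseq[OF l(2) l'(1)] l'(2)])
  then have "Bseq (\<lambda>n. f ((p \<circ> \<sigma> \<circ> \<tau>) n, (q \<circ> \<sigma> \<circ> \<tau>) n))"
    by (rule convergent_imp_Bseq[OF convergentI])
  then obtain C where C: "\<And>n. \<bar>f ((p \<circ> \<sigma> \<circ> \<tau>) n, (q \<circ> \<sigma> \<circ> \<tau>) n)\<bar> \<le> C"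
    by (auto simp: Bseq_def)
  obtain k :: nat where k: "C \<le> real k" using real_arch_simple by blast
  have "strict_mono (\<sigma> \<circ> \<tau>)" using l(1) l'(1) by (rule strict_mono_o)
  then have "k \<le> \<sigma> (\<tau> k)" using strict_mono_imp_increasing[of "\<sigma> \<circ> \<tau>" k] by simp
  then show False using C[of k] pq(3)[of "\<sigma> (\<tau> k)"] k by simp
qed

lemma topspace_completion_square: "topspace (completion_square G d K) = compl \<times> compl"
  by (simp add: completion_square_def topspace_completion_topology)

lemma countable_carrier: "countable X"
proof -
  have "X \<subseteq> (\<Union>n. {g \<in> X. len g \<le> real n})"
    using real_arch_simple by auto
  moreover have "countable (\<Union>n. {g \<in> X. len g \<le> real n})"
    by (intro countable_UN countableI_type countable_finite finite_cball)
  ultimately show ?thesis by (rule countable_subset)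
qed

end

subsection \<open>The Patterson-Sullivan measure\<close>

context visual_boundary
begin

abbreviation "PS \<equiv> patterson_sullivan G d K \<rho>"
abbreviation "borelB \<equiv> borel_of B.mtopology"

lemma boundary_in_borel: "bdry \<in> sets borelB"
  by (rule openin_imp_sets_borel_of) (metis B.topspace_mtopology openin_topspace)

lemma hausdorff_finite: "HB dimB bdry < top_class.top"
proof -
  obtain C where C: "\<And>S n. clustered n S \<Longrightarrow> HB dimB S \<le> ennreal (C * \<omega> powr (- n))"
    using hausdorff_shadow_upper by metis
  from C[OF clustered_boundary] show ?thesis by (rule le_less_trans) (auto simp: less_top)
qed

lemma
  shows space_PS: "space PS = bdry"
    and sets_PS: "sets PS = sets borelB"
    and emeasure_PS: "A \<in> sets borelB \<Longrightarrow> emeasure PS A = HB dimB A / HB dimB bdry"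
proof -
  have PS: "PS = scale_measure (1 / HB dimB bdry) (hausdorff_measure bdry \<rho> dimB)"
    by (simp add: patterson_sullivan_def normalized_hausdorff_measure_def hausdorff_dim_boundary
        B.emeasure_hausdorff_measure[OF boundary_in_borel])
  show "space PS = bdry" by (simp add: PS space_scale_measure B.space_hausdorff_measure)
  show "sets PS = sets borelB" by (simp add: PS B.sets_hausdorff_measure)
  show "A \<in> sets borelB \<Longrightarrow> emeasure PS A = HB dimB A / HB dimB bdry"
    by (simp add: PS B.emeasure_hausdorff_measure ennreal_divide_times[symmetric])
      (simp add: divide_ennreal_def mult.commute)
qed

sublocale PS: prob_space "patterson_sullivan G d K \<rho>"
proof
  show "emeasure PS (space PS) = 1"
    using hausdorff_positive hausdorff_finite
    by (simp add: space_PS emeasure_PS[OF boundary_in_borel] ennreal_divide_self)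
qed

sublocale PS2: pair_prob_space "patterson_sullivan G d K \<rho>" "patterson_sullivan G d K \<rho>" ..

lemma PS_shadow_upper:
  obtains C where "C > 0"
    "\<And>S n. S \<in> sets PS \<Longrightarrow> clustered n S \<Longrightarrow> measure PS S \<le> C * \<omega> powr (- n)"
proof -
  obtain C where C: "C > 0" "\<And>S n. clustered n S \<Longrightarrow> HB dimB S \<le> ennreal (C * \<omega> powr (- n))"
    using hausdorff_shadow_upper by metis
  obtain h where h: "h > 0" "HB dimB bdry = ennreal h"
    using hausdorff_positive hausdorff_finite
    by (cases "HB dimB bdry") (auto simp: ennreal_less_zero_iff)
  show ?thesis
  proof (rule that[of "C / h"])
    show "C / h > 0" using C h by simp
    fix S n assume S: "S \<in> sets PS" "clustered n S"
    then have "emeasure PS S \<le> ennreal (C * \<omega> powr (- n)) / ennreal h"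
      using emeasure_PS[of S] C(2) h by (simp add: sets_PS divide_right_mono_ennreal)
    also have "\<dots> = ennreal (C / h * \<omega> powr (- n))"
      using C h by (simp add: divide_ennreal)
    finally show "measure PS S \<le> C / h * \<omega> powr (- n)"
      using C h by (simp add: PS.emeasure_eq_measure ennreal_le_iff)
  qed
qed

text \<open>One point is taken from every member of the finite shadow covers at all integer depths.
  The dense sequence serves twice: for a countable basis of the boundary, and for a measurable
  choice of group elements near boundary points.\<close>

lemma boundary_separable:
  obtains q :: "nat \<Rightarrow> (real \<Rightarrow> 'a) set" where "\<And>i. q i \<in> bdry"
    "\<And>\<xi> r. \<xi> \<in> bdry \<Longrightarrow> 0 < r \<Longrightarrow> \<exists>i. \<rho> \<xi> (q i) < r"
proof -
  obtain C1 C2 where C: "C1 > 0" "C2 \<ge> 0"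
    "\<And>S n m. clustered n S \<Longrightarrow> 0 \<le> m \<Longrightarrow> n \<le> m \<Longrightarrow>
       \<exists>F. finite F \<and> real (card F) \<le> C1 * \<omega> powr (m - n) \<and> S \<subseteq> \<Union>F \<and> (\<forall>U\<in>F. clustered (m - C2) U)"
    using shadow_covers by blast
  have "\<exists>F. finite F \<and> bdry \<subseteq> \<Union>F \<and> (\<forall>U\<in>F. clustered (real j - C2) U)" for j :: nat
    using C(3)[OF clustered_boundary of_nat_0_le_iff[of j] of_nat_0_le_iff[of j]] by blast
  then obtain F where F: "\<And>j::nat. finite (F j)" "\<And>j. bdry \<subseteq> \<Union>(F j)"
    "\<And>j U. U \<in> F j \<Longrightarrow> clustered (real j - C2) U"
    by metis
  define Q where "Q = (\<Union>j. (\<lambda>U. SOME \<xi>. \<xi> \<in> U) ` (F j - {{}}))"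
  have some: "(SOME \<xi>. \<xi> \<in> U) \<in> U" if "U \<noteq> {}" for U :: "(real \<Rightarrow> 'a) set set"
    using that by (simp add: some_in_eq)
  have "countable Q"
    unfolding Q_def by (intro countable_UN countableI_type countable_image countable_finite finite_Diff F(1))
  moreover have "Q \<subseteq> bdry"
  proof
    fix \<xi> assume "\<xi> \<in> Q"
    then obtain j U where "U \<in> F j" "U \<noteq> {}" "\<xi> = (SOME \<xi>. \<xi> \<in> U)" by (auto simp: Q_def)
    then show "\<xi> \<in> bdry" using some[of U] clustered_subset[OF F(3)[of U j]] by auto
  qed
  ultimately have Q: "countable Q" "Q \<subseteq> bdry" by auto
  have dense: "\<exists>q\<in>Q. \<rho> \<xi> q < r" if \<xi>: "\<xi> \<in> bdry" and r: "0 < r" for \<xi> r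
  proof -
    obtain j :: nat where j: "C2 - ln (r / Cv) / \<epsilon> < real j" using reals_Archimedean2 by blast
    then have "- \<epsilon> * (real j - C2) < ln (r / Cv)" using eps_pos by (simp add: field_simps)
    then have "exp (- \<epsilon> * (real j - C2)) < r / Cv"
      using r Cv_pos by (metis divide_pos_pos exp_less_cancel_iff exp_ln)
    then have small: "Cv * exp (- \<epsilon> * (real j - C2)) < r" using Cv_pos by (simp add: field_simps)
    obtain U where U: "U \<in> F j" "\<xi> \<in> U" using F(2) \<xi> by blast
    define q where "q = (SOME \<xi>. \<xi> \<in> U)"
    have q: "q \<in> U" "q \<in> Q" using U some[of U] by (auto simp: q_def Q_def)
    have "\<rho> \<xi> q \<le> Cv * exp (- \<epsilon> * (real j - C2))"
      using clusteredD[OF F(3)[OF U(1)] U(2) q(1)] clustered_subset[OF F(3)[OF U(1)]] q(1) \<xi>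
      by (intro visual_upper) auto
    then show ?thesis using small q(2) by (intro bexI[of _ q]) auto
  qed
  have "HB dimB bdry \<noteq> HB dimB {}" using hausdorff_positive by simp
  then have "bdry \<noteq> {}" by metis
  then have "Q \<noteq> {}" using dense[of _ 1] by fastforce
  then have rng: "range (from_nat_into Q) = Q" using Q(1) by simp
  show ?thesis
  proof (rule that[of "from_nat_into Q"])
    show "from_nat_into Q i \<in> bdry" for i using rng Q(2) by blast
    show "\<exists>i. \<rho> \<xi> (from_nat_into Q i) < r" if "\<xi> \<in> bdry" "0 < r" for \<xi> r
      using dense[OF that] rng by (metis rangeE)
  qed
qed

lemma mball_in_borel: "B.mball \<xi> r \<in> sets borelB"
  by (rule openin_imp_sets_borel_of) simp

text \<open>If no ball around \<open>\<xi>\<close> fits, points outside \<open>U\<close> from balls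
  of radius of the order of \<open>exp (- \<epsilon> * n)\<close> have products with
  \<open>\<xi>\<close> at least \<open>n\<close>. They converge to \<open>\<xi>\<close> in the
  compactification, although \<open>U\<close> is a neighbourhood of it.\<close>

lemma openin_boundary_trace:
  assumes U: "openin CT U"
  shows "openin B.mtopology {\<xi> \<in> bdry. Inr \<xi> \<in> U}"
  unfolding B.openin_mtopology
proof (intro conjI allI impI)
  fix \<xi> assume \<xi>: "\<xi> \<in> {\<xi> \<in> bdry. Inr \<xi> \<in> U}"
  show "\<exists>r>0. B.mball \<xi> r \<subseteq> {\<xi> \<in> bdry. Inr \<xi> \<in> U}"
  proof (rule ccontr)
    assume "\<not> ?thesis"
    then have "\<exists>\<eta>. \<eta> \<in> B.mball \<xi> (exp (- \<epsilon> * real n) / Cv) \<and> Inr \<eta> \<notin> U" for n :: nat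
      using Cv_pos by (auto simp: subset_iff)
    then obtain \<eta> where \<eta>: "\<And>n. \<eta> n \<in> B.mball \<xi> (exp (- \<epsilon> * real n) / Cv)" "\<And>n::nat. Inr (\<eta> n) \<notin> U"
      by metis
    have \<eta>B: "\<eta> n \<in> bdry" for n using \<eta>(1)[of n] by simp
    have lower: "ereal (real n) \<le> E (Inr (\<eta> n)) (Inr \<xi>)" for n
      unfolding E_sym[of "Inr (\<eta> n)"]
      by (rule visual_lower) (use \<eta>(1)[of n] Cv_pos in \<open>auto simp: field_simps\<close>)
    have "limitin CT (\<lambda>n. Inr (\<eta> n)) (Inr \<xi>) sequentially"
    proof (rule limitin_boundary)
      fix r
      obtain k :: nat where k: "r \<le> real k" using real_arch_simple by blast
      have "ereal r \<le> E (Inr (\<eta> n)) (Inr \<xi>)" if "n \<ge> k" for n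
        by (rule order_trans[OF _ lower[of n]]) (use that k in auto)
      then show "\<forall>\<^sub>F n in sequentially. ereal r \<le> E (Inr (\<eta> n)) (Inr \<xi>)"
        by (auto simp: eventually_sequentially)
    qed (use \<eta>B \<xi> in auto)
    then have "\<forall>\<^sub>F n in sequentially. Inr (\<eta> n) \<in> U"
      using U \<xi> by (simp add: limitin_def)
    then show False using \<eta>(2) by simp
  qed
qed auto

text \<open>The target carries the sigma-algebra of all open sets of the square, while the source
  has only the product sigma-algebra. The countable basis of the boundary makes each open preimage a
  countable union of measurable rectangles.\<close>

lemma boundary_embedding_measurable:
  "map_prod Inr Inr \<in> measurable (PS \<Otimes>\<^sub>M PS) (borel_of (completion_square G d K))"
proof (rule measurable_borel_ofI)
  show "map_prod Inr Inr \<in> space (PS \<Otimes>\<^sub>M PS) \<rightarrow> topspace (completion_square G d K)"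
    by (auto simp: space_pair_measure space_PS topspace_completion_square)
  fix W assume W: "openin (completion_square G d K) W"
  obtain q :: "nat \<Rightarrow> (real \<Rightarrow> 'a) set" where q: "\<And>i. q i \<in> bdry"
    "\<And>\<xi> r. \<xi> \<in> bdry \<Longrightarrow> 0 < r \<Longrightarrow> \<exists>i. \<rho> \<xi> (q i) < r"
    using boundary_separable by metis
  define b where "b i n = B.mball (q i) (1 / real (Suc n))" for i n
  have basis: "\<exists>i n. \<xi> \<in> b i n \<and> b i n \<subseteq> V" if V: "openin B.mtopology V" and \<xi>: "\<xi> \<in> V" for V \<xi>
  proof -
    obtain r where r: "r > 0" "B.mball \<xi> r \<subseteq> V" using V \<xi> by (meson B.openin_mtopology)
    obtain n where n: "1 / real (Suc n) < r / 2" using nat_approx_posE[of "r / 2"] r(1) by auto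
    have \<xi>B: "\<xi> \<in> bdry" using V \<xi> openin_subset by fastforce
    obtain i where i: "\<rho> \<xi> (q i) < 1 / real (Suc n)" using q(2)[OF \<xi>B, of "1 / real (Suc n)"] by auto
    have "b i n \<subseteq> B.mball \<xi> r"
    proof
      fix \<eta> assume "\<eta> \<in> b i n"
      then have "\<eta> \<in> bdry" "\<rho> (q i) \<eta> < 1 / real (Suc n)" by (auto simp: b_def)
      then show "\<eta> \<in> B.mball \<xi> r" using B.triangle[OF \<xi>B q(1)[of i], of \<eta>] i n \<xi>B by auto
    qed
    moreover have "\<xi> \<in> b i n" using i q(1) \<xi>B by (simp add: b_def B.commute)
    ultimately show ?thesis using r(2) by blast
  qed
  define W' where "W' = map_prod Inr Inr -` W \<inter> space (PS \<Otimes>\<^sub>M PS)"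
  define J where "J = {(i, n, j, m). b i n \<times> b j m \<subseteq> W'}"
  have "W' = (\<Union>(i, n, j, m)\<in>J. b i n \<times> b j m)"
  proof (intro equalityI subsetI)
    fix z assume z: "z \<in> W'"
    obtain \<xi> \<eta> where z_eq: "z = (\<xi>, \<eta>)" by (cases z)
    have zW: "(Inr \<xi>, Inr \<eta>) \<in> W" "\<xi> \<in> bdry" "\<eta> \<in> bdry"
      using z by (auto simp: W'_def z_eq space_pair_measure space_PS)
    obtain U V where UV: "openin CT U" "openin CT V" "Inr \<xi> \<in> U" "Inr \<eta> \<in> V" "U \<times> V \<subseteq> W"
      using W zW(1) unfolding completion_square_def openin_prod_topology_alt by metis
    obtain i n where 1: "\<xi> \<in> b i n" "b i n \<subseteq> {\<xi> \<in> bdry. Inr \<xi> \<in> U}"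
      using basis[OF openin_boundary_trace[OF UV(1)], of \<xi>] UV zW by auto
    obtain j m where 2: "\<eta> \<in> b j m" "b j m \<subseteq> {\<xi> \<in> bdry. Inr \<xi> \<in> V}"
      using basis[OF openin_boundary_trace[OF UV(2)], of \<eta>] UV zW by auto
    have "b i n \<times> b j m \<subseteq> W'"
    proof
      fix y assume "y \<in> b i n \<times> b j m"
      then have "fst y \<in> bdry" "snd y \<in> bdry" "(Inr (fst y), Inr (snd y)) \<in> U \<times> V"
        using 1(2) 2(2) by auto
      then show "y \<in> W'" using UV(5) by (cases y) (auto simp: W'_def space_pair_measure space_PS)
    qed
    then have "(i, n, j, m) \<in> J" by (simp add: J_def)
    then show "z \<in> (\<Union>(i, n, j, m)\<in>J. b i n \<times> b j m)"
      using 1 2 by (auto simp: z_eq)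
  qed (auto simp: J_def)
  moreover have "(\<Union>(i, n, j, m)\<in>J. b i n \<times> b j m) \<in> sets (PS \<Otimes>\<^sub>M PS)"
    by (intro sets.countable_UN' countableI_type)
       (auto simp: b_def sets_PS mball_in_borel split: prod.splits intro!: pair_measureI)
  ultimately show "map_prod Inr Inr -` W \<inter> space (PS \<Otimes>\<^sub>M PS) \<in> sets (PS \<Otimes>\<^sub>M PS)"
    by (simp add: W'_def)
qed

section \<open>Construction of the approximating measures\<close>

lemma boundary_projection:
  obtains A p where "A \<ge> 0"
    "\<And>R \<xi>. 0 \<le> R \<Longrightarrow> \<xi> \<in> bdry \<Longrightarrow> p R \<xi> \<in> X"
    "\<And>R \<xi>. 0 \<le> R \<Longrightarrow> \<xi> \<in> bdry \<Longrightarrow> \<bar>len (p R \<xi>) - R / 2\<bar> \<le> A"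
    "\<And>R \<xi>. 0 \<le> R \<Longrightarrow> \<xi> \<in> bdry \<Longrightarrow> ereal (R / 2 - A) \<le> E (Inl (p R \<xi>)) (Inr \<xi>)"
    "\<And>R. 0 \<le> R \<Longrightarrow> p R \<in> measurable PS (count_space X)"
proof -
  obtain q :: "nat \<Rightarrow> (real \<Rightarrow> 'a) set" where q: "\<And>i. q i \<in> bdry"
    "\<And>\<xi> r. \<xi> \<in> bdry \<Longrightarrow> 0 < r \<Longrightarrow> \<exists>i. \<rho> \<xi> (q i) < r"
    using boundary_separable by metis
  have "\<exists>x\<in>X. 0 \<le> R \<longrightarrow> \<bar>len x - R / 2\<bar> \<le> 2 * K \<and> ereal (R / 2 - 3 * K - \<delta>) \<le> E (Inl x) (Inr (q i))" for i R
  proof (cases "0 \<le> R")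
    case True
    then have "0 \<le> R / 2" by simp
    then show ?thesis using bdry_point[OF q(1)[of i], of "R / 2"] by metis
  qed auto
  then have "\<forall>i R. \<exists>x. x \<in> X \<and> (0 \<le> R \<longrightarrow> \<bar>len x - R / 2\<bar> \<le> 2 * K \<and>
      ereal (R / 2 - 3 * K - \<delta>) \<le> E (Inl x) (Inr (q i)))" by blast
  then obtain y where "\<forall>i R. y i R \<in> X \<and> (0 \<le> R \<longrightarrow> \<bar>len (y i R) - R / 2\<bar> \<le> 2 * K \<and>
      ereal (R / 2 - 3 * K - \<delta>) \<le> E (Inl (y i R)) (Inr (q i)))" by metis
  then have y: "\<And>i R. y i R \<in> X" "\<And>i R. 0 \<le> R \<Longrightarrow> \<bar>len (y i R) - R / 2\<bar> \<le> 2 * K"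
    "\<And>i R. 0 \<le> R \<Longrightarrow> ereal (R / 2 - 3 * K - \<delta>) \<le> E (Inl (y i R)) (Inr (q i))"
    by blast+
  \<comment> \<open>The visual radius below which two boundary points have product at least
    \<open>R / 2\<close>.\<close>
  define r where "r R = exp (- \<epsilon> * (R / 2)) / Cv" for R
  \<comment> \<open>The first dense point close enough to \<open>\<xi>\<close>. The group element
    depends on \<open>\<xi>\<close> only through this index, which is measurable because its
    defining conditions are balls.\<close>
  define \<iota> where "\<iota> R \<xi> = (LEAST i. \<rho> \<xi> (q i) < r R)" for R \<xi>
  define A where "A = 3 * K + 2 * \<delta>"
  have \<iota>: "\<rho> \<xi> (q (\<iota> R \<xi>)) < r R" if "\<xi> \<in> bdry" for R \<xi>
  proof -
    have "\<exists>i. \<rho> \<xi> (q i) < r R" using q(2)[OF that, of "r R"] Cv_pos by (simp add: r_def)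
    then show ?thesis unfolding \<iota>_def by (rule LeastI_ex)
  qed
  show ?thesis
  proof (rule that[of A "\<lambda>R \<xi>. y (\<iota> R \<xi>) R"])
    show "A \<ge> 0" using K_nonneg delta_nonneg by (simp add: A_def)
    fix R :: real assume R: "0 \<le> R"
    have "(\<lambda>\<xi>. \<rho> \<xi> (q i) < r R) \<in> measurable PS (count_space UNIV)" for i
    proof -
      have "{\<xi> \<in> space PS. \<rho> \<xi> (q i) < r R} = B.mball (q i) (r R)"
        using q(1) by (auto simp: space_PS B.commute)
      then show ?thesis by (simp add: pred_def sets_PS mball_in_borel)
    qed
    then have "\<iota> R \<in> measurable PS (count_space UNIV)"
      unfolding \<iota>_def[abs_def] by (rule measurable_Least)
    then show "(\<lambda>\<xi>. y (\<iota> R \<xi>) R) \<in> measurable PS (count_space X)"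
      by (rule measurable_compose) (simp add: y(1))
    fix \<xi> assume \<xi>: "\<xi> \<in> bdry"
    show "y (\<iota> R \<xi>) R \<in> X" by (rule y(1))
    show "\<bar>len (y (\<iota> R \<xi>) R) - R / 2\<bar> \<le> A"
      using y(2)[OF R, of "\<iota> R \<xi>"] K_nonneg delta_nonneg unfolding A_def by linarith
    have "ereal (R / 2) \<le> EB \<xi> (q (\<iota> R \<xi>))"
      by (rule visual_lower[OF \<xi> q(1)]) (use \<iota>[OF \<xi>, of R] Cv_pos in \<open>simp add: r_def field_simps\<close>)
    moreover have "ereal (R / 2 - 3 * K - \<delta>) \<le> ereal (R / 2)" using K_nonneg delta_nonneg by simp
    ultimately have 1: "ereal (R / 2 - 3 * K - \<delta>) \<le> E (Inr (q (\<iota> R \<xi>))) (Inr \<xi>)"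
      unfolding E_sym[of "Inr (q _)"] by (metis order_trans)
    have "ereal (R / 2 - 3 * K - \<delta> - \<delta>) \<le> E (Inl (y (\<iota> R \<xi>) R)) (Inr \<xi>)"
      by (rule E_hyp[OF _ _ _ y(3)[OF R] 1]) (use y q \<xi> in auto)
    then show "ereal (R / 2 - A) \<le> E (Inl (y (\<iota> R \<xi>) R)) (Inr \<xi>)"
      by (simp add: A_def algebra_simps)
  qed
qed

lemma boundary_pair_element:
  obtains A g where "A \<ge> 0"
    "\<And>R \<xi> \<eta>. 0 \<le> R \<Longrightarrow> \<xi> \<in> bdry \<Longrightarrow> \<eta> \<in> bdry \<Longrightarrow> g R (\<xi>, \<eta>) \<in> X"
    "\<And>R \<xi> \<eta>. 0 \<le> R \<Longrightarrow> \<xi> \<in> bdry \<Longrightarrow> \<eta> \<in> bdry \<Longrightarrow> \<bar>len (g R (\<xi>, \<eta>)) - R\<bar> \<le> A"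
    "\<And>R \<xi> \<eta>. 0 \<le> R \<Longrightarrow> \<xi> \<in> bdry \<Longrightarrow> \<eta> \<in> bdry \<Longrightarrow> ereal (R / 2 - A) \<le> E (Inl (g R (\<xi>, \<eta>))) (Inr \<xi>)"
    "\<And>R \<xi> \<eta>. 0 \<le> R \<Longrightarrow> \<xi> \<in> bdry \<Longrightarrow> \<eta> \<in> bdry \<Longrightarrow> ereal (R / 2 - A) \<le> E (Inl (inv (g R (\<xi>, \<eta>)))) (Inr \<eta>)"
    "\<And>R. 0 \<le> R \<Longrightarrow> g R \<in> measurable (PS \<Otimes>\<^sub>M PS) (count_space X)"
    "\<And>R x. 0 \<le> R \<Longrightarrow> x \<in> X \<Longrightarrow> measure (PS \<Otimes>\<^sub>M PS) (g R -` {x} \<inter> space (PS \<Otimes>\<^sub>M PS)) \<le> A * \<omega> powr (- R)"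
proof -
  obtain A p where A: "A \<ge> 0" and p: "\<And>R \<xi>. 0 \<le> R \<Longrightarrow> \<xi> \<in> bdry \<Longrightarrow> p R \<xi> \<in> X"
    "\<And>R \<xi>. 0 \<le> R \<Longrightarrow> \<xi> \<in> bdry \<Longrightarrow> \<bar>len (p R \<xi>) - R / 2\<bar> \<le> A"
    "\<And>R \<xi>. 0 \<le> R \<Longrightarrow> \<xi> \<in> bdry \<Longrightarrow> ereal (R / 2 - A) \<le> E (Inl (p R \<xi>)) (Inr \<xi>)"
    "\<And>R. 0 \<le> R \<Longrightarrow> p R \<in> measurable PS (count_space X)"
    using boundary_projection by blast
  obtain C where C: "C \<ge> 0" "\<And>x y. x \<in> X \<Longrightarrow> y \<in> X \<Longrightarrow> \<exists>a\<in>X. len a \<le> C \<and> len (x \<otimes> a \<otimes> y) \<ge> len x + len y - C"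
    using almost_additive_products[OF nonelementary] by metis
  obtain a where a: "\<And>x y. x \<in> X \<Longrightarrow> y \<in> X \<Longrightarrow> a x y \<in> X"
    "\<And>x y. x \<in> X \<Longrightarrow> y \<in> X \<Longrightarrow> len (a x y) \<le> C"
    "\<And>x y. x \<in> X \<Longrightarrow> y \<in> X \<Longrightarrow> len (x \<otimes> a x y \<otimes> y) \<ge> len x + len y - C"
    using C(2) by metis
  obtain M where M: "M > 0" "\<And>S n. S \<in> sets PS \<Longrightarrow> clustered n S \<Longrightarrow> measure PS S \<le> M * \<omega> powr (- n)"
    using PS_shadow_upper by blast
  define f where "f x y = x \<otimes> a x (inv y) \<otimes> inv y" for x y
  have fX: "f x y \<in> X" if "x \<in> X" "y \<in> X" for x y using that a by (simp add: f_def)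
  have f_len: "len (f x y) \<ge> len x + len y - C" "len (f x y) \<le> len x + len y + C"
    and f_gp: "gp (f x y) x \<ge> len x - C" "gp (inv (f x y)) y \<ge> len y - C"
    if xy: "x \<in> X" "y \<in> X" for x y
  proof -
    let ?a = "a x (inv y)"
    have aX: "?a \<in> X" "len ?a \<le> C" using a xy by auto
    show 1: "len (f x y) \<ge> len x + len y - C"
      using a(3)[of x "inv y"] xy by (simp add: f_def len_inv)
    have ay: "len (?a \<otimes> inv y) \<le> C + len y"
      using len_mult[of ?a "inv y"] aX xy by (simp add: len_inv)
    have d1: "d x (f x y) = len (?a \<otimes> inv y)"
      using dist_mult[of x "?a \<otimes> inv y"] aX xy by (simp add: f_def m_assoc)
    show "len (f x y) \<le> len x + len y + C"
      using triangle[of \<one> x "f x y"] fX xy d1 ay by simp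
    show "gp (f x y) x \<ge> len x - C"
      using gp2[of "f x y" x] 1 d1 ay commute[of x "f x y"] by argo
    have "inv (f x y) = y \<otimes> (inv ?a \<otimes> inv x)"
      using aX xy by (simp add: f_def inv_mult_group m_assoc)
    then have "d y (inv (f x y)) = len (inv ?a \<otimes> inv x)"
      using dist_mult[of y "inv ?a \<otimes> inv x"] aX xy by simp
    also have "\<dots> \<le> C + len x"
      using len_mult[of "inv ?a" "inv x"] aX xy by (simp add: len_inv)
    finally show "gp (inv (f x y)) y \<ge> len y - C"
      using gp2[of "inv (f x y)" y] 1 len_inv[OF fX[OF xy]] commute[of y "inv (f x y)"] by argo
  qed
  define g where "g R = (\<lambda>(\<xi>, \<eta>). f (p R \<xi>) (p R \<eta>))" for R
  define A1 where "A1 = 2 * A + C"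
  define A2 where "A2 = A1 + 2 * \<delta>"
  \<comment> \<open>One factor for each of the two shadows of depth \<open>R / 2 - A2\<close>; the
    remaining powers multiply to \<open>\<omega> powr (- R)\<close>.\<close>
  define A3 where "A3 = (M * \<omega> powr A2)\<^sup>2"
  have A': "0 \<le> A1" "0 \<le> A2" "0 \<le> A3" using A C delta_nonneg by (auto simp: A1_def A2_def A3_def)
  have gpR: "R / 2 - A1 \<le> gp (f (p R \<xi>) (p R \<eta>)) (p R \<xi>)" "R / 2 - A1 \<le> gp (inv (f (p R \<xi>) (p R \<eta>))) (p R \<eta>)"
    if "0 \<le> R" "\<xi> \<in> bdry" "\<eta> \<in> bdry" for R \<xi> \<eta>
  proof -
    note X = p(1)[OF that(1,2)] p(1)[OF that(1,3)]
    show "R / 2 - A1 \<le> gp (f (p R \<xi>) (p R \<eta>)) (p R \<xi>)"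
      using f_gp(1)[OF X] p(2)[OF that(1,2)] A unfolding A1_def by linarith
    show "R / 2 - A1 \<le> gp (inv (f (p R \<xi>) (p R \<eta>))) (p R \<eta>)"
      using f_gp(2)[OF X] p(2)[OF that(1,3)] A unfolding A1_def by linarith
  qed
  have near: "ereal (R / 2 - A1 - \<delta>) \<le> E (Inl z) (Inr \<xi>)"
    if "0 \<le> R" "\<xi> \<in> bdry" "z \<in> X" "R / 2 - A1 \<le> gp z (p R \<xi>)" for R \<xi> z
  proof -
    have 1: "ereal (R / 2 - A1) \<le> E (Inl z) (Inl (p R \<xi>))" using that by simp
    have "ereal (R / 2 - A1) \<le> ereal (R / 2 - A)" using A C by (simp add: A1_def)
    then have 2: "ereal (R / 2 - A1) \<le> E (Inl (p R \<xi>)) (Inr \<xi>)"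
      using p(3)[OF that(1,2)] by (rule order_trans)
    show ?thesis by (rule E_hyp[OF _ _ _ 1 2]) (use that p in auto)
  qed
  define h where "h = max A2 A3"
  have h: "A2 \<le> h" "A3 \<le> h" by (auto simp: h_def)
  have A1h: "A1 + \<delta> \<le> h" using h(1) delta_nonneg by (simp add: A2_def)
  show ?thesis
  proof (rule that[of h g])
    show "h \<ge> 0" using A' h by linarith
    fix R :: real assume R: "0 \<le> R"
    note pm = p(4)[OF R]
    show "g R \<in> measurable (PS \<Otimes>\<^sub>M PS) (count_space X)"
    proof -
      have m1: "(\<lambda>z. p R (fst z)) \<in> measurable (PS \<Otimes>\<^sub>M PS) (count_space X)"
        by (rule measurable_compose[OF measurable_fst pm])
      have m2: "(\<lambda>z. p R (snd z)) \<in> measurable (PS \<Otimes>\<^sub>M PS) (count_space X)"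
        by (rule measurable_compose[OF measurable_snd pm])
      have "(\<lambda>z. f x (p R (snd z))) \<in> measurable (PS \<Otimes>\<^sub>M PS) (count_space X)" if "x \<in> X" for x
        by (rule measurable_compose[OF m2]) (use that fX in simp)
      then have "(\<lambda>z. f (p R (fst z)) (p R (snd z))) \<in> measurable (PS \<Otimes>\<^sub>M PS) (count_space X)"
        by (rule measurable_compose_countable'[OF _ m1 countable_carrier])
      then show ?thesis by (simp add: g_def case_prod_beta)
    qed
    {
      fix \<xi> \<eta> assume \<xi>\<eta>: "\<xi> \<in> bdry" "\<eta> \<in> bdry"
      note X = p(1)[OF R \<xi>\<eta>(1)] p(1)[OF R \<xi>\<eta>(2)]
      have g: "g R (\<xi>, \<eta>) = f (p R \<xi>) (p R \<eta>)" by (simp add: g_def)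
      show gX: "g R (\<xi>, \<eta>) \<in> X" using fX X by (simp add: g)
      show "\<bar>len (g R (\<xi>, \<eta>)) - R\<bar> \<le> h"
        unfolding g using f_len[OF X] p(2)[OF R \<xi>\<eta>(1)] p(2)[OF R \<xi>\<eta>(2)] A1h delta_nonneg
        unfolding A1_def by linarith
      have le: "ereal (R / 2 - h) \<le> ereal (R / 2 - A1 - \<delta>)" using A1h by simp
      show "ereal (R / 2 - h) \<le> E (Inl (g R (\<xi>, \<eta>))) (Inr \<xi>)"
        by (rule order_trans[OF le near]) (use R \<xi>\<eta> gX gpR(1)[OF R \<xi>\<eta>] g in auto)
      show "ereal (R / 2 - h) \<le> E (Inl (inv (g R (\<xi>, \<eta>)))) (Inr \<eta>)"
        by (rule order_trans[OF le near]) (use R \<xi>\<eta> gX gpR(2)[OF R \<xi>\<eta>] g in auto)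
    }
    fix x assume x: "x \<in> X"
    \<comment> \<open>The shadow of \<open>z\<close> at depth about \<open>R / 2\<close>, written as
      a preimage under \<open>p R\<close> so that it is measurable by construction.\<close>
    define S where "S z = p R -` {y \<in> X. R / 2 - A1 \<le> gp z y} \<inter> space PS" for z
    have S_sets: "S z \<in> sets PS" for z
      unfolding S_def using pm by (rule measurable_sets) simp
    have S_bd: "measure PS (S z) \<le> M * \<omega> powr A2 * \<omega> powr (- (R / 2))" if z: "z \<in> X" for z
    proof -
      have "ereal (R / 2 - A2) \<le> EB \<xi> \<eta>" if "\<xi> \<in> S z" "\<eta> \<in> S z" for \<xi> \<eta>
      proof -
        have B: "\<xi> \<in> bdry" "\<eta> \<in> bdry" using that by (auto simp: S_def space_PS)
        have 1: "ereal (R / 2 - A1 - \<delta>) \<le> E (Inr \<xi>) (Inl z)"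
          unfolding E_sym[of "Inr \<xi>"] by (rule near) (use R B z that in \<open>auto simp: S_def\<close>)
        have 2: "ereal (R / 2 - A1 - \<delta>) \<le> E (Inl z) (Inr \<eta>)"
          by (rule near) (use R B z that in \<open>auto simp: S_def\<close>)
        have "ereal (R / 2 - A1 - \<delta> - \<delta>) \<le> EB \<xi> \<eta>"
          by (rule E_hyp[OF _ _ _ 1 2]) (use B z in auto)
        then show ?thesis by (simp add: A2_def algebra_simps)
      qed
      then have "clustered (R / 2 - A2) (S z)"
        by (auto simp: clustered_def S_def space_PS)
      from M(2)[OF S_sets this] have "measure PS (S z) \<le> M * \<omega> powr (A2 + - (R / 2))" by simp
      then show ?thesis by (simp only: powr_add mult.assoc)
    qed
    have "g R -` {x} \<inter> space (PS \<Otimes>\<^sub>M PS) \<subseteq> S x \<times> S (inv x)"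
    proof
      fix z assume z: "z \<in> g R -` {x} \<inter> space (PS \<Otimes>\<^sub>M PS)"
      obtain \<xi> \<eta> where z_eq: "z = (\<xi>, \<eta>)" by (cases z)
      have B: "\<xi> \<in> bdry" "\<eta> \<in> bdry" "f (p R \<xi>) (p R \<eta>) = x"
        using z by (auto simp: z_eq space_pair_measure space_PS g_def)
      show "z \<in> S x \<times> S (inv x)"
        using gpR[OF R B(1,2)] p(1)[OF R] B by (auto simp: z_eq S_def space_PS)
    qed
    then have "measure (PS \<Otimes>\<^sub>M PS) (g R -` {x} \<inter> space (PS \<Otimes>\<^sub>M PS)) \<le> measure (PS \<Otimes>\<^sub>M PS) (S x \<times> S (inv x))"
      by (intro PS2.P.finite_measure_mono pair_measureI S_sets)
    also have "\<dots> = measure PS (S x) * measure PS (S (inv x))"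
      using PS.emeasure_pair_measure_Times[OF S_sets S_sets, of x "inv x"]
      by (simp add: measure_def enn2real_mult)
    also have "\<dots> \<le> (M * \<omega> powr A2 * \<omega> powr (- (R / 2))) * (M * \<omega> powr A2 * \<omega> powr (- (R / 2)))"
      using S_bd x M(1) by (intro mult_mono) auto
    also have "\<dots> = A3 * (\<omega> powr (- (R / 2)) * \<omega> powr (- (R / 2)))"
      by (simp add: A3_def power2_eq_square)
    also have "\<dots> = A3 * \<omega> powr (- R)" by (simp add: powr_add[symmetric])
    also have "\<dots> \<le> h * \<omega> powr (- R)" using h by (intro mult_right_mono) auto
    finally show "measure (PS \<Otimes>\<^sub>M PS) (g R -` {x} \<inter> space (PS \<Otimes>\<^sub>M PS)) \<le> h * \<omega> powr (- R)" .
  qed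
qed

theorem boundary_product_approximation:
  "\<exists>\<mu> :: real \<Rightarrow> 'a measure.
    (\<forall>R\<ge>0. prob_space (\<mu> R) \<and> space (\<mu> R) = carrier G \<and> sets (\<mu> R) = Pow (carrier G)) \<and>
    weak_star_tendsto (completion_square G d K)
      (\<lambda>R. distr (\<mu> R) (borel_of (completion_square G d K)) (pair_with_inverse G))
      (boundary_product_measure G d K (patterson_sullivan G d K \<rho>)) at_top \<and>
    (\<exists>h>0. \<forall>R\<ge>0. measure (\<mu> R) (annulus G d R h) = 1) \<and>
    (\<exists>C>0. \<forall>R\<ge>0. \<forall>g\<in>carrier G. measure (\<mu> R) {g} \<le> C * growth_rate G d powr (- R))"
proof -
  obtain A g where A: "A \<ge> 0" and g:
    "\<And>R \<xi> \<eta>. 0 \<le> R \<Longrightarrow> \<xi> \<in> bdry \<Longrightarrow> \<eta> \<in> bdry \<Longrightarrow> g R (\<xi>, \<eta>) \<in> X"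
    "\<And>R \<xi> \<eta>. 0 \<le> R \<Longrightarrow> \<xi> \<in> bdry \<Longrightarrow> \<eta> \<in> bdry \<Longrightarrow> \<bar>len (g R (\<xi>, \<eta>)) - R\<bar> \<le> A"
    "\<And>R \<xi> \<eta>. 0 \<le> R \<Longrightarrow> \<xi> \<in> bdry \<Longrightarrow> \<eta> \<in> bdry \<Longrightarrow> ereal (R / 2 - A) \<le> E (Inl (g R (\<xi>, \<eta>))) (Inr \<xi>)"
    "\<And>R \<xi> \<eta>. 0 \<le> R \<Longrightarrow> \<xi> \<in> bdry \<Longrightarrow> \<eta> \<in> bdry \<Longrightarrow> ereal (R / 2 - A) \<le> E (Inl (inv (g R (\<xi>, \<eta>)))) (Inr \<eta>)"
    "\<And>R. 0 \<le> R \<Longrightarrow> g R \<in> measurable (PS \<Otimes>\<^sub>M PS) (count_space X)"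
    "\<And>R x. 0 \<le> R \<Longrightarrow> x \<in> X \<Longrightarrow> measure (PS \<Otimes>\<^sub>M PS) (g R -` {x} \<inter> space (PS \<Otimes>\<^sub>M PS)) \<le> A * \<omega> powr (- R)"
    using boundary_pair_element by blast
  let ?P = "PS \<Otimes>\<^sub>M PS"
  let ?T = "completion_square G d K"
  \<comment> \<open>Negative \<open>R\<close> is replaced by 0, so that \<open>\<mu> R\<close> is a
    probability measure for every real \<open>R\<close>; the limit at infinity is not
    affected.\<close>
  define \<mu> where "\<mu> R = distr ?P (count_space X) (g (max 0 R))" for R
  have gm: "g (max 0 R) \<in> measurable ?P (count_space X)" for R by (rule g(5)) simp
  have space_P: "space ?P = bdry \<times> bdry" by (simp add: space_pair_measure space_PS)
  \<comment> \<open>\<open>A\<close> may be 0 while \<open>h\<close> has to be positive, hence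
    \<open>A + 1\<close>.\<close>
  have ann: "measure (\<mu> R) (annulus G d R (A + 1)) = 1" if R: "0 \<le> R" for R
  proof -
    have "measure (\<mu> R) (annulus G d R (A + 1)) = measure ?P (g (max 0 R) -` annulus G d R (A + 1) \<inter> space ?P)"
      unfolding \<mu>_def by (rule measure_distr[OF gm]) (auto simp: annulus_def)
    also have "g (max 0 R) -` annulus G d R (A + 1) \<inter> space ?P = space ?P"
    proof -
      have "g R (\<xi>, \<eta>) \<in> annulus G d R (A + 1)" if "\<xi> \<in> bdry" "\<eta> \<in> bdry" for \<xi> \<eta>
        using g(1)[OF R that] g(2)[OF R that] by (simp add: annulus_def abs_le_iff)
      then show ?thesis using R by (auto simp: space_P max_def)
    qed
    also have "measure ?P (space ?P) = 1" by (rule PS2.P.prob_space)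
    finally show ?thesis .
  qed
  have atoms: "measure (\<mu> R) {x} \<le> (A + 1) * \<omega> powr (- R)" if R: "0 \<le> R" and x: "x \<in> X" for R x
  proof -
    have "measure (\<mu> R) {x} = measure ?P (g (max 0 R) -` {x} \<inter> space ?P)"
      unfolding \<mu>_def by (rule measure_distr[OF gm]) (use x in auto)
    also have "\<dots> \<le> A * \<omega> powr (- R)" using g(6)[OF R x] R by (simp add: max_def)
    also have "\<dots> \<le> (A + 1) * \<omega> powr (- R)" by (intro mult_right_mono) auto
    finally show ?thesis .
  qed
  have weak: "weak_star_tendsto ?T (\<lambda>R. distr (\<mu> R) (borel_of ?T) (pair_with_inverse G))
      (boundary_product_measure G d K PS) at_top"
    unfolding weak_star_tendsto_def
  proof (intro allI impI)
    fix f assume f: "continuous_map ?T euclideanreal f"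
    have fm: "f \<in> borel_measurable (borel_of ?T)" by (rule continuous_imp_borel_of[OF f])
    obtain B where B: "\<And>p q. p \<in> compl \<Longrightarrow> q \<in> compl \<Longrightarrow> \<bar>f (p, q)\<bar> \<le> B"
      using continuous_map_completion_square_bounded[OF f] by blast
    have pm: "pair_with_inverse G \<in> measurable (count_space X) (borel_of ?T)"
      by (auto simp: space_borel_of topspace_completion_square pair_with_inverse_def)
    define u where "u R z = f (pair_with_inverse G (g (max 0 R) z))" for R z
    have um: "u R \<in> borel_measurable ?P" for R
      unfolding u_def[abs_def] by (intro measurable_compose[OF gm] measurable_compose[OF pm] fm)
    have lhs: "(\<integral>x. f x \<partial>distr (\<mu> R) (borel_of ?T) (pair_with_inverse G)) = (\<integral>z. u R z \<partial>?P)" for R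
    proof -
      have "pair_with_inverse G \<in> measurable (\<mu> R) (borel_of ?T)" using pm by (simp add: \<mu>_def)
      then have "(\<integral>x. f x \<partial>distr (\<mu> R) (borel_of ?T) (pair_with_inverse G)) = (\<integral>x. f (pair_with_inverse G x) \<partial>\<mu> R)"
        using fm by (rule integral_distr)
      also have "\<dots> = (\<integral>z. u R z \<partial>?P)"
        unfolding \<mu>_def u_def by (rule integral_distr[OF gm]) (rule measurable_compose[OF pm fm])
      finally show ?thesis .
    qed
    have rhs: "(\<integral>x. f x \<partial>boundary_product_measure G d K PS) = (\<integral>z. f (map_prod Inr Inr z) \<partial>?P)"
      unfolding boundary_product_measure_def
      by (rule integral_distr[OF boundary_embedding_measurable fm])
    have bound: "norm (u R z) \<le> B" if zP: "z \<in> space ?P" for R z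
    proof -
      obtain \<xi> \<eta> where z: "z = (\<xi>, \<eta>)" "\<xi> \<in> bdry" "\<eta> \<in> bdry" using zP by (auto simp: space_P)
      have "g (max 0 R) z \<in> X" using g(1)[of "max 0 R" \<xi> \<eta>] z by simp
      then show ?thesis by (simp add: u_def pair_with_inverse_def B)
    qed
    have lim: "((\<lambda>R. u R z) \<longlongrightarrow> f (map_prod Inr Inr z)) at_top" if zP: "z \<in> space ?P" for z
    proof -
      obtain \<xi> \<eta> where z: "z = (\<xi>, \<eta>)" "\<xi> \<in> bdry" "\<eta> \<in> bdry" using zP by (auto simp: space_P)
      \<comment> \<open>The topology of the compactification is defined by sequences, so the limit
        in the real parameter is tested along sequences.\<close>
      show "((\<lambda>R. u R z) \<longlongrightarrow> f (map_prod Inr Inr z)) at_top"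
      proof (rule tendsto_at_topI_sequentially)
        fix Y :: "nat \<Rightarrow> real" assume Y: "filterlim Y at_top sequentially"
        have ev: "\<forall>\<^sub>F n in sequentially. r \<le> max 0 (Y n) / 2 - A" for r
        proof -
          have "\<forall>\<^sub>F n in sequentially. 2 * (r + A) \<le> Y n" using Y by (simp add: filterlim_at_top)
          then show ?thesis by eventually_elim auto
        qed
        let ?g = "\<lambda>n. g (max 0 (Y n)) z"
        have gX: "?g n \<in> X" for n using g(1)[of "max 0 (Y n)" \<xi> \<eta>] z by simp
        have "limitin CT (\<lambda>n. Inl (?g n)) (Inr \<xi>) sequentially"
        proof (rule limitin_boundary)
          fix r
          show "\<forall>\<^sub>F n in sequentially. ereal r \<le> E (Inl (?g n)) (Inr \<xi>)"
            using ev[of r]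
          proof eventually_elim
            case (elim n)
            then have "ereal r \<le> ereal (max 0 (Y n) / 2 - A)" by simp
            also have "\<dots> \<le> E (Inl (?g n)) (Inr \<xi>)" unfolding z(1) by (rule g(3)) (use z in auto)
            finally show ?case .
          qed
        qed (use gX z in auto)
        moreover have "limitin CT (\<lambda>n. Inl (inv (?g n))) (Inr \<eta>) sequentially"
        proof (rule limitin_boundary)
          fix r
          show "\<forall>\<^sub>F n in sequentially. ereal r \<le> E (Inl (inv (?g n))) (Inr \<eta>)"
            using ev[of r]
          proof eventually_elim
            case (elim n)
            then have "ereal r \<le> ereal (max 0 (Y n) / 2 - A)" by simp
            also have "\<dots> \<le> E (Inl (inv (?g n))) (Inr \<eta>)" unfolding z(1) by (rule g(4)) (use z in auto)
            finally show ?case .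
          qed
        qed (use gX z in auto)
        ultimately have "(\<lambda>n. f (Inl (?g n), Inl (inv (?g n)))) \<longlonglongrightarrow> f (Inr \<xi>, Inr \<eta>)"
          by (rule continuous_map_completion_square_limit[OF f])
        then show "(\<lambda>n. u (Y n) z) \<longlonglongrightarrow> f (map_prod Inr Inr z)"
          by (simp add: u_def pair_with_inverse_def z(1))
      qed
    qed
    have "((\<lambda>R. \<integral>z. u R z \<partial>?P) \<longlongrightarrow> (\<integral>z. f (map_prod Inr Inr z) \<partial>?P)) at_top"
    proof (rule integral_dominated_convergence_at_top[where w = "\<lambda>_. B"])
      show "(\<lambda>z. f (map_prod Inr Inr z)) \<in> borel_measurable ?P"
        by (rule measurable_compose[OF boundary_embedding_measurable fm])
      show "u t \<in> borel_measurable ?P" for t by (rule um)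
      show "integrable ?P (\<lambda>_. B)" by simp
      show "AE z in ?P. ((\<lambda>R. u R z) \<longlongrightarrow> f (map_prod Inr Inr z)) at_top"
        by (intro AE_I2 lim)
      show "\<forall>\<^sub>F R in at_top. AE z in ?P. norm (u R z) \<le> B"
        by (intro always_eventually allI AE_I2 bound)
    qed
    then show "((\<lambda>R. \<integral>x. f x \<partial>distr (\<mu> R) (borel_of ?T) (pair_with_inverse G)) \<longlongrightarrow>
        (\<integral>x. f x \<partial>boundary_product_measure G d K PS)) at_top"
      by (simp only: lhs rhs)
  qed
  have prob: "prob_space (\<mu> R)" for R
    unfolding \<mu>_def by (rule PS2.P.prob_space_distr[OF gm])
  have sp: "space (\<mu> R) = X" "sets (\<mu> R) = Pow X" for R
    by (simp_all add: \<mu>_def)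
  show ?thesis
  proof (intro exI[of _ \<mu>] conjI weak)
    show "\<forall>R\<ge>0. prob_space (\<mu> R) \<and> space (\<mu> R) = X \<and> sets (\<mu> R) = Pow X"
      using prob sp by simp
    show "\<exists>h>0. \<forall>R\<ge>0. measure (\<mu> R) (annulus G d R h) = 1"
      using ann A by (intro exI[of _ "A + 1"]) auto
    show "\<exists>C>0. \<forall>R\<ge>0. \<forall>g\<in>X. measure (\<mu> R) {g} \<le> C * growth_rate G d powr (- R)"
      using atoms A unfolding \<omega>_def by (intro exI[of _ "A + 1"]) auto
  qed
qed

end

subsection \<open>Word metrics\<close>

lemma (in group) generate_imp_word:
  assumes "S \<subseteq> carrier G" "g \<in> generate G S"
  shows "\<exists>ws. set ws \<subseteq> S \<union> m_inv G ` S \<and> foldr (mult G) ws \<one> = g"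
  using assms(2)
proof (induction rule: generate.induct)
  case one
  then show ?case by (intro exI[of _ "[]"]) simp
next
  case (incl h)
  then show ?case using assms(1) by (intro exI[of _ "[h]"]) auto
next
  case (inv h)
  then show ?case using assms(1) by (intro exI[of _ "[inv h]"]) auto
next
  case (eng h1 h2)
  then obtain ws vs where ws: "set ws \<subseteq> S \<union> m_inv G ` S" "foldr (mult G) ws \<one> = h1"
    and vs: "set vs \<subseteq> S \<union> m_inv G ` S" "foldr (mult G) vs \<one> = h2" by blast
  have h2: "h2 \<in> carrier G" using eng(2) generate_in_carrier assms(1) by blast
  have "foldr (mult G) ws \<one> \<in> carrier G \<and> foldr (mult G) ws h2 = foldr (mult G) ws \<one> \<otimes> h2"
    using ws(1)
  proof (induction ws)
    case (Cons w ws)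
    moreover have "w \<in> carrier G" using Cons.prems assms(1) by auto
    ultimately show ?case using h2 by (simp add: m_assoc)
  qed (use h2 in simp)
  then have "foldr (mult G) (ws @ vs) \<one> = h1 \<otimes> h2" using ws vs by simp
  then show ?case using ws vs by (intro exI[of _ "ws @ vs"]) auto
qed

text \<open>\<open>word_length\<close> is a \<open>LEAST\<close>, attained because \<open>S\<close>
  generates the group and so every element has some word. Balls are then images of finite sets of
  words.\<close>

lemma (in group) finite_word_ball:
  assumes "finite_generating_set G S"
  shows "finite {g \<in> carrier G. word_length G S g \<le> n}"
proof -
  have S: "finite S" "S \<subseteq> carrier G" "generate G S = carrier G"
    using assms by (auto simp: finite_generating_set_def)
  define L where "L = {ws. set ws \<subseteq> S \<union> m_inv G ` S \<and> length ws \<le> n}"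
  have "{g \<in> carrier G. word_length G S g \<le> n} \<subseteq> (\<lambda>ws. foldr (mult G) ws \<one>) ` L"
  proof
    fix g assume g: "g \<in> {g \<in> carrier G. word_length G S g \<le> n}"
    then obtain ws where "set ws \<subseteq> S \<union> m_inv G ` S" "foldr (mult G) ws \<one> = g"
      using generate_imp_word[OF S(2)] S(3) by blast
    then have "\<exists>m ws. length ws = m \<and> set ws \<subseteq> S \<union> m_inv G ` S \<and> foldr (mult G) ws \<one> = g" by blast
    from LeastI_ex[OF this] obtain vs where "length vs = word_length G S g"
      "set vs \<subseteq> S \<union> m_inv G ` S" "foldr (mult G) vs \<one> = g"
      unfolding word_length_def by blast
    then show "g \<in> (\<lambda>ws. foldr (mult G) ws \<one>) ` L" using g by (auto simp: L_def)
  qed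
  moreover have "finite L" unfolding L_def using S(1) by (intro finite_lists_length_le) auto
  ultimately show ?thesis using finite_subset by blast
qed

lemma group_metrics_rough_hyperbolic:
  fixes G (structure)
  assumes "group G" "d \<in> group_metrics G" "roughly_geodesic_space (carrier G) d K"
  obtains \<delta> where "rough_hyperbolic_group G d K \<delta>"
proof -
  interpret group G by fact
  have d: "Metric_space (carrier G) d" "hyperbolic_metric G d"
    "\<And>g x y. g \<in> carrier G \<Longrightarrow> x \<in> carrier G \<Longrightarrow> y \<in> carrier G \<Longrightarrow> d (g \<otimes> x) (g \<otimes> y) = d x y"
    using assms(2) by (auto simp: group_metrics_def)
  interpret Metric_space "carrier G" d by (rule d(1))
  obtain S where S: "finite_generating_set G S" "quasi_isometric_metrics (carrier G) d (word_metric G S)"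
    using assms(2) by (auto simp: group_metrics_def)
  obtain L C where LC: "L \<ge> 1" "\<And>x y. x \<in> carrier G \<Longrightarrow> y \<in> carrier G \<Longrightarrow> inverse L * word_metric G S x y - C \<le> d x y"
    using S(2) unfolding quasi_isometric_metrics_def by blast
  obtain \<delta>0 where \<delta>0: "\<And>x y z. x \<in> carrier G \<Longrightarrow> y \<in> carrier G \<Longrightarrow> z \<in> carrier G \<Longrightarrow>
      gromov_product G d x y \<ge> min (gromov_product G d x z) (gromov_product G d z y) - \<delta>0"
    using d(2) unfolding hyperbolic_metric_def by blast
  have "finite {g \<in> carrier G. d \<one> g \<le> r}" for r
  proof (rule finite_subset)
    show "{g \<in> carrier G. d \<one> g \<le> r} \<subseteq> {g \<in> carrier G. word_length G S g \<le> nat \<lceil>L * (r + C)\<rceil>}"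
    proof
      fix g assume "g \<in> {g \<in> carrier G. d \<one> g \<le> r}"
      then have g: "g \<in> carrier G" "d \<one> g \<le> r" by auto
      have "inverse L * real (word_length G S g) - C \<le> r"
        using LC(2)[of \<one> g] g by (simp add: word_metric_def)
      then have "real (word_length G S g) \<le> L * (r + C)" using LC(1) by (simp add: field_simps)
      then have "word_length G S g \<le> nat \<lceil>L * (r + C)\<rceil>" by linarith
      then show "g \<in> {g \<in> carrier G. word_length G S g \<le> nat \<lceil>L * (r + C)\<rceil>}"
        using g(1) by simp
    qed
  qed (rule finite_word_ball[OF S(1)])
  \<comment> \<open>\<open>hyperbolic_metric\<close> states no sign for its constant, while the
    locale asks for a nonnegative one.\<close>
  then have "rough_hyperbolic_group G d K (max 0 \<delta>0)"
    by unfold_locales (use d(3) \<delta>0 assms(3) in \<open>force simp: min_def max_def\<close>)+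
  then show ?thesis using that by blast
qed

theorem theorem3p2:
  fixes G :: "('a, 'b) monoid_scheme" and d :: "'a \<Rightarrow> 'a \<Rightarrow> real"
    and K \<epsilon> :: real and \<rho> :: "(real \<Rightarrow> 'a) set \<Rightarrow> (real \<Rightarrow> 'a) set \<Rightarrow> real"
  assumes "hyperbolic_group G" and "\<not> virtually_cyclic G"
    and "d \<in> group_metrics G"
    and "roughly_geodesic_space (carrier G) d K"
    and "\<epsilon> > 0" and "visual_metric G d K \<epsilon> \<rho>"
  shows "\<exists>\<mu> :: real \<Rightarrow> 'a measure.
    (\<forall>R\<ge>0. prob_space (\<mu> R) \<and> space (\<mu> R) = carrier G \<and> sets (\<mu> R) = Pow (carrier G)) \<and>
    weak_star_tendsto (completion_square G d K)
      (\<lambda>R. distr (\<mu> R) (borel_of (completion_square G d K)) (pair_with_inverse G))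
      (boundary_product_measure G d K (patterson_sullivan G d K \<rho>)) at_top \<and>
    (\<exists>h>0. \<forall>R\<ge>0. measure (\<mu> R) (annulus G d R h) = 1) \<and>
    (\<exists>C>0. \<forall>R\<ge>0. \<forall>g\<in>carrier G. measure (\<mu> R) {g} \<le> C * growth_rate G d powr (- R))"
proof -
  have "group G" using assms(1) by (simp add: hyperbolic_group_def)
  then obtain \<delta> where "rough_hyperbolic_group G d K \<delta>"
    using group_metrics_rough_hyperbolic assms(3,4) by metis
  then interpret rough_hyperbolic_group G d K \<delta> .
  obtain Cv where Cv: "Cv > 0" "\<And>\<xi> \<eta>. \<lbrakk>\<xi> \<in> bdry; \<eta> \<in> bdry\<rbrakk> \<Longrightarrow>
      inverse Cv * exp_neg_mult \<epsilon> (E (Inr \<xi>) (Inr \<eta>)) \<le> \<rho> \<xi> \<eta> \<and>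
      \<rho> \<xi> \<eta> \<le> Cv * exp_neg_mult \<epsilon> (E (Inr \<xi>) (Inr \<eta>))"
    using assms(6) unfolding visual_metric_def by metis
  have metric: "Metric_space bdry \<rho>" using assms(6) by (simp add: visual_metric_def)
  interpret visual_boundary G d K \<delta> \<epsilon> Cv \<rho>
    by (intro visual_boundary.intro nonelementary_hyperbolic_group.intro rough_hyperbolic_group_axioms
        nonelementary_hyperbolic_group_axioms.intro visual_boundary_axioms.intro)
      (use assms(2,5) Cv metric in auto)
  show ?thesis by (rule boundary_product_approximation)
qed

end
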